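(* Let $(X,d)$ be a separable ultra-metric space in which all closed balls are compact, let $\mu$ be a Radon measure on $X$ with full support, let $\sigma$ be a distance distribution function, and let $P=\int_{[0,\infty)}\mathrm{Q}_r\,d\sigma(r)$, a self-adjoint operator in $L^2(X,\mu)$ with spectrum in $[0,1]$. For $t>0$ let $P^t$ be the power of $P$ in the sense of functional calculus, and let $P^0=\mathrm{id}$. Then: (a) The family $\{P^t\}_{t\ge 0}$ is a strongly continuous symmetric Markov semigroup on $L^2(X,\mu)$. (b) For any $t>0$, the operator $P^t$ has the representation $$P^tf=\int_{[0,\infty)}\mathrm{Q}_rf\,d\sigma^t(r).$$ (c) For any $t>0$, the operator $P^t$ admits an integral kernel $p(t,x,y)$, that is, for all bounded Borel functions $f$ (pointwise for all $x\in X$) and for all $f\in L^2(X,\mu)$ (for $\mu$-almost all $x$), $$P^tf(x)=\int_X p(t,x,y)f(y)\,d\mu(y),$$ where $p(t,x,y)\in[0,\infty]$ is given by $$p(t,x,y)=\int_{[d(x,y),\infty)}\frac{d\sigma^t(r)}{\mu(B_r(x))}.$$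
   Context: An ultra-metric space is a metric space with $d(x,y)\le\max\{d(x,z),d(z,y)\}$. Closed balls: $B_r(x)=\{y\in X:d(x,y)\le r\}$. Averaging operators: for $r>0$, $\mathrm{Q}_rf(x)=\frac1{\mu(B_r(x))}\int_{B_r(x)}f\,d\mu$, and $\mathrm{Q}_0=\mathrm{id}$. Each $\mathrm{Q}_r$ acts on bounded Borel functions and is an orthogonal projector in $L^2(X,\mu)$. A distance distribution function is a strictly increasing left-continuous function $\sigma:[0,\infty]\to[0,1]$ with $\sigma(0+)=0$ and $\sigma(\infty)=1$. Integrals $\int\cdots d\sigma(r)$ and $\int\cdots d\sigma^t(r)$ are Lebesgue–Stieltjes integrals, where $\sigma^t(r)=(\sigma(r))^t$; on $L^2$ they converge in the strong operator topology, and on bounded Borel functions they are understood pointwise (for bounded Borel $f$, $P^tf$ is given by the pointwise integral in (b)). A bounded operator $A$ on $L^2(X,\mu)$ is Markov if $f\ge0$ implies $Af\ge 0$ and, acting on bounded Borel functions, $A1=1$; a semigroup is symmetric Markov if it consists of self-adjoint Markov operators. *)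

theory Defs
  imports "HOL-Analysis.Analysis" "HOL-Computational_Algebra.Polynomial"
begin

section \<open>The space and the measure\<close>

definition ultrametric :: "'a::metric_space itself \<Rightarrow> bool" where
  "ultrametric _ \<longleftrightarrow> (\<forall>x y z :: 'a. dist x y \<le> max (dist x z) (dist z y))"

definition radon_measure :: "'a::topological_space measure \<Rightarrow> bool" where
  "radon_measure \<mu> \<longleftrightarrow>
     sets \<mu> = sets borel \<and>
     (\<forall>x. \<exists>U. open U \<and> x \<in> U \<and> emeasure \<mu> U < \<infinity>) \<and>
     (\<forall>A\<in>sets borel. emeasure \<mu> A = (SUP K\<in>{K. compact K \<and> K \<subseteq> A}. emeasure \<mu> K))"

definition full_support :: "'a::topological_space measure \<Rightarrow> bool" where
  "full_support \<mu> \<longleftrightarrow> (\<forall>U. open U \<and> U \<noteq> {} \<longrightarrow> emeasure \<mu> U > 0)"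

definition bounded_borel :: "('a::topological_space \<Rightarrow> real) \<Rightarrow> bool" where
  "bounded_borel f \<longleftrightarrow> f \<in> borel_measurable borel \<and> bounded (range f)"


section \<open>Operators on real $L^2$\<close>

text \<open>
  Elements of $L^2$ are represented by square-integrable functions, and an operator on $L^2$ by
  a map on representatives. Identities in $L^2$ are stated almost everywhere. That an operator
  does not depend on the representative follows from linearity and boundedness.
\<close>

definition L2 :: "'a measure \<Rightarrow> ('a \<Rightarrow> real) set" where
  "L2 \<mu> = {f \<in> borel_measurable \<mu>. integrable \<mu> (\<lambda>x. (f x)\<^sup>2)}"

definition L2_inner :: "'a measure \<Rightarrow> ('a \<Rightarrow> real) \<Rightarrow> ('a \<Rightarrow> real) \<Rightarrow> real" where
  "L2_inner \<mu> f g = (\<integral>x. f x * g x \<partial>\<mu>)"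

definition L2_norm :: "'a measure \<Rightarrow> ('a \<Rightarrow> real) \<Rightarrow> real" where
  "L2_norm \<mu> f = sqrt (L2_inner \<mu> f f)"

definition L2_operator :: "'a measure \<Rightarrow> (('a \<Rightarrow> real) \<Rightarrow> ('a \<Rightarrow> real)) \<Rightarrow> bool" where
  "L2_operator \<mu> A \<longleftrightarrow>
     (\<forall>f\<in>L2 \<mu>. A f \<in> L2 \<mu>) \<and>
     (\<forall>f\<in>L2 \<mu>. \<forall>g\<in>L2 \<mu>. AE x in \<mu>. A (\<lambda>y. f y + g y) x = A f x + A g x) \<and>
     (\<forall>f\<in>L2 \<mu>. \<forall>c. AE x in \<mu>. A (\<lambda>y. c * f y) x = c * A f x) \<and>
     (\<exists>C. \<forall>f\<in>L2 \<mu>. L2_norm \<mu> (A f) \<le> C * L2_norm \<mu> f)"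

definition L2_selfadjoint :: "'a measure \<Rightarrow> (('a \<Rightarrow> real) \<Rightarrow> ('a \<Rightarrow> real)) \<Rightarrow> bool" where
  "L2_selfadjoint \<mu> A \<longleftrightarrow>
     L2_operator \<mu> A \<and> (\<forall>f\<in>L2 \<mu>. \<forall>g\<in>L2 \<mu>. L2_inner \<mu> (A f) g = L2_inner \<mu> f (A g))"

text \<open>
  Only real points of the spectrum are considered, which for a self-adjoint operator is the
  whole spectrum of its complexification.
\<close>

definition L2_spectrum :: "'a measure \<Rightarrow> (('a \<Rightarrow> real) \<Rightarrow> ('a \<Rightarrow> real)) \<Rightarrow> real set" where
  "L2_spectrum \<mu> A =
     {l. \<not> (\<exists>R. L2_operator \<mu> R \<and>
            (\<forall>f\<in>L2 \<mu>. (AE x in \<mu>. R (\<lambda>y. A f y - l * f y) x = f x) \<and>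
                      (AE x in \<mu>. A (R f) x - l * R f x = f x)))}"

definition op_poly ::
  "real poly \<Rightarrow> (('a \<Rightarrow> real) \<Rightarrow> ('a \<Rightarrow> real)) \<Rightarrow> (('a \<Rightarrow> real) \<Rightarrow> ('a \<Rightarrow> real))" where
  "op_poly p A f = (\<lambda>x. \<Sum>i\<le>degree p. coeff p i * (A ^^ i) f x)"

definition L2_op_tendsto ::
  "'a measure \<Rightarrow> (nat \<Rightarrow> ('a \<Rightarrow> real) \<Rightarrow> ('a \<Rightarrow> real)) \<Rightarrow> (('a \<Rightarrow> real) \<Rightarrow> ('a \<Rightarrow> real)) \<Rightarrow> bool" where
  "L2_op_tendsto \<mu> B A \<longleftrightarrow>
     (\<forall>e>0. \<forall>\<^sub>F n in sequentially.
        \<forall>f\<in>L2 \<mu>. L2_norm \<mu> (\<lambda>x. B n f x - A f x) \<le> e * L2_norm \<mu> f)"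

text \<open>
  Continuous functional calculus of a self-adjoint operator \<open>A\<close>: \<open>B\<close> is \<open>\<phi>(A)\<close> if it is the
  limit in operator norm of \<open>p\<^sub>n(A)\<close>, where the polynomials \<open>p\<^sub>n\<close> converge to \<open>\<phi>\<close> uniformly on the
  spectrum. Since the norm of \<open>p(A)\<close> is the maximum of the modulus of \<open>p\<close> on the spectrum, the
  limit does not depend on the choice of the sequence.
\<close>

definition is_fun_calc ::
  "'a measure \<Rightarrow> (('a \<Rightarrow> real) \<Rightarrow> ('a \<Rightarrow> real)) \<Rightarrow> (real \<Rightarrow> real) \<Rightarrow> (('a \<Rightarrow> real) \<Rightarrow> ('a \<Rightarrow> real)) \<Rightarrow> bool"
  where
  "is_fun_calc \<mu> A \<phi> B \<longleftrightarrow>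
     L2_operator \<mu> B \<and>
     (\<exists>p :: nat \<Rightarrow> real poly.
        uniform_limit (L2_spectrum \<mu> A) (\<lambda>n. poly (p n)) \<phi> sequentially \<and>
        L2_op_tendsto \<mu> (\<lambda>n. op_poly (p n) A) B)"

definition fun_calc ::
  "'a measure \<Rightarrow> (('a \<Rightarrow> real) \<Rightarrow> ('a \<Rightarrow> real)) \<Rightarrow> (real \<Rightarrow> real) \<Rightarrow> (('a \<Rightarrow> real) \<Rightarrow> ('a \<Rightarrow> real))" where
  "fun_calc \<mu> A \<phi> = (SOME B. is_fun_calc \<mu> A \<phi> B)"

text \<open>
  Bochner integral of an $L^2$-valued function: the library's \<^const>\<open>has_bochner_integral\<close> written
  out with the norm of $L^2$, which is not a type here.
\<close>

definition has_L2_integral ::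
  "'a measure \<Rightarrow> 'b measure \<Rightarrow> ('b \<Rightarrow> 'a \<Rightarrow> real) \<Rightarrow> ('a \<Rightarrow> real) \<Rightarrow> bool" where
  "has_L2_integral \<mu> \<nu> F g \<longleftrightarrow>
     (\<forall>r\<in>space \<nu>. F r \<in> L2 \<mu>) \<and> g \<in> L2 \<mu> \<and>
     (\<exists>s :: nat \<Rightarrow> 'b \<Rightarrow> 'a \<Rightarrow> real.
        (\<forall>n. simple_function \<nu> (s n) \<and> (\<forall>r\<in>space \<nu>. s n r \<in> L2 \<mu>) \<and>
             emeasure \<nu> {r\<in>space \<nu>. s n r \<noteq> (\<lambda>_. 0)} < \<infinity> \<and>
             (\<lambda>r. L2_norm \<mu> (\<lambda>x. F r x - s n r x)) \<in> borel_measurable \<nu>) \<and>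
        (\<lambda>n. \<integral>\<^sup>+ r. ennreal (L2_norm \<mu> (\<lambda>x. F r x - s n r x)) \<partial>\<nu>) \<longlonglongrightarrow> 0 \<and>
        (\<lambda>n. L2_norm \<mu> (\<lambda>x. (\<Sum>v\<in>s n ` space \<nu>. measure \<nu> {r\<in>space \<nu>. s n r = v} * v x) - g x))
          \<longlonglongrightarrow> 0)"

definition has_strong_integral ::
  "'a measure \<Rightarrow> 'b measure \<Rightarrow> ('b \<Rightarrow> ('a \<Rightarrow> real) \<Rightarrow> ('a \<Rightarrow> real)) \<Rightarrow> (('a \<Rightarrow> real) \<Rightarrow> ('a \<Rightarrow> real)) \<Rightarrow> bool"
  where
  "has_strong_integral \<mu> \<nu> T B \<longleftrightarrow>
     L2_operator \<mu> B \<and> (\<forall>f\<in>L2 \<mu>. has_L2_integral \<mu> \<nu> (\<lambda>r. T r f) (B f))"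

definition strong_integral ::
  "'a measure \<Rightarrow> 'b measure \<Rightarrow> ('b \<Rightarrow> ('a \<Rightarrow> real) \<Rightarrow> ('a \<Rightarrow> real)) \<Rightarrow> (('a \<Rightarrow> real) \<Rightarrow> ('a \<Rightarrow> real))" where
  "strong_integral \<mu> \<nu> T = (SOME B. has_strong_integral \<mu> \<nu> T B)"


section \<open>Markov semigroups\<close>

text \<open>
  An operator comes as a pair: \<open>A\<close> acts on $L^2$ and \<open>A'\<close> acts pointwise on bounded Borel
  functions; both have to agree on the functions that lie in both domains.
\<close>

definition markov_operator ::
  "'a::topological_space measure \<Rightarrow> (('a \<Rightarrow> real) \<Rightarrow> ('a \<Rightarrow> real)) \<Rightarrow> (('a \<Rightarrow> real) \<Rightarrow> ('a \<Rightarrow> real)) \<Rightarrow> bool"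
  where
  "markov_operator \<mu> A A' \<longleftrightarrow>
     L2_operator \<mu> A \<and>
     (\<forall>f. bounded_borel f \<longrightarrow> bounded_borel (A' f)) \<and>
     (\<forall>f\<in>L2 \<mu>. bounded_borel f \<longrightarrow> (AE x in \<mu>. A f x = A' f x)) \<and>
     (\<forall>f\<in>L2 \<mu>. (AE x in \<mu>. f x \<ge> 0) \<longrightarrow> (AE x in \<mu>. A f x \<ge> 0)) \<and>
     (\<forall>f. bounded_borel f \<and> (\<forall>x. f x \<ge> 0) \<longrightarrow> (\<forall>x. A' f x \<ge> 0)) \<and>
     (\<forall>x. A' (\<lambda>_. 1) x = 1)"

definition symmetric_markov_semigroup ::
  "'a::topological_space measure \<Rightarrow> (real \<Rightarrow> ('a \<Rightarrow> real) \<Rightarrow> ('a \<Rightarrow> real)) \<Rightarrow>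
   (real \<Rightarrow> ('a \<Rightarrow> real) \<Rightarrow> ('a \<Rightarrow> real)) \<Rightarrow> bool" where
  "symmetric_markov_semigroup \<mu> T T' \<longleftrightarrow>
     (\<forall>t\<ge>0. L2_selfadjoint \<mu> (T t) \<and> markov_operator \<mu> (T t) (T' t)) \<and>
     (\<forall>f\<in>L2 \<mu>. AE x in \<mu>. T 0 f x = f x) \<and>
     (\<forall>s\<ge>0. \<forall>t\<ge>0. \<forall>f\<in>L2 \<mu>. AE x in \<mu>. T (s + t) f x = T s (T t f) x)"

definition strongly_continuous ::
  "'a measure \<Rightarrow> (real \<Rightarrow> ('a \<Rightarrow> real) \<Rightarrow> ('a \<Rightarrow> real)) \<Rightarrow> bool" where
  "strongly_continuous \<mu> T \<longleftrightarrow>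
     (\<forall>f\<in>L2 \<mu>. \<forall>s\<ge>0. ((\<lambda>t. L2_norm \<mu> (\<lambda>x. T t f x - T s f x)) \<longlongrightarrow> 0) (at s within {0..}))"


section \<open>Distance distribution functions and Stieltjes measures\<close>

text \<open>
  \<open>[0,\<infinity>]\<close> is the type \<^typ>\<open>ennreal\<close>. Left continuity includes the point \<open>\<infinity>\<close>; at \<open>0\<close> it is void.
\<close>

definition distance_distribution :: "(ennreal \<Rightarrow> real) \<Rightarrow> bool" where
  "distance_distribution \<sigma> \<longleftrightarrow>
     range \<sigma> \<subseteq> {0..1} \<and> strict_mono \<sigma> \<and>
     (\<forall>r. (\<sigma> \<longlongrightarrow> \<sigma> r) (at_left r)) \<and>
     (\<sigma> \<longlongrightarrow> 0) (at_right 0) \<and> \<sigma> \<infinity> = 1"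

text \<open>
  Lebesgue-Stieltjes measure on \<open>[0,\<infinity>)\<close> of a nondecreasing left-continuous \<open>G\<close>, which gives
  \<open>[a,b)\<close> the mass \<open>G b - G a\<close>. Since \<^const>\<open>interval_measure\<close> is for right-continuous functions,
  \<open>G\<close> is reflected at the origin.
\<close>

definition stieltjes_measure :: "(real \<Rightarrow> real) \<Rightarrow> real measure" where
  "stieltjes_measure G =
     restrict_space (distr (interval_measure (\<lambda>s. - G (- s))) borel uminus) {0..}"

lemma emeasure_stieltjes_measure:
  assumes mono: "\<And>x y. x \<le> y \<Longrightarrow> G x \<le> G y"
    and cont: "\<And>x. continuous (at_left x) G"
    and "0 \<le> a" "a \<le> b"
  shows "emeasure (stieltjes_measure G) {a..<b} = ennreal (G b - G a)"
proof -
  have c: "continuous (at_right x) (\<lambda>s. - G (- s))" for x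
  proof -
    have "(G \<longlongrightarrow> G (- x)) (at_left (- x))"
      using cont[of "- x"] by (simp add: continuous_within)
    then have "((\<lambda>s. G (- s)) \<longlongrightarrow> G (- x)) (at_right x)"
      by (subst (asm) at_left_minus) (simp add: filterlim_filtermap)
    then show ?thesis
      by (auto simp: continuous_within intro!: tendsto_minus)
  qed
  have "emeasure (stieltjes_measure G) {a..<b} =
      emeasure (distr (interval_measure (\<lambda>s. - G (- s))) borel uminus) {a..<b}"
    unfolding stieltjes_measure_def using \<open>0 \<le> a\<close>
    by (intro emeasure_restrict_space) auto
  also have "\<dots> = emeasure (interval_measure (\<lambda>s. - G (- s))) {- b<..- a}"
  proof -
    have "uminus -` {a..<b} = {- b<..- a}" by auto
    then show ?thesis by (subst emeasure_distr) auto
  qed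
  also have "\<dots> = ennreal (G b - G a)"
    using \<open>a \<le> b\<close> mono c by (subst emeasure_interval_measure_Ioc) auto
  finally show ?thesis .
qed

text \<open>
  The measure \<open>d\<sigma>\<^sup>t\<close> on \<open>[0,\<infinity>)\<close>. The integrator vanishes on \<open>(-\<infinity>,0]\<close>, because
  \<^term>\<open>ennreal r = 0\<close> for \<^term>\<open>r \<le> 0\<close> and a distance distribution function vanishes at \<open>0\<close>.
\<close>

definition sigma_pow :: "(ennreal \<Rightarrow> real) \<Rightarrow> real \<Rightarrow> real measure" where
  "sigma_pow \<sigma> t = stieltjes_measure (\<lambda>r. \<sigma> (ennreal r) powr t)"


section \<open>The isotropic semigroup\<close>

definition avg ::
  "'a::metric_space measure \<Rightarrow> real \<Rightarrow> ('a \<Rightarrow> real) \<Rightarrow> ('a \<Rightarrow> real)" where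
  "avg \<mu> r f x =
     (if r > 0 then (1 / measure \<mu> (cball x r)) * (\<integral>y\<in>cball x r. f y \<partial>\<mu>) else f x)"

definition iso_op ::
  "'a::metric_space measure \<Rightarrow> (ennreal \<Rightarrow> real) \<Rightarrow> ('a \<Rightarrow> real) \<Rightarrow> ('a \<Rightarrow> real)" where
  "iso_op \<mu> \<sigma> = strong_integral \<mu> (stieltjes_measure (\<lambda>r. \<sigma> (ennreal r))) (avg \<mu>)"

definition iso_power ::
  "'a::metric_space measure \<Rightarrow> (ennreal \<Rightarrow> real) \<Rightarrow> real \<Rightarrow> ('a \<Rightarrow> real) \<Rightarrow> ('a \<Rightarrow> real)" where
  "iso_power \<mu> \<sigma> t = (if t = 0 then id else fun_calc \<mu> (iso_op \<mu> \<sigma>) (\<lambda>l. l powr t))"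

text \<open>The action of \<open>P\<^sup>t\<close> on bounded Borel functions, by the pointwise integral.\<close>

definition iso_power_bdd ::
  "'a::metric_space measure \<Rightarrow> (ennreal \<Rightarrow> real) \<Rightarrow> real \<Rightarrow> ('a \<Rightarrow> real) \<Rightarrow> ('a \<Rightarrow> real)" where
  "iso_power_bdd \<mu> \<sigma> t f x =
     (if t = 0 then f x else (\<integral>r. avg \<mu> r f x \<partial>sigma_pow \<sigma> t))"

definition iso_kernel ::
  "'a::metric_space measure \<Rightarrow> (ennreal \<Rightarrow> real) \<Rightarrow> real \<Rightarrow> 'a \<Rightarrow> 'a \<Rightarrow> ennreal" where
  "iso_kernel \<mu> \<sigma> t x y =
     (\<integral>\<^sup>+ r\<in>{dist x y..}. 1 / emeasure \<mu> (cball x r) \<partial>sigma_pow \<sigma> t)"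

text \<open>
  The kernel may take the value \<open>\<infinity>\<close> (on the diagonal), so integration against \<open>p(t,x,y) d\<mu>(y)\<close>
  is integration against the measure with density \<open>p(t,x,\<cdot>)\<close>.
\<close>

definition has_kernel_value ::
  "'a measure \<Rightarrow> ('a \<Rightarrow> ennreal) \<Rightarrow> ('a \<Rightarrow> real) \<Rightarrow> real \<Rightarrow> bool" where
  "has_kernel_value \<mu> k f v \<longleftrightarrow>
     k \<in> borel_measurable \<mu> \<and> integrable (density \<mu> k) f \<and> v = (\<integral>y. f y \<partial>density \<mu> k)"

end

theory Submission
  imports Defs
begin

text \<open>
  By the ultrametric inequality the averages \<open>Q\<^sub>r\<close> are orthogonal projectors with
  \<open>Q\<^sub>r Q\<^sub>s = Q\<^bsub>max r s\<^esub>\<close>, so \<open>\<integral>Q\<^sub>r d\<nu>\<close> and \<open>\<integral>Q\<^sub>r d\<nu>'\<close> compose to \<open>\<integral>Q\<^sub>r d\<kappa>\<close>, where the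
  distribution function of \<open>\<kappa>\<close> is the product of those of \<open>\<nu>\<close> and \<open>\<nu>'\<close>. The energy
  \<open>\<parallel>Q\<^sub>r f\<parallel>\<^sup>2\<close> decreases from \<open>\<parallel>f\<parallel>\<^sup>2\<close>, and the layer cake formula for it gives a spectral
  representation: with \<open>b u\<close> the radius at which the energy drops to \<open>u\<close>, the squared norm of
  \<open>\<Sum>i. a\<^sub>i \<integral>Q\<^sub>r f d\<nu>\<^sub>i\<close> is the integral of \<open>(\<Sum>i. a\<^sub>i \<nu>\<^sub>i[0, b u))\<^sup>2\<close> over \<open>0 \<le> u < \<parallel>f\<parallel>\<^sup>2\<close>. Thus \<open>P\<close>
  is multiplication by \<open>\<sigma>(b u)\<close>, these values lie in its spectrum, and its powers are
  multiplication by \<open>\<sigma>(b u)\<^sup>t\<close>, which is \<open>\<integral>Q\<^sub>r d\<sigma>\<^sup>t(r)\<close>. The kernel comes from Tonelli's theorem.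
\<close>

section \<open>Square-integrable functions\<close>

text \<open>\<open>iso_op\<close> and \<open>iso_power\<close> are choices, determined only up to
  null sets, so nothing can be computed from them directly. Each is compared with the concrete
  representative \<open>avg_mix\<close>, which requires existence and uniqueness for both defining
  predicates. For the strong integral, uniqueness is tested weakly, against all of L2. For the
  functional calculus, the approximating polynomials are controlled on the spectrum alone. Existence
  therefore needs the spectrum inside [0,1], shown by explicit resolvents, so that Weierstrass
  approximation applies; uniqueness needs the numbers \<sigma>(b u) to belong to the spectrum, shown
  by approximate eigenvectors.

  Right continuity of the energy in r makes each set {r. energy > u} a half-open interval [0, b u),
  or the whole half-line, with b u > 0. Half-open intervals are what the left-continuous \<sigma>
  measures directly, and b u > 0 makes \<sigma>(b u) positive, so that powers with exponent near 0
  converge to the identity. At r = 0 right continuity says that Q_r f tends to f; this is where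
  inner regularity of \<mu> enters.\<close>

lemma L2_iff: "f \<in> L2 M \<longleftrightarrow> f \<in> borel_measurable M \<and> integrable M (\<lambda>x. (f x)\<^sup>2)"
  by (simp add: L2_def)

lemma L2_borel: "f \<in> L2 M \<Longrightarrow> f \<in> borel_measurable M"
  by (simp add: L2_def)

lemma L2_times_integrable:
  assumes "f \<in> L2 M" "g \<in> L2 M"
  shows "integrable M (\<lambda>x. f x * g x)"
proof (rule Bochner_Integration.integrable_bound)
  show "integrable M (\<lambda>x. (f x)\<^sup>2 + (g x)\<^sup>2)"
    using assms by (auto simp: L2_iff)
  show "AE x in M. norm (f x * g x) \<le> norm ((f x)\<^sup>2 + (g x)\<^sup>2)"
  proof (intro AE_I2)
    fix x
    have "2 * (\<bar>f x\<bar> * \<bar>g x\<bar>) \<le> (f x)\<^sup>2 + (g x)\<^sup>2"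
      using sum_squares_bound[of "\<bar>f x\<bar>" "\<bar>g x\<bar>"] by (simp add: mult.assoc)
    moreover have "0 \<le> \<bar>f x\<bar> * \<bar>g x\<bar>" by simp
    ultimately have "\<bar>f x\<bar> * \<bar>g x\<bar> \<le> (f x)\<^sup>2 + (g x)\<^sup>2" by linarith
    then show "norm (f x * g x) \<le> norm ((f x)\<^sup>2 + (g x)\<^sup>2)"
      by (simp add: abs_mult)
  qed
qed (use assms in \<open>auto simp: L2_iff\<close>)

lemma L2_zero [simp]: "(\<lambda>_. 0) \<in> L2 M"
  by (simp add: L2_iff)

lemma L2_cmult [intro]: "f \<in> L2 M \<Longrightarrow> (\<lambda>x. c * f x) \<in> L2 M"
  by (auto simp: L2_iff power_mult_distrib)

lemma L2_add [intro]:
  assumes "f \<in> L2 M" "g \<in> L2 M" shows "(\<lambda>x. f x + g x) \<in> L2 M"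
  using assms L2_times_integrable[OF assms]
  by (auto simp: L2_iff power2_sum mult.assoc)

lemma L2_diff [intro]:
  assumes "f \<in> L2 M" "g \<in> L2 M" shows "(\<lambda>x. f x - g x) \<in> L2 M"
  using L2_add[OF assms(1) L2_cmult[OF assms(2), of "-1"]] by simp

lemma L2_sum [intro]:
  assumes "\<And>i. i \<in> I \<Longrightarrow> f i \<in> L2 M" shows "(\<lambda>x. \<Sum>i\<in>I. f i x) \<in> L2 M"
  using assms by (induction I rule: infinite_finite_induct) auto

lemma L2_abs [intro]: "f \<in> L2 M \<Longrightarrow> (\<lambda>x. \<bar>f x\<bar>) \<in> L2 M"
  by (auto simp add: L2_iff)

section \<open>Inner product and norm of L2, on representatives\<close>

lemma L2_inner_commute: "L2_inner M f g = L2_inner M g f"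
  by (simp add: L2_inner_def mult.commute)

lemma L2_inner_add_left:
  "f \<in> L2 M \<Longrightarrow> g \<in> L2 M \<Longrightarrow> h \<in> L2 M \<Longrightarrow>
    L2_inner M (\<lambda>x. f x + g x) h = L2_inner M f h + L2_inner M g h"
  unfolding L2_inner_def
  by (simp add: L2_times_integrable distrib_right)

lemma L2_inner_diff_left:
  "f \<in> L2 M \<Longrightarrow> g \<in> L2 M \<Longrightarrow> h \<in> L2 M \<Longrightarrow>
    L2_inner M (\<lambda>x. f x - g x) h = L2_inner M f h - L2_inner M g h"
  unfolding L2_inner_def
  by (simp add: L2_times_integrable left_diff_distrib)

lemma L2_inner_cmult_left: "L2_inner M (\<lambda>x. c * f x) h = c * L2_inner M f h"
  unfolding L2_inner_def by (simp add: mult.assoc)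

lemma L2_inner_sum_left:
  "(\<And>i. i \<in> I \<Longrightarrow> f i \<in> L2 M) \<Longrightarrow> h \<in> L2 M \<Longrightarrow>
    L2_inner M (\<lambda>x. \<Sum>i\<in>I. f i x) h = (\<Sum>i\<in>I. L2_inner M (f i) h)"
  unfolding L2_inner_def
  by (simp add: sum_distrib_right L2_times_integrable)

lemma L2_inner_add_right:
  "f \<in> L2 M \<Longrightarrow> g \<in> L2 M \<Longrightarrow> h \<in> L2 M \<Longrightarrow>
    L2_inner M h (\<lambda>x. f x + g x) = L2_inner M h f + L2_inner M h g"
  using L2_inner_add_left[of f M g h] by (simp add: L2_inner_commute)

lemma L2_inner_diff_right:
  "f \<in> L2 M \<Longrightarrow> g \<in> L2 M \<Longrightarrow> h \<in> L2 M \<Longrightarrow>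
    L2_inner M h (\<lambda>x. f x - g x) = L2_inner M h f - L2_inner M h g"
  using L2_inner_diff_left[of f M g h] by (simp add: L2_inner_commute)

lemma L2_inner_cmult_right: "L2_inner M h (\<lambda>x. c * f x) = c * L2_inner M h f"
  using L2_inner_cmult_left[of M c f h] by (simp add: L2_inner_commute)

lemma L2_inner_sum_right:
  "(\<And>i. i \<in> I \<Longrightarrow> f i \<in> L2 M) \<Longrightarrow> h \<in> L2 M \<Longrightarrow>
    L2_inner M h (\<lambda>x. \<Sum>i\<in>I. f i x) = (\<Sum>i\<in>I. L2_inner M h (f i))"
  using L2_inner_sum_left[of I f M h] by (simp add: L2_inner_commute)

lemma L2_inner_AE_cong:
  assumes "AE x in M. f x = f' x" "AE x in M. g x = g' x"
    and "f \<in> L2 M" "f' \<in> L2 M" "g \<in> L2 M" "g' \<in> L2 M"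
  shows "L2_inner M f g = L2_inner M f' g'"
  unfolding L2_inner_def
proof (rule integral_cong_AE)
  show "AE x in M. f x * g x = f' x * g' x"
    using assms(1,2) by eventually_elim simp
qed (use assms in \<open>auto simp: L2_iff\<close>)

lemma L2_norm_nonneg [simp]: "0 \<le> L2_norm M f"
  by (simp add: L2_norm_def L2_inner_def)

lemma L2_inner_self_nonneg [simp]: "0 \<le> L2_inner M f f"
  by (simp add: L2_inner_def)

lemma L2_norm_sq: "(L2_norm M f)\<^sup>2 = L2_inner M f f"
  by (simp add: L2_norm_def)

lemma L2_norm_sq_integral: "(L2_norm M f)\<^sup>2 = (\<integral>x. (f x)\<^sup>2 \<partial>M)"
  unfolding L2_norm_sq by (simp add: L2_inner_def power2_eq_square)

lemma L2_norm_AE_cong: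
  assumes "AE x in M. f x = g x" "f \<in> L2 M" "g \<in> L2 M"
  shows "L2_norm M f = L2_norm M g"
  unfolding L2_norm_def using L2_inner_AE_cong[OF assms(1,1,2,3,2,3)] by simp

lemma L2_norm_cmult: "L2_norm M (\<lambda>x. c * f x) = \<bar>c\<bar> * L2_norm M f"
  by (simp add: L2_norm_def L2_inner_cmult_left L2_inner_cmult_right real_sqrt_mult
      flip: mult.assoc)

lemma L2_norm_minus_commute: "L2_norm M (\<lambda>x. f x - g x) = L2_norm M (\<lambda>x. g x - f x)"
  using L2_norm_cmult[of M "-1" "\<lambda>x. g x - f x"] by simp

lemma L2_norm_zero_iff:
  assumes "f \<in> L2 M" shows "L2_norm M f = 0 \<longleftrightarrow> (AE x in M. f x = 0)"
proof -
  have "L2_norm M f = 0 \<longleftrightarrow> (\<integral>x. (f x)\<^sup>2 \<partial>M) = 0"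
    using L2_norm_sq_integral[of M f] by (metis power_eq_0_iff zero_neq_numeral power_zero_numeral)
  also have "\<dots> \<longleftrightarrow> (AE x in M. (f x)\<^sup>2 = 0)"
    using assms by (intro integral_nonneg_eq_0_iff_AE) (auto simp: L2_iff)
  finally show ?thesis by simp
qed

lemma L2_Cauchy_Schwarz:
  assumes f: "f \<in> L2 M" and g: "g \<in> L2 M"
  shows "\<bar>L2_inner M f g\<bar> \<le> L2_norm M f * L2_norm M g"
proof -
  let ?a = "L2_inner M f f" and ?b = "L2_inner M f g" and ?c = "L2_inner M g g"
  have quad: "0 \<le> ?a + 2 * s * ?b + s\<^sup>2 * ?c" for s
  proof -
    have "0 \<le> L2_inner M (\<lambda>x. f x + s * g x) (\<lambda>x. f x + s * g x)" by simp
    also have "\<dots> = ?a + 2 * s * ?b + s\<^sup>2 * ?c"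
      using f g
      by (simp add: L2_inner_add_left L2_inner_add_right L2_cmult L2_add L2_inner_cmult_left
          L2_inner_cmult_right L2_inner_commute[of M g f] power2_eq_square algebra_simps)
    finally show ?thesis .
  qed
  have "?b\<^sup>2 \<le> ?a * ?c"
  proof (cases "?c = 0")
    case True
    have "?b = 0"
    proof (rule ccontr)
      assume "?b \<noteq> 0"
      \<comment> \<open>With ?c = 0 the quadratic is affine in s, and this s is chosen to give it
        the value -1.\<close>
      then have "2 * (- (?a + 1) / (2 * ?b)) * ?b = - (?a + 1)" by (simp add: field_simps)
      then show False
        using quad[of "- (?a + 1) / (2 * ?b)"] True by (simp only:)
    qed
    then show ?thesis using True by simp
  next
    case False
    then have "?c > 0" using L2_inner_self_nonneg[of M g] by linarith
    then show ?thesis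
      using quad[of "- ?b / ?c"] False by (simp add: field_simps power2_eq_square)
  qed
  then have "sqrt (?b\<^sup>2) \<le> sqrt (?a * ?c)" by (rule real_sqrt_le_mono)
  then show ?thesis by (simp add: L2_norm_def real_sqrt_mult)
qed

lemma L2_norm_triangle:
  assumes f: "f \<in> L2 M" and g: "g \<in> L2 M"
  shows "L2_norm M (\<lambda>x. f x + g x) \<le> L2_norm M f + L2_norm M g"
proof (rule power2_le_imp_le)
  have "(L2_norm M (\<lambda>x. f x + g x))\<^sup>2 = (L2_norm M f)\<^sup>2 + 2 * L2_inner M f g + (L2_norm M g)\<^sup>2"
    using f g unfolding L2_norm_sq
    by (simp add: L2_inner_add_left L2_inner_add_right L2_add L2_inner_commute[of M g f])
  also have "\<dots> \<le> (L2_norm M f + L2_norm M g)\<^sup>2"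
    using L2_Cauchy_Schwarz[OF f g] by (simp add: power2_sum)
  finally show "(L2_norm M (\<lambda>x. f x + g x))\<^sup>2 \<le> (L2_norm M f + L2_norm M g)\<^sup>2" .
qed simp

lemma L2_norm_diff_triangle:
  assumes "f \<in> L2 M" "g \<in> L2 M" "h \<in> L2 M"
  shows "L2_norm M (\<lambda>x. f x - h x) \<le> L2_norm M (\<lambda>x. f x - g x) + L2_norm M (\<lambda>x. g x - h x)"
  using L2_norm_triangle[of "\<lambda>x. f x - g x" M "\<lambda>x. g x - h x"] assms by (auto simp: L2_diff)

lemma L2_eqI_weak:
  assumes f: "f \<in> L2 M" and g: "g \<in> L2 M"
    and eq: "\<And>h. h \<in> L2 M \<Longrightarrow> L2_inner M f h = L2_inner M g h"
  shows "AE x in M. f x = g x"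
proof -
  have "L2_inner M (\<lambda>x. f x - g x) (\<lambda>x. f x - g x) = 0"
    using f g eq[of "\<lambda>x. f x - g x"] by (simp add: L2_inner_diff_left L2_diff)
  then have "L2_norm M (\<lambda>x. f x - g x) = 0" by (simp add: L2_norm_def)
  then have "AE x in M. f x - g x = 0"
    using f g by (subst (asm) L2_norm_zero_iff) auto
  then show ?thesis by simp
qed

text \<open>Cauchy-Schwarz against the constant 1, which is square integrable for a finite
  measure.\<close>

lemma integral_square_le:
  fixes f :: "'b \<Rightarrow> real"
  assumes "finite_measure N" and f: "f \<in> L2 N"
  shows "integrable N f" and "(\<integral>r. f r \<partial>N)\<^sup>2 \<le> measure N (space N) * (\<integral>r. (f r)\<^sup>2 \<partial>N)"
proof -
  interpret finite_measure N by fact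
  have one: "(\<lambda>_. 1) \<in> L2 N" by (simp add: L2_iff)
  show "integrable N f" using L2_times_integrable[OF f one] by simp
  have "\<bar>L2_inner N f (\<lambda>_. 1)\<bar>\<^sup>2 \<le> (L2_norm N f * L2_norm N (\<lambda>_. 1))\<^sup>2"
    using L2_Cauchy_Schwarz[OF f one] by (intro power_mono) auto
  then show "(\<integral>r. f r \<partial>N)\<^sup>2 \<le> measure N (space N) * (\<integral>r. (f r)\<^sup>2 \<partial>N)"
    by (simp add: power_mult_distrib L2_norm_sq_integral L2_inner_def mult.commute)
qed

section \<open>Bounded operators modulo null sets\<close>

lemma L2_operatorD:
  assumes "L2_operator M A"
  shows "f \<in> L2 M \<Longrightarrow> A f \<in> L2 M"
    and "f \<in> L2 M \<Longrightarrow> g \<in> L2 M \<Longrightarrow> AE x in M. A (\<lambda>y. f y + g y) x = A f x + A g x"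
    and "f \<in> L2 M \<Longrightarrow> AE x in M. A (\<lambda>y. c * f y) x = c * A f x"
    and "\<exists>C. \<forall>f\<in>L2 M. L2_norm M (A f) \<le> C * L2_norm M f"
  using assms by (auto simp: L2_operator_def)

lemma L2_operator_diff:
  assumes A: "L2_operator M A" and f: "f \<in> L2 M" and g: "g \<in> L2 M"
  shows "AE x in M. A (\<lambda>y. f y - g y) x = A f x - A g x"
proof -
  have "AE x in M. A (\<lambda>y. f y - g y) x = A f x + A (\<lambda>y. - g y) x"
    using L2_operatorD(2)[OF A f L2_cmult[OF g, of "-1"]] by simp
  moreover have "AE x in M. A (\<lambda>y. - g y) x = - A g x"
    using L2_operatorD(3)[OF A g, of "-1"] by simp
  ultimately show ?thesis by eventually_elim simp
qed

text \<open>The norm bound sends the null function f - g to a null function, and linearity does the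
  rest. This is the independence of the representative that every substitution inside an operator
  relies on.\<close>

lemma L2_operator_AE_cong:
  assumes A: "L2_operator M A" and f: "f \<in> L2 M" and g: "g \<in> L2 M"
    and eq: "AE x in M. f x = g x"
  shows "AE x in M. A f x = A g x"
proof -
  obtain C where C: "\<And>f. f \<in> L2 M \<Longrightarrow> L2_norm M (A f) \<le> C * L2_norm M f"
    using A unfolding L2_operator_def by blast
  let ?d = "\<lambda>x. f x - g x"
  have d: "?d \<in> L2 M" using f g by (rule L2_diff)
  have "L2_norm M ?d = 0"
    using d eq by (subst L2_norm_zero_iff) auto
  then have "L2_norm M (A ?d) = 0"
    using C[OF d] L2_norm_nonneg[of M "A ?d"] by (simp del: L2_norm_nonneg)
  then have "AE x in M. A ?d x = 0"
    using L2_operatorD(1)[OF A d] by (subst (asm) L2_norm_zero_iff)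
  with L2_operator_diff[OF A f g] show ?thesis by eventually_elim simp
qed

lemma L2_operator_cong:
  assumes B: "L2_operator M B" and A: "\<And>f. f \<in> L2 M \<Longrightarrow> A f \<in> L2 M"
    and eq: "\<And>f. f \<in> L2 M \<Longrightarrow> AE x in M. A f x = B f x"
  shows "L2_operator M A"
  unfolding L2_operator_def
proof (intro conjI ballI allI)
  fix f g assume f: "f \<in> L2 M" and g: "g \<in> L2 M"
  have "AE x in M. B (\<lambda>y. f y + g y) x = B f x + B g x"
    by (rule L2_operatorD(2)[OF B f g])
  then show "AE x in M. A (\<lambda>y. f y + g y) x = A f x + A g x"
    using eq[OF f] eq[OF g] eq[OF L2_add[OF f g]] by eventually_elim simp
next
  fix f c assume f: "f \<in> L2 M"
  have "AE x in M. B (\<lambda>y. c * f y) x = c * B f x"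
    by (rule L2_operatorD(3)[OF B f])
  then show "AE x in M. A (\<lambda>y. c * f y) x = c * A f x"
    using eq[OF f] eq[OF L2_cmult[OF f, of c]] by eventually_elim simp
next
  obtain C where C: "\<And>f. f \<in> L2 M \<Longrightarrow> L2_norm M (B f) \<le> C * L2_norm M f"
    using B unfolding L2_operator_def by blast
  have "L2_norm M (A f) \<le> C * L2_norm M f" if "f \<in> L2 M" for f
    using C[OF that] L2_norm_AE_cong[OF eq[OF that] A[OF that]] B that
    by (auto simp: L2_operator_def)
  then show "\<exists>C. \<forall>f\<in>L2 M. L2_norm M (A f) \<le> C * L2_norm M f" by blast
qed (use A in auto)

text \<open>Supplies boundedness of the resolvents of P, which are a multiple of the identity plus a
  multiple of an integral of averages.\<close>

lemma L2_operator_combine: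
  assumes A: "L2_operator M A"
  shows "L2_operator M (\<lambda>f x. a * f x + b * A f x)"
  unfolding L2_operator_def
proof (intro conjI ballI allI)
  fix f g assume f: "f \<in> L2 M" and g: "g \<in> L2 M"
  show "AE x in M. a * (f x + g x) + b * A (\<lambda>y. f y + g y) x = (a * f x + b * A f x) + (a * g x + b * A g x)"
    using L2_operatorD(2)[OF A f g] by eventually_elim (simp add: algebra_simps)
next
  fix f c assume f: "f \<in> L2 M"
  show "(\<lambda>x. a * f x + b * A f x) \<in> L2 M"
    by (intro L2_add L2_cmult f L2_operatorD(1)[OF A])
  show "AE x in M. a * (c * f x) + b * A (\<lambda>y. c * f y) x = c * (a * f x + b * A f x)"
    using L2_operatorD(3)[OF A f, of c] by eventually_elim (simp add: algebra_simps)
next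
  obtain C where C: "\<And>f. f \<in> L2 M \<Longrightarrow> L2_norm M (A f) \<le> C * L2_norm M f"
    using L2_operatorD(4)[OF A] by blast
  have "L2_norm M (\<lambda>x. a * f x + b * A f x) \<le> (\<bar>a\<bar> + \<bar>b\<bar> * C) * L2_norm M f" if f: "f \<in> L2 M" for f
  proof -
    have "L2_norm M (\<lambda>x. a * f x + b * A f x) \<le> \<bar>a\<bar> * L2_norm M f + \<bar>b\<bar> * L2_norm M (A f)"
      using L2_norm_triangle[OF L2_cmult[OF f] L2_cmult[OF L2_operatorD(1)[OF A f]], of a b]
      by (simp add: L2_norm_cmult)
    also have "\<dots> \<le> \<bar>a\<bar> * L2_norm M f + \<bar>b\<bar> * (C * L2_norm M f)"
      by (intro add_left_mono mult_left_mono C f) simp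
    finally show ?thesis by (simp add: algebra_simps)
  qed
  then show "\<exists>C. \<forall>f\<in>L2 M. L2_norm M (\<lambda>x. a * f x + b * A f x) \<le> C * L2_norm M f" by blast
qed

lemma L2_selfadjoint_cong:
  assumes B: "L2_selfadjoint M B" and A: "L2_operator M A"
    and eq: "\<And>f. f \<in> L2 M \<Longrightarrow> AE x in M. A f x = B f x"
  shows "L2_selfadjoint M A"
  unfolding L2_selfadjoint_def
proof (intro conjI ballI A)
  fix f g assume f: "f \<in> L2 M" and g: "g \<in> L2 M"
  have B_op: "L2_operator M B" using B by (simp add: L2_selfadjoint_def)
  have "L2_inner M (A f) g = L2_inner M (B f) g"
    using eq[OF f] by (intro L2_inner_AE_cong f g L2_operatorD(1)[OF A] L2_operatorD(1)[OF B_op]) auto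
  also have "\<dots> = L2_inner M f (B g)" using B f g by (simp add: L2_selfadjoint_def)
  also have "\<dots> = L2_inner M f (A g)"
    using eq[OF g] by (intro L2_inner_AE_cong f g L2_operatorD(1)[OF A] L2_operatorD(1)[OF B_op]) auto
  finally show "L2_inner M (A f) g = L2_inner M f (A g)" .
qed

section \<open>Averages over balls\<close>

locale ultrametric_measure =
  fixes \<mu> :: "'a::metric_space measure"
  assumes ultra: "ultrametric TYPE('a)"
    and separable: "separable_space (euclidean :: 'a topology)"
    and compact_ball: "\<And>(x::'a) r. compact (cball x r)"
    and radon: "radon_measure \<mu>"
    and support: "full_support \<mu>"
begin

section \<open>Balls, finiteness of the measure, measurability of the distance\<close>

lemma sets_mu [measurable_cong, simp]: "sets \<mu> = sets borel"
  using radon by (simp add: radon_measure_def)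

lemma space_mu [simp]: "space \<mu> = UNIV"
  using sets_eq_imp_space_eq[OF sets_mu] by simp

lemma emeasure_compact_finite:
  assumes "compact K" shows "emeasure \<mu> K < \<infinity>"
proof -
  let ?C = "{U. open U \<and> emeasure \<mu> U < \<infinity>}"
  have "K \<subseteq> \<Union>?C"
    using radon unfolding radon_measure_def by blast
  then obtain D where D: "D \<subseteq> ?C" "finite D" "K \<subseteq> \<Union>D"
    using compactE[OF assms, of ?C] by (metis (mono_tags, lifting) mem_Collect_eq)
  have "emeasure \<mu> K \<le> emeasure \<mu> (\<Union>U\<in>D. U)"
    using D by (intro emeasure_mono) (auto intro!: borel_open)
  also have "\<dots> \<le> (\<Sum>U\<in>D. emeasure \<mu> U)"
    using D by (intro emeasure_subadditive_finite) (auto intro!: borel_open)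
  also have "\<dots> < \<infinity>" using D by auto
  finally show ?thesis .
qed

lemma emeasure_cball_finite: "emeasure \<mu> (cball x r) < \<infinity>"
  by (intro emeasure_compact_finite compact_ball)

lemma measure_cball_pos: "0 < r \<Longrightarrow> 0 < measure \<mu> (cball x r)"
proof -
  assume "0 < r"
  then have "0 < emeasure \<mu> (ball x r)"
    using support unfolding full_support_def by force
  also have "\<dots> \<le> emeasure \<mu> (cball x r)"
    by (intro emeasure_mono) auto
  finally show ?thesis
    using emeasure_cball_finite[of x r] by (simp add: measure_def enn2real_positive_iff)
qed

text \<open>By the ultrametric inequality every point of a ball is a centre of it, so for r \<ge> 0
  the balls of radius r are the classes of an equivalence relation. Symmetry of the averaging kernel
  and nesting of the projectors both come from here.\<close>

lemma cball_eq_cball: "dist (x :: 'a) y \<le> r \<Longrightarrow> cball x r = cball y r"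
proof -
  have "z \<in> cball v r" if "dist u v \<le> r" "z \<in> cball u r" for u v z :: 'a
  proof -
    have "dist v z \<le> max (dist v u) (dist u z)" using ultra by (simp add: ultrametric_def)
    moreover have "dist v u \<le> r" "dist u z \<le> r" using that by (simp_all add: dist_commute)
    ultimately show ?thesis unfolding mem_cball by linarith
  qed
  from this[of x y] this[of y x] show "dist x y \<le> r \<Longrightarrow> cball x r = cball y r"
    by (auto simp only: dist_commute)
qed

lemma countable_dense: "\<exists>D :: 'a set. countable D \<and> (\<forall>x e. 0 < e \<longrightarrow> (\<exists>d\<in>D. dist x d < e))"
proof -
  obtain D :: "'a set" where D: "countable D" "closure D = UNIV"
    using separable by (auto simp: separable_space_def)
  have "\<exists>d\<in>D. dist x d < e" if "0 < e" for x e
    using D(2) closure_approachable[of x D] that by (auto simp: dist_commute)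
  with D(1) show ?thesis by blast
qed

sublocale sigma_finite_measure \<mu>
proof
  obtain D :: "'a set" where D: "countable D" "\<And>x e. 0 < e \<Longrightarrow> \<exists>d\<in>D. dist x d < e"
    using countable_dense by metis
  have "x \<in> (\<Union>d\<in>D. cball d 1)" for x
    using D(2)[of 1 x] by (force simp: dist_commute)
  then show "\<exists>A. countable A \<and> A \<subseteq> sets \<mu> \<and> \<Union> A = space \<mu> \<and> (\<forall>a\<in>A. emeasure \<mu> a \<noteq> \<infinity>)"
    using D(1) emeasure_cball_finite
    by (intro exI[of _ "(\<lambda>d. cball d 1) ` D"]) (auto simp: less_top)
qed

text \<open>The type \<^typ>\<open>'a\<close> is not of class \<^class>\<open>second_countable_topology\<close>, so the Borel
  \<open>\<sigma>\<close>-algebra of the square is not known to be the product \<open>\<sigma>\<close>-algebra.\<close>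

lemma measurable_dist_pair: "(\<lambda>p. dist (fst p) (snd p)) \<in> borel_measurable (\<mu> \<Otimes>\<^sub>M \<mu>)"
proof -
  obtain D :: "'a set" where D: "countable D" "\<And>x e. 0 < e \<Longrightarrow> \<exists>d\<in>D. dist x d < e"
    using countable_dense by metis
  \<comment> \<open>For r > 0 the relation dist \<le> r is an equivalence whose classes all meet D.
    It is thus a countable union of measurable squares.\<close>
  have pos: "{p. dist (fst p) (snd p) \<le> r} \<in> sets (\<mu> \<Otimes>\<^sub>M \<mu>)" if "0 < r" for r
  proof -
    have "p \<in> (\<Union>d\<in>D. cball d r \<times> cball d r)" if "dist (fst p) (snd p) \<le> r" for p
    proof -
      obtain d where "d \<in> D" "dist (fst p) d < r" using D(2)[OF \<open>0 < r\<close>] by blast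
      then have "cball (fst p) r = cball d r" by (intro cball_eq_cball) simp
      moreover have "fst p \<in> cball (fst p) r" "snd p \<in> cball (fst p) r"
        using that \<open>0 < r\<close> by auto
      ultimately show ?thesis using \<open>d \<in> D\<close> by (auto simp: mem_Times_iff)
    qed
    moreover have "dist (fst p) (snd p) \<le> r" if "p \<in> cball d r \<times> cball d r" for d :: 'a and p
      using cball_eq_cball[of d "fst p" r] that by (auto simp: mem_Times_iff)
    ultimately have "{p. dist (fst p) (snd p) \<le> r} = (\<Union>d\<in>D. cball d r \<times> cball d r)"
      by blast
    also have "\<dots> \<in> sets (\<mu> \<Otimes>\<^sub>M \<mu>)"
      using D(1) by (intro sets.countable_UN') auto
    finally show ?thesis .
  qed
  have "{p. dist (fst p) (snd p) \<le> r} \<in> sets (\<mu> \<Otimes>\<^sub>M \<mu>)" for r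
  proof -
    consider "r < 0" | "r = 0" | "r > 0" by linarith
    then show ?thesis
    proof cases
      case 1
      then have "{p :: 'a \<times> 'a. dist (fst p) (snd p) \<le> r} = {}"
        by (auto dest: order_trans[OF zero_le_dist])
      then show ?thesis by simp
    next
      case 2
      \<comment> \<open>A single point may miss D, so the diagonal is reached as the intersection
        over positive radii.\<close>
      have "{p :: 'a \<times> 'a. dist (fst p) (snd p) \<le> r} =
          (\<Inter>n. {p. dist (fst p) (snd p) \<le> inverse (real (Suc n))})"
      proof (intro set_eqI iffI)
        fix p :: "'a \<times> 'a"
        assume p: "p \<in> (\<Inter>n. {p. dist (fst p) (snd p) \<le> inverse (real (Suc n))})"
        have "dist (fst p) (snd p) \<le> 0"
          by (rule LIMSEQ_le_const[OF LIMSEQ_inverse_real_of_nat]) (use p in auto)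
        with 2 show "p \<in> {p. dist (fst p) (snd p) \<le> r}" by simp
      qed (use 2 in auto)
      also have "\<dots> \<in> sets (\<mu> \<Otimes>\<^sub>M \<mu>)"
      proof (rule sets.countable_INT'')
        show "UNIV \<in> sets (\<mu> \<Otimes>\<^sub>M \<mu>)"
          using sets.top[of "\<mu> \<Otimes>\<^sub>M \<mu>"]
          by (simp only: space_pair_measure space_mu UNIV_Times_UNIV)
      qed (simp, rule pos, simp)
      finally show ?thesis .
    qed (rule pos)
  qed
  then show ?thesis
    by (subst borel_measurable_iff_le) (simp add: space_pair_measure)
qed

lemma measurable_dist' [measurable (raw)]:
  assumes f: "f \<in> N \<rightarrow>\<^sub>M \<mu>" and g: "g \<in> N \<rightarrow>\<^sub>M \<mu>"
  shows "(\<lambda>x. dist (f x) (g x)) \<in> borel_measurable N"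
  using measurable_compose[OF measurable_Pair[OF f g] measurable_dist_pair] by simp

lemma measurable_cball_integral [measurable (raw)]:
  fixes f :: "'b \<Rightarrow> 'a \<Rightarrow> real"
  assumes [measurable]: "(\<lambda>(p, y). f p y) \<in> borel_measurable (N \<Otimes>\<^sub>M \<mu>)" "r \<in> borel_measurable N" "x \<in> N \<rightarrow>\<^sub>M \<mu>"
  shows "(\<lambda>p. \<integral>y. indicator (cball (x p) (r p)) y * f p y \<partial>\<mu>) \<in> borel_measurable N"
  unfolding indicator_def mem_cball by measurable

lemma measurable_measure_cball [measurable (raw)]:
  assumes [measurable]: "r \<in> borel_measurable N" "x \<in> N \<rightarrow>\<^sub>M \<mu>"
  shows "(\<lambda>p. measure \<mu> (cball (x p) (r p))) \<in> borel_measurable N"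
  using measurable_cball_integral[of "\<lambda>_ _. 1" N r x] by (simp add: assms)

section \<open>The averages as nested orthogonal projectors\<close>

lemma avg_eq:
  "avg \<mu> r f x =
    (if r > 0 then (\<integral>y. indicator (cball x r) y * f y \<partial>\<mu>) / measure \<mu> (cball x r) else f x)"
  by (simp add: avg_def set_lebesgue_integral_def)

lemma avg_nonpos: "r \<le> 0 \<Longrightarrow> avg \<mu> r f = f"
  by (auto simp: avg_def)

lemma measurable_avg [measurable (raw)]:
  assumes [measurable]: "f \<in> borel_measurable \<mu>" "r \<in> borel_measurable N" "x \<in> N \<rightarrow>\<^sub>M \<mu>"
  shows "(\<lambda>p. avg \<mu> (r p) f (x p)) \<in> borel_measurable N"
  unfolding avg_eq by measurable

lemma indicator_times_L2 [intro]: "f \<in> L2 \<mu> \<Longrightarrow> A \<in> sets borel \<Longrightarrow> (\<lambda>y. indicator A y * f y) \<in> L2 \<mu>"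
proof -
  assume f: "f \<in> L2 \<mu>" and A: "A \<in> sets borel"
  have "integrable \<mu> (\<lambda>y. indicator A y *\<^sub>R (f y)\<^sup>2)"
    using f A by (intro integrable_mult_indicator) (auto simp: L2_iff)
  moreover have "(\<lambda>y. indicator A y *\<^sub>R (f y)\<^sup>2) = (\<lambda>y. (indicator A y * f y)\<^sup>2)"
    by (auto simp: indicator_def)
  ultimately show ?thesis using f A by (auto simp: L2_iff)
qed

lemma indicator_L2: "A \<in> sets borel \<Longrightarrow> emeasure \<mu> A < \<infinity> \<Longrightarrow> indicat_real A \<in> L2 \<mu>"
proof -
  have "(\<lambda>y. (indicat_real A y)\<^sup>2) = indicat_real A" by (auto simp: indicator_def)
  then show "A \<in> sets borel \<Longrightarrow> emeasure \<mu> A < \<infinity> \<Longrightarrow> indicat_real A \<in> L2 \<mu>"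
    by (auto simp: L2_iff)
qed

lemma integrable_indicator_cball:
  assumes "f \<in> L2 \<mu>" shows "integrable \<mu> (\<lambda>y. indicator (cball x r) y * f y)"
  by (intro L2_times_integrable indicator_L2 assms emeasure_cball_finite) auto

lemma avg_add: "f \<in> L2 \<mu> \<Longrightarrow> g \<in> L2 \<mu> \<Longrightarrow> avg \<mu> r (\<lambda>y. f y + g y) x = avg \<mu> r f x + avg \<mu> r g x"
  by (simp add: avg_eq integrable_indicator_cball distrib_left add_divide_distrib)

lemma avg_cmult: "avg \<mu> r (\<lambda>y. c * f y) x = c * avg \<mu> r f x"
  by (simp add: avg_eq mult.left_commute[of _ c])

lemma avg_diff: "f \<in> L2 \<mu> \<Longrightarrow> g \<in> L2 \<mu> \<Longrightarrow> avg \<mu> r (\<lambda>y. f y - g y) x = avg \<mu> r f x - avg \<mu> r g x"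
  by (simp add: avg_eq integrable_indicator_cball right_diff_distrib diff_divide_distrib)

lemma avg_nonneg: "(\<And>y. 0 \<le> f y) \<Longrightarrow> 0 \<le> avg \<mu> r f x"
  by (auto simp: avg_eq intro!: divide_nonneg_nonneg)

lemma avg_const: "avg \<mu> r (\<lambda>_. c) x = c"
  using measure_cball_pos[of r x] by (auto simp: avg_eq)

lemma avg_invariant:
  assumes "\<And>y. y \<in> cball x r \<Longrightarrow> f y = f x" shows "avg \<mu> r f x = f x"
proof -
  have "(\<lambda>y. indicator (cball x r) y * f y) = (\<lambda>y. indicator (cball x r) y * f x)"
    using assms by (auto simp: indicator_def)
  then have "avg \<mu> r f x = avg \<mu> r (\<lambda>_. f x) x" by (simp add: avg_eq)
  then show ?thesis by (simp add: avg_const)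
qed

lemma avg_eq_on_ball: "dist x y \<le> r \<Longrightarrow> 0 < r \<Longrightarrow> avg \<mu> r f y = avg \<mu> r f x"
  using cball_eq_cball[of x y r] by (simp add: avg_eq)

text \<open>Q_s f is constant on balls of radius s, hence on the smaller ones, and averaging a
  constant changes nothing. The identity is pointwise, not only almost everywhere.\<close>

lemma avg_avg: "0 \<le> r \<Longrightarrow> r \<le> s \<Longrightarrow> avg \<mu> r (avg \<mu> s f) = avg \<mu> s f"
proof
  fix x assume "0 \<le> r" "r \<le> s"
  show "avg \<mu> r (avg \<mu> s f) x = avg \<mu> s f x"
  proof (cases "r = 0")
    case False
    with \<open>0 \<le> r\<close> \<open>r \<le> s\<close> show ?thesis
      by (intro avg_invariant avg_eq_on_ball) auto
  qed (simp add: avg_nonpos)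
qed

text \<open>Jensen's inequality for the square, obtained from Cauchy-Schwarz between f restricted to
  the ball and the indicator of the ball.\<close>

lemma avg_sq_le:
  assumes f: "f \<in> L2 \<mu>" shows "(avg \<mu> r f x)\<^sup>2 \<le> avg \<mu> r (\<lambda>y. (f y)\<^sup>2) x"
proof (cases "0 < r")
  case True
  let ?B = "cball x r" and ?m = "measure \<mu> (cball x r)"
  have m: "0 < ?m" using True by (rule measure_cball_pos)
  let ?g = "\<lambda>y. indicator ?B y * f y"
  have g: "?g \<in> L2 \<mu>" using f by (intro indicator_times_L2) auto
  have B: "indicat_real ?B \<in> L2 \<mu>" by (intro indicator_L2 emeasure_cball_finite) auto
  have sq: "(\<lambda>y. (?g y)\<^sup>2) = (\<lambda>y. indicator ?B y * (f y)\<^sup>2)" by (auto simp: indicator_def fun_eq_iff)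
  have sqB: "(\<lambda>y. (indicat_real ?B y)\<^sup>2) = indicat_real ?B" by (auto simp: indicator_def)
  have mul: "(\<lambda>y. indicator ?B y * f y * indicator ?B y) = ?g" by (auto simp: indicator_def)
  have "\<bar>L2_inner \<mu> ?g (indicat_real ?B)\<bar>\<^sup>2 \<le> (L2_norm \<mu> ?g * L2_norm \<mu> (indicat_real ?B))\<^sup>2"
    using L2_Cauchy_Schwarz[OF g B] by (intro power_mono) auto
  then have "(\<integral>y. ?g y \<partial>\<mu>)\<^sup>2 \<le> (\<integral>y. indicator ?B y * (f y)\<^sup>2 \<partial>\<mu>) * ?m"
    unfolding power_mult_distrib[of "L2_norm _ _"] L2_norm_sq_integral sq sqB
    by (simp add: L2_inner_def mul)
  then have "(\<integral>y. ?g y \<partial>\<mu>)\<^sup>2 / ?m\<^sup>2 \<le> (\<integral>y. indicator ?B y * (f y)\<^sup>2 \<partial>\<mu>) * ?m / ?m\<^sup>2"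
    using m by (intro divide_right_mono) auto
  also have "\<dots> = (\<integral>y. indicator ?B y * (f y)\<^sup>2 \<partial>\<mu>) / ?m"
    using m by (simp add: power2_eq_square)
  finally show ?thesis using True by (simp add: avg_eq power_divide)
qed (simp add: avg_nonpos)

text \<open>The kernel of Q_r is symmetric, because balls of radius r that meet coincide. After
  Tonelli it is integrated in the other variable, where its total mass is again 1. Together with
  \<open>avg_sq_le\<close> this makes Q_r a contraction of L2.\<close>

lemma nn_integral_avg:
  assumes f: "integrable \<mu> f" "\<And>x. 0 \<le> f x" shows "(\<integral>\<^sup>+x. avg \<mu> r f x \<partial>\<mu>) = (\<integral>\<^sup>+x. f x \<partial>\<mu>)"
proof (cases "0 < r")
  case True
  interpret pair_sigma_finite \<mu> \<mu> ..
  have [measurable]: "f \<in> borel_measurable \<mu>" using f by auto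
  have m: "0 < measure \<mu> (cball x r)" for x using True by (rule measure_cball_pos)
  let ?k = "\<lambda>x y. indicator (cball x r) y / measure \<mu> (cball x r)"
  have k_sym: "?k x y = ?k y x" for x y
    using cball_eq_cball[of x y r] by (auto simp: indicator_def dist_commute)
  have [measurable]: "(\<lambda>(x, y). ?k x y * f y) \<in> borel_measurable (\<mu> \<Otimes>\<^sub>M \<mu>)"
    unfolding indicator_def mem_cball by measurable
  have "(\<integral>\<^sup>+x. avg \<mu> r f x \<partial>\<mu>) = (\<integral>\<^sup>+x. \<integral>\<^sup>+y. ennreal (?k x y * f y) \<partial>\<mu> \<partial>\<mu>)"
  proof (rule nn_integral_cong)
    fix x
    have "integrable \<mu> (\<lambda>y. ?k x y * f y)"
    proof -
      have "integrable \<mu> (\<lambda>y. indicator (cball x r) y *\<^sub>R f y)"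
        using f by (intro integrable_mult_indicator) auto
      then show ?thesis by simp
    qed
    then show "ennreal (avg \<mu> r f x) = (\<integral>\<^sup>+y. ennreal (?k x y * f y) \<partial>\<mu>)"
      using True m f by (subst nn_integral_eq_integral) (auto simp: avg_eq)
  qed
  also have "\<dots> = (\<integral>\<^sup>+y. \<integral>\<^sup>+x. ennreal (?k x y * f y) \<partial>\<mu> \<partial>\<mu>)"
    by (rule Fubini') measurable
  also have "\<dots> = (\<integral>\<^sup>+y. f y \<partial>\<mu>)"
  proof (rule nn_integral_cong)
    fix y
    have "(\<integral>\<^sup>+x. ennreal (?k x y * f y) \<partial>\<mu>) =
        (\<integral>\<^sup>+x. ennreal (f y / measure \<mu> (cball y r)) * indicator (cball y r) x \<partial>\<mu>)"
    proof (rule nn_integral_cong)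
      fix x
      show "ennreal (?k x y * f y) = ennreal (f y / measure \<mu> (cball y r)) * indicator (cball y r) x"
        using k_sym[of x y] by (auto simp: indicator_def)
    qed
    also have "\<dots> = ennreal (f y / measure \<mu> (cball y r)) * emeasure \<mu> (cball y r)"
      by (subst nn_integral_cmult_indicator) auto
    also have "\<dots> = ennreal (f y)"
    proof -
      have "emeasure \<mu> (cball y r) = ennreal (measure \<mu> (cball y r))"
        using emeasure_cball_finite[of y r] by (intro emeasure_eq_ennreal_measure) auto
      then have "ennreal (f y / measure \<mu> (cball y r)) * emeasure \<mu> (cball y r) =
          ennreal (f y / measure \<mu> (cball y r) * measure \<mu> (cball y r))"
        using m[of y] f(2)[of y] by (simp only: ennreal_mult divide_nonneg_pos less_imp_le)
      then show ?thesis using m[of y] by simp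
    qed
    finally show "(\<integral>\<^sup>+x. ennreal (?k x y * f y) \<partial>\<mu>) = ennreal (f y)" .
  qed
  finally show ?thesis .
qed (simp add: avg_nonpos)

lemma nn_integral_avg_sq_le:
  assumes f: "f \<in> L2 \<mu>" shows "(\<integral>\<^sup>+x. (avg \<mu> r f x)\<^sup>2 \<partial>\<mu>) \<le> (\<integral>\<^sup>+x. (f x)\<^sup>2 \<partial>\<mu>)"
proof -
  have "(\<integral>\<^sup>+x. (avg \<mu> r f x)\<^sup>2 \<partial>\<mu>) \<le> (\<integral>\<^sup>+x. avg \<mu> r (\<lambda>y. (f y)\<^sup>2) x \<partial>\<mu>)"
    by (intro nn_integral_mono ennreal_leI avg_sq_le f)
  also have "\<dots> = (\<integral>\<^sup>+x. (f x)\<^sup>2 \<partial>\<mu>)"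
    using f by (intro nn_integral_avg) (auto simp: L2_iff)
  finally show ?thesis .
qed

lemma avg_L2 [simp, intro]:
  assumes f: "f \<in> L2 \<mu>" shows "avg \<mu> r f \<in> L2 \<mu>"
proof -
  have [measurable]: "f \<in> borel_measurable \<mu>" using f by (rule L2_borel)
  have "(\<integral>\<^sup>+x. (f x)\<^sup>2 \<partial>\<mu>) < \<infinity>"
    using f by (auto simp: L2_iff integrable_iff_bounded)
  with nn_integral_avg_sq_le[OF f, of r] have "(\<integral>\<^sup>+x. (avg \<mu> r f x)\<^sup>2 \<partial>\<mu>) < \<infinity>"
    by (rule order.strict_trans1)
  moreover have "avg \<mu> r f \<in> borel_measurable \<mu>" by measurable
  ultimately show ?thesis by (auto simp: L2_iff integrable_iff_bounded)
qed

lemma avg_norm_le: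
  assumes f: "f \<in> L2 \<mu>" shows "L2_norm \<mu> (avg \<mu> r f) \<le> L2_norm \<mu> f"
proof (rule power2_le_imp_le)
  have "ennreal (\<integral>x. (avg \<mu> r f x)\<^sup>2 \<partial>\<mu>) \<le> ennreal (\<integral>x. (f x)\<^sup>2 \<partial>\<mu>)"
    using nn_integral_avg_sq_le[OF f, of r] f avg_L2[OF f, of r]
    by (simp add: nn_integral_eq_integral L2_iff)
  then show "(L2_norm \<mu> (avg \<mu> r f))\<^sup>2 \<le> (L2_norm \<mu> f)\<^sup>2"
    by (simp add: L2_norm_sq_integral)
qed simp

lemma avg_selfadjoint:
  assumes f: "f \<in> L2 \<mu>" and g: "g \<in> L2 \<mu>"
  shows "L2_inner \<mu> (avg \<mu> r f) g = L2_inner \<mu> f (avg \<mu> r g)"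
proof (cases "0 < r")
  case True
  interpret pair_sigma_finite \<mu> \<mu> ..
  have [measurable]: "f \<in> borel_measurable \<mu>" "g \<in> borel_measurable \<mu>" using f g by (auto simp: L2_iff)
  let ?k = "\<lambda>x y. indicator (cball x r) y / measure \<mu> (cball x r)"
  have k_sym: "?k x y = ?k y x" for x y
    using cball_eq_cball[of x y r] by (auto simp: indicator_def dist_commute)
  have k: "(\<integral>y. ?k x y * h y \<partial>\<mu>) = avg \<mu> r h x" for x h
    using True by (simp add: avg_eq)
  have int: "integrable \<mu> (\<lambda>y. ?k x y * h y)" if "h \<in> L2 \<mu>" for x h
    using integrable_indicator_cball[OF that, of x r] by simp
  have meas: "(\<lambda>(x, y). ?k x y * f y * g x) \<in> borel_measurable (\<mu> \<Otimes>\<^sub>M \<mu>)"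
    unfolding indicator_def mem_cball by measurable
  \<comment> \<open>The inner integral of the modulus is Q_r |f| times |g|, a product of two
    functions in L2.\<close>
  have "integrable (\<mu> \<Otimes>\<^sub>M \<mu>) (\<lambda>(x, y). ?k x y * f y * g x)"
  proof (rule Fubini_integrable[OF meas])
    have "(\<lambda>x. \<integral>y. norm (case (x, y) of (x, y) \<Rightarrow> ?k x y * f y * g x) \<partial>\<mu>) =
        (\<lambda>x. avg \<mu> r (\<lambda>y. \<bar>f y\<bar>) x * \<bar>g x\<bar>)"
      unfolding k[symmetric] by (simp add: abs_mult)
    then show "integrable \<mu> (\<lambda>x. \<integral>y. norm (case (x, y) of (x, y) \<Rightarrow> ?k x y * f y * g x) \<partial>\<mu>)"
      using f g by (auto intro!: L2_times_integrable)
    show "AE x in \<mu>. integrable \<mu> (\<lambda>y. case (x, y) of (x, y) \<Rightarrow> ?k x y * f y * g x)"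
      using int[OF f] by (auto intro!: AE_I2 integrable_mult_left simp del: times_divide_eq_left)
  qed
  from Fubini_integral[OF this]
  have "(\<integral>y. (\<integral>x. ?k x y * f y * g x \<partial>\<mu>) \<partial>\<mu>) = (\<integral>x. (\<integral>y. ?k x y * f y * g x \<partial>\<mu>) \<partial>\<mu>)"
    by simp
  moreover have "(\<integral>x. ?k x y * f y * g x \<partial>\<mu>) = f y * avg \<mu> r g y" for y
  proof -
    have "(\<integral>x. ?k x y * f y * g x \<partial>\<mu>) = (\<integral>x. f y * (?k y x * g x) \<partial>\<mu>)"
    proof (rule Bochner_Integration.integral_cong)
      fix x
      show "?k x y * f y * g x = f y * (?k y x * g x)"
        by (subst k_sym) (simp only: mult_ac)
    qed simp
    also have "\<dots> = f y * avg \<mu> r g y"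
      unfolding k[symmetric] by (rule integral_mult_right_zero)
    finally show ?thesis .
  qed
  moreover have "(\<integral>y. ?k x y * f y * g x \<partial>\<mu>) = avg \<mu> r f x * g x" for x
    unfolding k[symmetric] by (rule integral_mult_left_zero)
  ultimately show ?thesis by (simp add: L2_inner_def)
qed (simp add: avg_nonpos)

text \<open>Weak form of Q_r Q_s = Q_(max r s): self-adjointness moves the projector of smaller
  radius to the other side, where \<open>avg_avg\<close> absorbs it.\<close>

lemma inner_avg_avg:
  assumes f: "f \<in> L2 \<mu>" and g: "g \<in> L2 \<mu>" and "0 \<le> r" "0 \<le> s"
  shows "L2_inner \<mu> (avg \<mu> r f) (avg \<mu> s g) = L2_inner \<mu> (avg \<mu> (max r s) f) g"
proof (cases "r \<le> s")
  case True
  have "L2_inner \<mu> (avg \<mu> r f) (avg \<mu> s g) = L2_inner \<mu> f (avg \<mu> r (avg \<mu> s g))"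
    using f g by (intro avg_selfadjoint) auto
  also have "\<dots> = L2_inner \<mu> f (avg \<mu> s g)" using assms True by (simp add: avg_avg)
  also have "\<dots> = L2_inner \<mu> (avg \<mu> s f) g" using f g by (intro avg_selfadjoint[symmetric])
  finally show ?thesis using True by (simp add: max_absorb2)
next
  case False
  then have "s \<le> r" by simp
  have "L2_inner \<mu> (avg \<mu> r f) (avg \<mu> s g) = L2_inner \<mu> (avg \<mu> s (avg \<mu> r f)) g"
    using f g by (intro avg_selfadjoint[symmetric]) auto
  with \<open>s \<le> r\<close> assms show ?thesis by (simp add: avg_avg max_absorb1)
qed

end

section \<open>Integrals of averages\<close>

text \<open>Wide enough for both the Stieltjes measures and the unit mass at 0, so that the identity
  operator is also an integral of averages.\<close>

definition ray_measure :: "real measure \<Rightarrow> bool" where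
  "ray_measure N \<longleftrightarrow> finite_measure N \<and> sets N = sets (restrict_space borel {0..})"

lemma ray_measure_finite: "ray_measure N \<Longrightarrow> finite_measure N"
  and ray_measure_sets: "ray_measure N \<Longrightarrow> sets N = sets (restrict_space borel {0..})"
  by (auto simp: ray_measure_def)

lemma ray_measure_space: "ray_measure N \<Longrightarrow> space N = {0..}"
  using sets_eq_imp_space_eq[OF ray_measure_sets] by (simp add: space_restrict_space)

lemma ray_measure_borel: "ray_measure N \<Longrightarrow> (\<lambda>r. r) \<in> borel_measurable N"
proof -
  assume N: "ray_measure N"
  have "(\<lambda>r :: real. r) \<in> borel_measurable (restrict_space borel {0..})"
    by (intro measurable_restrict_space1) simp
  then show ?thesis by (simp add: measurable_cong_sets[OF ray_measure_sets[OF N] refl])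
qed

context ultrametric_measure
begin

text \<open>Cauchy-Schwarz in r for almost every x, followed by Fubini. The last bound keeps the
  norm of \<Phi> r under the integral, so that approximation errors tending to 0 for each r can be
  fed into it.\<close>

lemma integral_L2:
  fixes \<Phi> :: "'b \<Rightarrow> 'a \<Rightarrow> real"
  assumes N: "finite_measure N"
    and meas [measurable]: "(\<lambda>(r, x). \<Phi> r x) \<in> borel_measurable (N \<Otimes>\<^sub>M \<mu>)"
    and L2: "\<And>r. r \<in> space N \<Longrightarrow> \<Phi> r \<in> L2 \<mu>"
    and bound: "\<And>r. r \<in> space N \<Longrightarrow> L2_norm \<mu> (\<Phi> r) \<le> C"
  shows "AE x in \<mu>. (\<lambda>r. \<Phi> r x) \<in> L2 N"
    and "(\<lambda>x. \<integral>r. \<Phi> r x \<partial>N) \<in> L2 \<mu>"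
    and "(L2_norm \<mu> (\<lambda>x. \<integral>r. \<Phi> r x \<partial>N))\<^sup>2 \<le> measure N (space N) * (\<integral>r. (L2_norm \<mu> (\<Phi> r))\<^sup>2 \<partial>N)"
proof -
  interpret N: finite_measure N by fact
  interpret P: pair_sigma_finite N \<mu> ..
  have sq_bound: "(\<integral>x. (\<Phi> r x)\<^sup>2 \<partial>\<mu>) \<le> C\<^sup>2" if "r \<in> space N" for r
    unfolding L2_norm_sq_integral[symmetric] by (intro power_mono bound that) simp
  have int: "integrable (N \<Otimes>\<^sub>M \<mu>) (\<lambda>(r, x). (\<Phi> r x)\<^sup>2)"
  proof (rule P.Fubini_integrable)
    show "integrable N (\<lambda>r. \<integral>x. norm (case (r, x) of (r, x) \<Rightarrow> (\<Phi> r x)\<^sup>2) \<partial>\<mu>)"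
      using sq_bound by (intro N.integrable_const_bound[where B = "C\<^sup>2"]) auto
    show "AE r in N. integrable \<mu> (\<lambda>x. case (r, x) of (r, x) \<Rightarrow> (\<Phi> r x)\<^sup>2)"
      using L2 by (auto simp: L2_iff)
  qed measurable
  have ae: "AE x in \<mu>. integrable N (\<lambda>r. (\<Phi> r x)\<^sup>2)"
    by (rule P.AE_integrable_snd[OF int])
  then show ae': "AE x in \<mu>. (\<lambda>r. \<Phi> r x) \<in> L2 N"
    by eventually_elim (auto simp: L2_iff)
  have int2: "integrable \<mu> (\<lambda>x. \<integral>r. (\<Phi> r x)\<^sup>2 \<partial>N)"
    by (rule P.integrable_snd[OF int])
  have le: "AE x in \<mu>. (\<integral>r. \<Phi> r x \<partial>N)\<^sup>2 \<le> measure N (space N) * (\<integral>r. (\<Phi> r x)\<^sup>2 \<partial>N)"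
    using ae' by eventually_elim (rule integral_square_le(2)[OF N])
  have int3: "integrable \<mu> (\<lambda>x. (\<integral>r. \<Phi> r x \<partial>N)\<^sup>2)"
  proof (rule Bochner_Integration.integrable_bound)
    show "integrable \<mu> (\<lambda>x. measure N (space N) * (\<integral>r. (\<Phi> r x)\<^sup>2 \<partial>N))"
      using int2 by simp
    show "AE x in \<mu>. norm ((\<integral>r. \<Phi> r x \<partial>N)\<^sup>2) \<le> norm (measure N (space N) * (\<integral>r. (\<Phi> r x)\<^sup>2 \<partial>N))"
      using le by eventually_elim auto
  qed measurable
  then show "(\<lambda>x. \<integral>r. \<Phi> r x \<partial>N) \<in> L2 \<mu>"
    unfolding L2_iff by (intro conjI) measurable
  have "(L2_norm \<mu> (\<lambda>x. \<integral>r. \<Phi> r x \<partial>N))\<^sup>2 \<le> (\<integral>x. measure N (space N) * (\<integral>r. (\<Phi> r x)\<^sup>2 \<partial>N) \<partial>\<mu>)"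
    unfolding L2_norm_sq_integral using int2 int3 le by (intro integral_mono_AE) auto
  also have "\<dots> = measure N (space N) * (\<integral>r. (L2_norm \<mu> (\<Phi> r))\<^sup>2 \<partial>N)"
    using P.Fubini_integral[OF int] by (simp add: L2_norm_sq_integral)
  finally show "(L2_norm \<mu> (\<lambda>x. \<integral>r. \<Phi> r x \<partial>N))\<^sup>2 \<le> measure N (space N) * (\<integral>r. (L2_norm \<mu> (\<Phi> r))\<^sup>2 \<partial>N)" .
qed

lemma inner_integral_L2:
  fixes \<Phi> :: "'b \<Rightarrow> 'a \<Rightarrow> real"
  assumes N: "finite_measure N"
    and meas [measurable]: "(\<lambda>(r, x). \<Phi> r x) \<in> borel_measurable (N \<Otimes>\<^sub>M \<mu>)"
    and L2: "\<And>r. r \<in> space N \<Longrightarrow> \<Phi> r \<in> L2 \<mu>"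
    and bound: "\<And>r. r \<in> space N \<Longrightarrow> L2_norm \<mu> (\<Phi> r) \<le> C"
    and g: "g \<in> L2 \<mu>"
  shows "integrable N (\<lambda>r. L2_inner \<mu> (\<Phi> r) g)"
    and "L2_inner \<mu> (\<lambda>x. \<integral>r. \<Phi> r x \<partial>N) g = (\<integral>r. L2_inner \<mu> (\<Phi> r) g \<partial>N)"
proof -
  interpret N: finite_measure N by fact
  interpret P: pair_sigma_finite N \<mu> ..
  have [measurable]: "g \<in> borel_measurable \<mu>" using g by (rule L2_borel)
  have int: "integrable (N \<Otimes>\<^sub>M \<mu>) (\<lambda>(r, x). \<Phi> r x * g x)"
  proof (rule P.Fubini_integrable)
    have "(\<integral>x. norm (\<Phi> r x * g x) \<partial>\<mu>) \<le> C * L2_norm \<mu> g" if r: "r \<in> space N" for r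
    proof -
      have "(\<integral>x. norm (\<Phi> r x * g x) \<partial>\<mu>) = L2_inner \<mu> (\<lambda>x. \<bar>\<Phi> r x\<bar>) (\<lambda>x. \<bar>g x\<bar>)"
        by (simp add: L2_inner_def abs_mult)
      also have "\<dots> \<le> L2_norm \<mu> (\<lambda>x. \<bar>\<Phi> r x\<bar>) * L2_norm \<mu> (\<lambda>x. \<bar>g x\<bar>)"
        using L2_Cauchy_Schwarz[OF L2_abs[OF L2[OF r]] L2_abs[OF g]] by linarith
      also have "\<dots> = L2_norm \<mu> (\<Phi> r) * L2_norm \<mu> g"
        by (simp add: L2_norm_def L2_inner_def)
      finally show ?thesis using bound[OF r] by (meson L2_norm_nonneg mult_right_mono order_trans)
    qed
    then show "integrable N (\<lambda>r. \<integral>x. norm (case (r, x) of (r, x) \<Rightarrow> \<Phi> r x * g x) \<partial>\<mu>)"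
      by (intro N.integrable_const_bound[where B = "C * L2_norm \<mu> g"]) (auto simp: integral_nonneg_AE)
    show "AE r in N. integrable \<mu> (\<lambda>x. case (r, x) of (r, x) \<Rightarrow> \<Phi> r x * g x)"
      using L2 g by (auto intro: L2_times_integrable)
  qed measurable
  show "integrable N (\<lambda>r. L2_inner \<mu> (\<Phi> r) g)"
    using P.integrable_fst[OF int] by (simp add: L2_inner_def)
  show "L2_inner \<mu> (\<lambda>x. \<integral>r. \<Phi> r x \<partial>N) g = (\<integral>r. L2_inner \<mu> (\<Phi> r) g \<partial>N)"
    using P.Fubini_integral[OF int] by (simp add: L2_inner_def)
qed

text \<open>A concrete pointwise representative of the strong integral of Q_r. At the points where
  the integrand is not integrable its value is 0 by convention.\<close>

definition avg_mix :: "real measure \<Rightarrow> ('a \<Rightarrow> real) \<Rightarrow> ('a \<Rightarrow> real)" where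
  "avg_mix N f x = (\<integral>r. avg \<mu> r f x \<partial>N)"

context
  fixes N :: "real measure"
  assumes N: "ray_measure N"
begin

lemma measurable_avg_pair [measurable]:
  assumes [measurable]: "f \<in> borel_measurable \<mu>"
  shows "(\<lambda>(r, x). avg \<mu> r f x) \<in> borel_measurable (N \<Otimes>\<^sub>M \<mu>)"
proof -
  have [measurable]: "(\<lambda>r. r) \<in> borel_measurable N" by (rule ray_measure_borel[OF N])
  have [measurable]: "fst \<in> borel_measurable (N \<Otimes>\<^sub>M \<mu>)"
    using measurable_compose[OF measurable_fst ray_measure_borel[OF N]] by (simp add: id_def)
  show ?thesis unfolding split_beta' by measurable
qed

lemma avg_mix_AE_integrable: "f \<in> L2 \<mu> \<Longrightarrow> AE x in \<mu>. integrable N (\<lambda>r. avg \<mu> r f x)"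
proof -
  assume f: "f \<in> L2 \<mu>"
  then have "AE x in \<mu>. (\<lambda>r. avg \<mu> r f x) \<in> L2 N"
    by (intro integral_L2(1)[OF ray_measure_finite[OF N] measurable_avg_pair[OF L2_borel] avg_L2 avg_norm_le])
  then show ?thesis
    by eventually_elim (rule integral_square_le(1)[OF ray_measure_finite[OF N]])
qed

lemma avg_mix_L2: "f \<in> L2 \<mu> \<Longrightarrow> avg_mix N f \<in> L2 \<mu>"
  unfolding avg_mix_def[abs_def]
  by (rule integral_L2(2)[OF ray_measure_finite[OF N] measurable_avg_pair[OF L2_borel] avg_L2 avg_norm_le])

lemma avg_mix_integrable_inner:
  "f \<in> L2 \<mu> \<Longrightarrow> g \<in> L2 \<mu> \<Longrightarrow> integrable N (\<lambda>r. L2_inner \<mu> (avg \<mu> r f) g)"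
  by (rule inner_integral_L2(1)[OF ray_measure_finite[OF N] measurable_avg_pair[OF L2_borel] avg_L2 avg_norm_le])

lemma avg_mix_inner:
  "f \<in> L2 \<mu> \<Longrightarrow> g \<in> L2 \<mu> \<Longrightarrow> L2_inner \<mu> (avg_mix N f) g = (\<integral>r. L2_inner \<mu> (avg \<mu> r f) g \<partial>N)"
  unfolding avg_mix_def[abs_def]
  by (rule inner_integral_L2(2)[OF ray_measure_finite[OF N] measurable_avg_pair[OF L2_borel] avg_L2 avg_norm_le])

lemma avg_mix_norm_le:
  assumes f: "f \<in> L2 \<mu>"
  shows "L2_norm \<mu> (avg_mix N f) \<le> measure N (space N) * L2_norm \<mu> f"
proof (rule power2_le_imp_le)
  interpret finite_measure N by (rule ray_measure_finite[OF N])
  let ?m = "measure N (space N)"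
  have "(L2_norm \<mu> (avg_mix N f))\<^sup>2 \<le> ?m * (\<integral>r. (L2_norm \<mu> (avg \<mu> r f))\<^sup>2 \<partial>N)"
    unfolding avg_mix_def[abs_def]
    by (rule integral_L2(3)[OF ray_measure_finite[OF N] measurable_avg_pair[OF L2_borel] avg_L2 avg_norm_le]) (rule f)+
  also have "\<dots> \<le> ?m * (\<integral>r. (L2_norm \<mu> f)\<^sup>2 \<partial>N)"
  proof (intro mult_left_mono integral_mono)
    have [measurable]: "f \<in> borel_measurable \<mu>" using f by (rule L2_borel)
    have "(\<lambda>r. (L2_norm \<mu> (avg \<mu> r f))\<^sup>2) \<in> borel_measurable N"
      unfolding L2_norm_sq_integral by measurable
    then show "integrable N (\<lambda>r. (L2_norm \<mu> (avg \<mu> r f))\<^sup>2)"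
      by (intro integrable_const_bound[where B = "(L2_norm \<mu> f)\<^sup>2"])
         (auto intro!: power_mono avg_norm_le f)
  qed (auto intro!: power_mono avg_norm_le f)
  also have "\<dots> = (?m * L2_norm \<mu> f)\<^sup>2" by (simp add: power2_eq_square)
  finally show "(L2_norm \<mu> (avg_mix N f))\<^sup>2 \<le> (?m * L2_norm \<mu> f)\<^sup>2" .
qed (simp add: measure_nonneg)

lemma avg_mix_operator: "L2_operator \<mu> (avg_mix N)"
  unfolding L2_operator_def
proof (intro conjI ballI allI)
  fix f g assume f: "f \<in> L2 \<mu>" and g: "g \<in> L2 \<mu>"
  show "AE x in \<mu>. avg_mix N (\<lambda>y. f y + g y) x = avg_mix N f x + avg_mix N g x"
    using avg_mix_AE_integrable[OF f] avg_mix_AE_integrable[OF g]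
    by eventually_elim (simp add: avg_mix_def avg_add f g)
next
  show "\<exists>C. \<forall>f\<in>L2 \<mu>. L2_norm \<mu> (avg_mix N f) \<le> C * L2_norm \<mu> f"
    using avg_mix_norm_le by blast
qed (auto simp: avg_mix_def avg_mix_L2 avg_cmult)

lemma avg_mix_selfadjoint: "L2_selfadjoint \<mu> (avg_mix N)"
  unfolding L2_selfadjoint_def
proof (intro conjI ballI avg_mix_operator)
  fix f g assume f: "f \<in> L2 \<mu>" and g: "g \<in> L2 \<mu>"
  show "L2_inner \<mu> (avg_mix N f) g = L2_inner \<mu> f (avg_mix N g)"
    unfolding L2_inner_commute[of _ f "avg_mix N g"] avg_mix_inner[OF f g] avg_mix_inner[OF g f]
    by (intro Bochner_Integration.integral_cong refl)
       (simp add: avg_selfadjoint f g L2_inner_commute[of _ _ f])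
qed

end

lemma avg_mix_inner_avg_mix:
  assumes N: "ray_measure N" and N': "ray_measure N'" and f: "f \<in> L2 \<mu>" and g: "g \<in> L2 \<mu>"
  shows "L2_inner \<mu> (avg_mix N f) (avg_mix N' g) =
    (\<integral>r. (\<integral>s. L2_inner \<mu> (avg \<mu> (max r s) f) g \<partial>N') \<partial>N)"
proof -
  have "L2_inner \<mu> (avg_mix N f) (avg_mix N' g) = (\<integral>r. L2_inner \<mu> (avg_mix N' g) (avg \<mu> r f) \<partial>N)"
    using avg_mix_inner[OF N f avg_mix_L2[OF N' g]] by (simp add: L2_inner_commute)
  also have "\<dots> = (\<integral>r. (\<integral>s. L2_inner \<mu> (avg \<mu> s g) (avg \<mu> r f) \<partial>N') \<partial>N)"
    by (simp add: avg_mix_inner[OF N' g avg_L2[OF f]])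
  also have "\<dots> = (\<integral>r. (\<integral>s. L2_inner \<mu> (avg \<mu> (max r s) f) g \<partial>N') \<partial>N)"
    using inner_avg_avg[OF f g]
    by (intro Bochner_Integration.integral_cong refl)
       (simp add: ray_measure_space[OF N] ray_measure_space[OF N'] L2_inner_commute[of _ "avg \<mu> _ g"])
  finally show ?thesis .
qed

end

section \<open>Strong continuity of the averages\<close>

context ultrametric_measure
begin

definition energy :: "('a \<Rightarrow> real) \<Rightarrow> real \<Rightarrow> real" where
  "energy f r = L2_inner \<mu> (avg \<mu> r f) f"

lemma energy_eq: "f \<in> L2 \<mu> \<Longrightarrow> 0 \<le> r \<Longrightarrow> energy f r = (L2_norm \<mu> (avg \<mu> r f))\<^sup>2"
  using inner_avg_avg[of f f r r] by (simp add: energy_def L2_norm_sq)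

lemma energy_0: "energy f 0 = (L2_norm \<mu> f)\<^sup>2"
  by (simp add: energy_def avg_nonpos L2_norm_sq)

text \<open>For nested projectors \<parallel>Q_s f\<parallel>^2 is the inner product of Q_s f and
  Q_r f; Cauchy-Schwarz and division by \<parallel>Q_s f\<parallel> finish, the case of norm 0 being
  trivial.\<close>

lemma avg_norm_antimono:
  assumes f: "f \<in> L2 \<mu>" and "0 \<le> r" "r \<le> s"
  shows "L2_norm \<mu> (avg \<mu> s f) \<le> L2_norm \<mu> (avg \<mu> r f)"
proof -
  have "(L2_norm \<mu> (avg \<mu> s f))\<^sup>2 = L2_inner \<mu> (avg \<mu> s f) (avg \<mu> r f)"
    using inner_avg_avg[of f f s r] inner_avg_avg[of f f s s] assms by (simp add: L2_norm_sq max_absorb1)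
  also have "\<dots> \<le> L2_norm \<mu> (avg \<mu> s f) * L2_norm \<mu> (avg \<mu> r f)"
    using L2_Cauchy_Schwarz[of "avg \<mu> s f" \<mu> "avg \<mu> r f"] f by simp
  finally show ?thesis
    using L2_norm_nonneg[of \<mu> "avg \<mu> s f"] L2_norm_nonneg[of \<mu> "avg \<mu> r f"]
    by (cases "L2_norm \<mu> (avg \<mu> s f) = 0") (auto simp: power2_eq_square simp del: L2_norm_nonneg)
qed

lemma energy_antimono: "f \<in> L2 \<mu> \<Longrightarrow> 0 \<le> r \<Longrightarrow> r \<le> s \<Longrightarrow> energy f s \<le> energy f r"
  by (simp add: energy_eq avg_norm_antimono power_mono)

lemma energy_nonneg: "f \<in> L2 \<mu> \<Longrightarrow> 0 \<le> r \<Longrightarrow> 0 \<le> energy f r"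
  by (simp add: energy_eq)

lemma energy_le: "f \<in> L2 \<mu> \<Longrightarrow> 0 \<le> r \<Longrightarrow> energy f r \<le> (L2_norm \<mu> f)\<^sup>2"
  using energy_antimono[of f 0 r] by (simp add: energy_0)

text \<open>Pythagoras for nested projectors. It reduces norm continuity of Q_r f in r to continuity
  of the real function \<open>energy f\<close>.\<close>

lemma norm_avg_diff_sq:
  assumes f: "f \<in> L2 \<mu>" and "0 \<le> r" "r \<le> s"
  shows "(L2_norm \<mu> (\<lambda>x. avg \<mu> r f x - avg \<mu> s f x))\<^sup>2 = energy f r - energy f s"
  using f inner_avg_avg[of f f r s] inner_avg_avg[of f f s r] inner_avg_avg[of f f r r]
    inner_avg_avg[of f f s s] assms
  by (simp add: L2_norm_sq L2_inner_diff_left L2_inner_diff_right L2_diff energy_def max_absorb1 max_absorb2)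

text \<open>One radius per e already amounts to convergence as r tends to 0, because the distance is
  monotone in the radius (\<open>avg_dist_mono\<close>).\<close>

definition avg_converges :: "('a \<Rightarrow> real) \<Rightarrow> bool" where
  "avg_converges f \<longleftrightarrow> f \<in> L2 \<mu> \<and> (\<forall>e>0. \<exists>s>0. L2_norm \<mu> (\<lambda>x. avg \<mu> s f x - f x) < e)"

lemma avg_dist_mono:
  assumes f: "f \<in> L2 \<mu>" and "0 \<le> r" "r \<le> s"
  shows "L2_norm \<mu> (\<lambda>x. avg \<mu> r f x - f x) \<le> L2_norm \<mu> (\<lambda>x. avg \<mu> s f x - f x)"
proof (rule power2_le_imp_le)
  have "(L2_norm \<mu> (\<lambda>x. avg \<mu> q f x - f x))\<^sup>2 = energy f 0 - energy f q" if "0 \<le> q" for q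
    using norm_avg_diff_sq[OF f order_refl that] by (subst L2_norm_minus_commute) (simp add: avg_nonpos)
  with assms energy_antimono[of f r s]
  show "(L2_norm \<mu> (\<lambda>x. avg \<mu> r f x - f x))\<^sup>2 \<le> (L2_norm \<mu> (\<lambda>x. avg \<mu> s f x - f x))\<^sup>2" by simp
qed simp

lemma avg_converges_cmult: 
  assumes "avg_converges f" shows "avg_converges (\<lambda>x. c * f x)"
  unfolding avg_converges_def
proof (intro conjI allI impI)
  fix e :: real assume "0 < e"
  then obtain s where s: "0 < s" "L2_norm \<mu> (\<lambda>x. avg \<mu> s f x - f x) < e / (\<bar>c\<bar> + 1)"
    using assms unfolding avg_converges_def by (metis abs_ge_zero add_nonneg_pos divide_pos_pos zero_less_one)
  have "L2_norm \<mu> (\<lambda>x. avg \<mu> s (\<lambda>x. c * f x) x - c * f x) = \<bar>c\<bar> * L2_norm \<mu> (\<lambda>x. avg \<mu> s f x - f x)"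
    unfolding avg_cmult right_diff_distrib[symmetric] by (rule L2_norm_cmult)
  also have "\<dots> \<le> (\<bar>c\<bar> + 1) * L2_norm \<mu> (\<lambda>x. avg \<mu> s f x - f x)"
    by (intro mult_right_mono) auto
  also have "\<dots> < e" using s(2) by (simp add: field_simps)
  finally show "\<exists>s>0. L2_norm \<mu> (\<lambda>x. avg \<mu> s (\<lambda>x. c * f x) x - c * f x) < e" using s(1) by blast
qed (use assms in \<open>auto simp: avg_converges_def\<close>)

lemma avg_converges_add: 
  assumes f: "avg_converges f" and g: "avg_converges g" shows "avg_converges (\<lambda>x. f x + g x)"
  unfolding avg_converges_def
proof (intro conjI allI impI)
  have fL: "f \<in> L2 \<mu>" and gL: "g \<in> L2 \<mu>" using f g by (auto simp: avg_converges_def)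
  then show "(\<lambda>x. f x + g x) \<in> L2 \<mu>" by auto
  fix e :: real assume "0 < e"
  then have "0 < e / 2" by simp
  obtain s where s: "0 < s" "L2_norm \<mu> (\<lambda>x. avg \<mu> s f x - f x) < e / 2"
    using f \<open>0 < e / 2\<close> unfolding avg_converges_def by blast
  obtain t where t: "0 < t" "L2_norm \<mu> (\<lambda>x. avg \<mu> t g x - g x) < e / 2"
    using g \<open>0 < e / 2\<close> unfolding avg_converges_def by blast
  let ?r = "min s t"
  have "L2_norm \<mu> (\<lambda>x. avg \<mu> ?r (\<lambda>x. f x + g x) x - (f x + g x)) =
      L2_norm \<mu> (\<lambda>x. (avg \<mu> ?r f x - f x) + (avg \<mu> ?r g x - g x))"
    by (simp add: avg_add fL gL algebra_simps)
  also have "\<dots> \<le> L2_norm \<mu> (\<lambda>x. avg \<mu> ?r f x - f x) + L2_norm \<mu> (\<lambda>x. avg \<mu> ?r g x - g x)"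
    using fL gL by (intro L2_norm_triangle) auto
  also have "\<dots> < e"
    using avg_dist_mono[OF fL, of ?r s] avg_dist_mono[OF gL, of ?r t] s t by simp
  finally show "\<exists>s>0. L2_norm \<mu> (\<lambda>x. avg \<mu> s (\<lambda>x. f x + g x) x - (f x + g x)) < e"
    using s(1) t(1) by (intro exI[of _ ?r]) simp
qed

lemma avg_converges_sum:
  "finite I \<Longrightarrow> (\<And>i. i \<in> I \<Longrightarrow> avg_converges (f i)) \<Longrightarrow> avg_converges (\<lambda>x. \<Sum>i\<in>I. f i x)"
proof (induction I rule: finite_induct)
  case empty
  have "\<exists>s>0. L2_norm \<mu> (\<lambda>x. avg \<mu> s (\<lambda>_. 0) x - 0) < e" if "0 < e" for e
    using that by (intro exI[of _ 1]) (simp add: avg_const L2_norm_def L2_inner_def)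
  then show ?case by (simp add: avg_converges_def)
qed (simp add: avg_converges_add)

text \<open>Three-epsilon argument; contractivity of Q_s carries the approximation error
  through.\<close>

lemma avg_converges_closed:
  assumes f: "f \<in> L2 \<mu>"
    and approx: "\<And>e. 0 < e \<Longrightarrow> \<exists>g. avg_converges g \<and> L2_norm \<mu> (\<lambda>x. f x - g x) < e"
  shows "avg_converges f"
  unfolding avg_converges_def
proof (intro conjI allI impI f)
  fix e :: real assume "0 < e"
  then have e3: "0 < e / 3" by simp
  obtain g where g: "avg_converges g" "L2_norm \<mu> (\<lambda>x. f x - g x) < e / 3"
    using approx[OF e3] by blast
  have gL: "g \<in> L2 \<mu>" using g by (simp add: avg_converges_def)
  obtain s where s: "0 < s" "L2_norm \<mu> (\<lambda>x. avg \<mu> s g x - g x) < e / 3"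
    using g e3 unfolding avg_converges_def by blast
  have "L2_norm \<mu> (\<lambda>x. avg \<mu> s f x - f x) \<le>
      L2_norm \<mu> (\<lambda>x. avg \<mu> s f x - avg \<mu> s g x) + L2_norm \<mu> (\<lambda>x. avg \<mu> s g x - f x)"
    using f gL by (intro L2_norm_diff_triangle) auto
  also have "L2_norm \<mu> (\<lambda>x. avg \<mu> s f x - avg \<mu> s g x) = L2_norm \<mu> (avg \<mu> s (\<lambda>x. f x - g x))"
    unfolding avg_diff[OF f gL, symmetric] by simp
  also have "\<dots> \<le> L2_norm \<mu> (\<lambda>x. f x - g x)"
    using f gL by (intro avg_norm_le) auto
  also have "L2_norm \<mu> (\<lambda>x. avg \<mu> s g x - f x) \<le>
      L2_norm \<mu> (\<lambda>x. avg \<mu> s g x - g x) + L2_norm \<mu> (\<lambda>x. g x - f x)"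
    using f gL by (intro L2_norm_diff_triangle) auto
  finally have "L2_norm \<mu> (\<lambda>x. avg \<mu> s f x - f x) < e"
    using g(2) s(2) L2_norm_minus_commute[of \<mu> f g] by simp
  with s(1) show "\<exists>s>0. L2_norm \<mu> (\<lambda>x. avg \<mu> s f x - f x) < e" by blast
qed

lemma norm_indicator_diff_sq:
  assumes "B \<subseteq> A" and [measurable]: "A \<in> sets borel" "B \<in> sets borel" and fin: "emeasure \<mu> A < \<infinity>"
  shows "(L2_norm \<mu> (\<lambda>x. indicat_real A x - indicat_real B x))\<^sup>2 = measure \<mu> A - measure \<mu> B"
proof -
  have "(\<lambda>x. (indicat_real A x - indicat_real B x)\<^sup>2) = indicat_real (A - B)"
    using assms(1) by (auto simp: indicator_def fun_eq_iff)
  then have "(L2_norm \<mu> (\<lambda>x. indicat_real A x - indicat_real B x))\<^sup>2 = measure \<mu> (A - B)"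
    unfolding L2_norm_sq_integral by simp
  also have "\<dots> = measure \<mu> A - measure \<mu> B"
  proof (rule measure_Diff)
    show "emeasure \<mu> A \<noteq> \<infinity>" using fin by simp
  qed (use assms in auto)
  finally show ?thesis .
qed

lemma open_cball: "0 < r \<Longrightarrow> open (cball (x :: 'a) r)"
  unfolding open_contains_ball
proof
  fix y assume "0 < r" "y \<in> cball x r"
  then have "ball y r \<subseteq> cball x r" using cball_eq_cball[of x y r] by auto
  with \<open>0 < r\<close> show "\<exists>e>0. ball y e \<subseteq> cball x r" by blast
qed

text \<open>The r-neighbourhood of K is a union of balls of radius r, so Q_r fixes its indicator. As
  r decreases to 0 these neighbourhoods have finite measure and shrink to K, since K is bounded and
  closed.\<close>

lemma avg_converges_indicator_compact:
  assumes K: "compact K" shows "avg_converges (indicat_real K)"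
proof (rule avg_converges_closed)
  have [measurable]: "K \<in> sets borel" using K by (intro borel_closed compact_imp_closed)
  show "indicat_real K \<in> L2 \<mu>" by (intro indicator_L2 emeasure_compact_finite K) simp
  define U where "U r = (\<Union>x\<in>K. cball x r)" for r :: real
  have U_open: "open (U r)" if "0 < r" for r
    unfolding U_def using that by (intro open_UN ballI open_cball)
  have U_sub: "K \<subseteq> U r" if "0 < r" for r using that by (force simp: U_def)
  have U_finite: "emeasure \<mu> (U r) < \<infinity>" for r
  proof -
    obtain x0 B where B: "\<And>x. x \<in> K \<Longrightarrow> dist x0 x \<le> B"
      using compact_imp_bounded[OF K] by (auto simp: bounded_def)
    have "U r \<subseteq> cball x0 (B + r)"
    proof
      fix y assume "y \<in> U r"
      then obtain x where "x \<in> K" "dist x y \<le> r" by (auto simp: U_def)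
      with B[of x] dist_triangle[of x0 y x] show "y \<in> cball x0 (B + r)" by simp
    qed
    then have "emeasure \<mu> (U r) \<le> emeasure \<mu> (cball x0 (B + r))"
      by (intro emeasure_mono) auto
    also have "\<dots> < \<infinity>" by (rule emeasure_cball_finite)
    finally show ?thesis .
  qed
  have conv: "avg_converges (indicat_real (U r))" if "0 < r" for r
  proof -
    have "avg \<mu> r (indicat_real (U r)) x = indicat_real (U r) x" for x
    proof (rule avg_invariant)
      fix y assume "y \<in> cball x r"
      then have "dist x y \<le> r" by simp
      have "z \<in> cball y r \<longleftrightarrow> z \<in> cball x r" for z
        using cball_eq_cball[OF \<open>dist x y \<le> r\<close>] by simp
      then have "y \<in> U r \<longleftrightarrow> x \<in> U r"
        by (simp add: U_def dist_commute)
      then show "indicat_real (U r) y = indicat_real (U r) x" by (simp add: indicator_def)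
    qed
    then have "L2_norm \<mu> (\<lambda>x. avg \<mu> r (indicat_real (U r)) x - indicat_real (U r) x) = 0"
      by (simp add: L2_norm_def L2_inner_def)
    with that U_open[OF that] U_finite[of r] show ?thesis
      unfolding avg_converges_def by (auto intro!: indicator_L2 borel_open exI[of _ r])
  qed
  define A where "A n = U (inverse (real (Suc n)))" for n
  have A_sets: "A n \<in> sets \<mu>" for n unfolding A_def by (simp add: borel_open U_open)
  have "(\<lambda>n. measure \<mu> (A n)) \<longlonglongrightarrow> measure \<mu> (\<Inter>n. A n)"
  proof (rule Lim_measure_decseq)
    show "decseq A"
    proof (rule decseq_SucI)
      fix n
      have "inverse (real (Suc (Suc n))) \<le> inverse (real (Suc n))" by simp
      then show "A (Suc n) \<subseteq> A n" unfolding A_def U_def by (intro UN_mono subset_refl subset_cball)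
    qed
    show "emeasure \<mu> (A n) \<noteq> \<infinity>" for n using U_finite unfolding A_def by (simp add: less_top)
  qed (use A_sets in auto)
  also have "(\<Inter>n. A n) = K"
  proof (intro equalityI subsetI)
    fix y assume y: "y \<in> (\<Inter>n. A n)"
    have "\<exists>x\<in>K. dist x y < e" if e: "0 < e" for e
    proof -
      obtain n where n: "inverse (real (Suc n)) < e" using reals_Archimedean[OF e] by blast
      have "y \<in> A n" using y by blast
      then obtain x where "x \<in> K" "dist x y \<le> inverse (real (Suc n))" unfolding A_def U_def by auto
      with n show ?thesis by force
    qed
    then have "y \<in> closure K" by (simp add: closure_approachable)
    then show "y \<in> K" using compact_imp_closed[OF K] by simp
  next
    show "y \<in> (\<Inter>n. A n)" if "y \<in> K" for y
    proof
      show "y \<in> A n" for n using U_sub[of "inverse (real (Suc n))"] that unfolding A_def by auto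
    qed
  qed
  finally have lim: "(\<lambda>n. measure \<mu> (A n)) \<longlonglongrightarrow> measure \<mu> K" .
  fix e :: real assume "0 < e"
  then have "0 < e\<^sup>2" by simp
  then have "\<forall>\<^sub>F n in sequentially. measure \<mu> (A n) < measure \<mu> K + e\<^sup>2"
    by (intro order_tendstoD(2)[OF lim]) simp
  then obtain n where n: "measure \<mu> (A n) < measure \<mu> K + e\<^sup>2"
    using eventually_happens'[OF sequentially_bot] by blast
  have "(L2_norm \<mu> (\<lambda>x. indicat_real K x - indicat_real (A n) x))\<^sup>2 < e\<^sup>2"
    unfolding L2_norm_minus_commute[of _ "indicat_real K"]
    using n A_sets[of n] U_finite U_sub
    by (subst norm_indicator_diff_sq) (auto simp: A_def)
  then have "L2_norm \<mu> (\<lambda>x. indicat_real K x - indicat_real (A n) x) < e"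
    by (rule power2_less_imp_less) (use \<open>0 < e\<close> in simp)
  moreover have "avg_converges (indicat_real (A n))" unfolding A_def by (rule conv) simp
  ultimately show "\<exists>g. avg_converges g \<and> L2_norm \<mu> (\<lambda>x. indicat_real K x - g x) < e" by blast
qed

text \<open>Inner regularity replaces A by a compact subset at the cost of a small L2 error.\<close>

lemma avg_converges_indicator:
  assumes [measurable]: "A \<in> sets borel" and fin: "emeasure \<mu> A < \<infinity>"
  shows "avg_converges (indicat_real A)"
proof (rule avg_converges_closed)
  show "indicat_real A \<in> L2 \<mu>" using fin by (intro indicator_L2) auto
  fix e :: real assume "0 < e"
  have inner: "emeasure \<mu> A = (SUP K\<in>{K. compact K \<and> K \<subseteq> A}. emeasure \<mu> K)"
    using radon assms(1) by (auto simp: radon_measure_def)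
  have "\<exists>K\<in>{K. compact K \<and> K \<subseteq> A}. emeasure \<mu> A < emeasure \<mu> K + ennreal (e\<^sup>2)"
    using \<open>0 < e\<close> fin by (intro SUP_approx_ennreal inner) (auto intro: exI[of _ "{}"])
  then obtain K where K: "compact K" "K \<subseteq> A" "emeasure \<mu> A < emeasure \<mu> K + ennreal (e\<^sup>2)" by blast
  have K_meas: "K \<in> sets borel" using K(1) by (intro borel_closed compact_imp_closed)
  have "ennreal (measure \<mu> A) < ennreal (measure \<mu> K) + ennreal (e\<^sup>2)"
    using K(3) fin emeasure_compact_finite[OF K(1)]
    by (simp add: emeasure_eq_ennreal_measure less_top)
  then have "measure \<mu> A < measure \<mu> K + e\<^sup>2" by (simp add: ennreal_less_iff flip: ennreal_plus)
  then have "(L2_norm \<mu> (\<lambda>x. indicat_real A x - indicat_real K x))\<^sup>2 < e\<^sup>2"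
    using K(2) K_meas fin by (subst norm_indicator_diff_sq) auto
  then have "L2_norm \<mu> (\<lambda>x. indicat_real A x - indicat_real K x) < e"
    by (rule power2_less_imp_less) (use \<open>0 < e\<close> in simp)
  with avg_converges_indicator_compact[OF K(1)]
  show "\<exists>g. avg_converges g \<and> L2_norm \<mu> (\<lambda>x. indicat_real A x - g x) < e" by blast
qed

lemma avg_converges_simple:
  assumes s: "simple_function \<mu> f" and f: "f \<in> L2 \<mu>"
  shows "avg_converges f"
proof -
  have [measurable]: "f \<in> borel_measurable \<mu>" using f by (rule L2_borel)
  have fin: "finite (range f)" using s by (simp add: simple_function_def)
  \<comment> \<open>The value 0 is left out because its level set may have infinite measure; for the
    other values Chebyshev's inequality gives finiteness.\<close>
  have "avg_converges (\<lambda>x. \<Sum>y\<in>range f - {0}. y * indicat_real {x. f x = y} x)"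
  proof (rule avg_converges_sum)
    fix y assume y: "y \<in> range f - {0}"
    have set: "{x. f x = y} \<in> sets \<mu>"
      using simple_functionD(2)[OF s, of "{y}"] by (simp add: vimage_def)
    have "ennreal (y\<^sup>2) * emeasure \<mu> {x. f x = y} = (\<integral>\<^sup>+x. ennreal (y\<^sup>2) * indicator {x. f x = y} x \<partial>\<mu>)"
      using set by (subst nn_integral_cmult_indicator) auto
    also have "\<dots> \<le> (\<integral>\<^sup>+x. ennreal ((f x)\<^sup>2) \<partial>\<mu>)"
      by (intro nn_integral_mono) (auto simp: indicator_def)
    also have "\<dots> < \<infinity>" using f by (auto simp: L2_iff integrable_iff_bounded)
    finally have "emeasure \<mu> {x. f x = y} < \<infinity>"
      using y by (auto simp: ennreal_mult_less_top)
    with set show "avg_converges (\<lambda>x. y * indicat_real {x. f x = y} x)"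
      by (intro avg_converges_cmult avg_converges_indicator) auto
  qed (use fin in simp)
  also have "(\<lambda>x. \<Sum>y\<in>range f - {0}. y * indicat_real {x. f x = y} x) = f"
  proof
    fix x
    have "(\<Sum>y\<in>range f - {0}. y * indicat_real {x. f x = y} x) = (\<Sum>y\<in>range f. y * indicat_real {x. f x = y} x)"
      using fin by (intro sum.mono_neutral_left) auto
    also have "\<dots> = (\<Sum>y\<in>range f. if y = f x then y else 0)"
      by (intro sum.cong) (auto simp: indicator_def)
    also have "\<dots> = f x" using fin by (subst sum.delta) auto
    finally show "(\<Sum>y\<in>range f - {0}. y * indicat_real {x. f x = y} x) = f x" .
  qed
  finally show ?thesis .
qed

lemma avg_converges:
  assumes f: "f \<in> L2 \<mu>" shows "avg_converges f"
proof (rule avg_converges_closed[OF f])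
  have f_meas [measurable]: "f \<in> borel_measurable \<mu>" using f by (rule L2_borel)
  \<comment> \<open>The bound |F i| \<le> 2 |f| gives the majorants 4 f^2 for the square of F i and
    9 f^2 for the square of f - F i used below.\<close>
  obtain F where F: "\<And>i. simple_function \<mu> (F i)" "\<And>x. (\<lambda>i. F i x) \<longlonglongrightarrow> f x"
    "\<And>i x. \<bar>F i x\<bar> \<le> 2 * \<bar>f x\<bar>"
    using borel_measurable_implies_sequence_metric[OF f_meas, of 0] by auto
  have [measurable]: "F i \<in> borel_measurable \<mu>" for i
    using F(1) by (rule borel_measurable_simple_function)
  have sq: "integrable \<mu> (\<lambda>x. (f x)\<^sup>2)" using f by (simp add: L2_iff)
  have F_L2: "F i \<in> L2 \<mu>" for i
    unfolding L2_iff
  proof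
    show "integrable \<mu> (\<lambda>x. (F i x)\<^sup>2)"
    proof (rule Bochner_Integration.integrable_bound)
      show "integrable \<mu> (\<lambda>x. 4 * (f x)\<^sup>2)" using sq by simp
      show "AE x in \<mu>. norm ((F i x)\<^sup>2) \<le> norm (4 * (f x)\<^sup>2)"
      proof (rule AE_I2)
        fix x
        have "\<bar>F i x\<bar>\<^sup>2 \<le> (2 * \<bar>f x\<bar>)\<^sup>2" by (intro power_mono F(3)) simp
        then show "norm ((F i x)\<^sup>2) \<le> norm (4 * (f x)\<^sup>2)" by (simp add: power_mult_distrib)
      qed
    qed measurable
  qed measurable
  have "(\<lambda>i. \<integral>x. (f x - F i x)\<^sup>2 \<partial>\<mu>) \<longlonglongrightarrow> (\<integral>x. 0 \<partial>\<mu>)"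
  proof (rule integral_dominated_convergence)
    show "integrable \<mu> (\<lambda>x. 9 * (f x)\<^sup>2)" using sq by simp
    show "AE x in \<mu>. (\<lambda>i. (f x - F i x)\<^sup>2) \<longlonglongrightarrow> 0"
    proof (rule AE_I2)
      fix x
      have "(\<lambda>i. (f x - F i x)\<^sup>2) \<longlonglongrightarrow> (f x - f x)\<^sup>2" by (intro tendsto_intros F(2))
      then show "(\<lambda>i. (f x - F i x)\<^sup>2) \<longlonglongrightarrow> 0" by simp
    qed
    show "AE x in \<mu>. norm ((f x - F i x)\<^sup>2) \<le> 9 * (f x)\<^sup>2" for i
    proof (rule AE_I2)
      fix x
      have "\<bar>f x - F i x\<bar>\<^sup>2 \<le> (3 * \<bar>f x\<bar>)\<^sup>2" using F(3)[of i x] by (intro power_mono) auto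
      then show "norm ((f x - F i x)\<^sup>2) \<le> 9 * (f x)\<^sup>2" by (simp add: power_mult_distrib)
    qed
  qed measurable
  then have lim: "(\<lambda>i. (L2_norm \<mu> (\<lambda>x. f x - F i x))\<^sup>2) \<longlonglongrightarrow> 0"
    by (simp add: L2_norm_sq_integral)
  fix e :: real assume "0 < e"
  then have "\<forall>\<^sub>F i in sequentially. (L2_norm \<mu> (\<lambda>x. f x - F i x))\<^sup>2 < e\<^sup>2"
    by (intro order_tendstoD(2)[OF lim]) simp
  then obtain i where "(L2_norm \<mu> (\<lambda>x. f x - F i x))\<^sup>2 < e\<^sup>2"
    using eventually_happens'[OF sequentially_bot] by blast
  then have "L2_norm \<mu> (\<lambda>x. f x - F i x) < e"
    by (rule power2_less_imp_less) (use \<open>0 < e\<close> in simp)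
  with avg_converges_simple[OF F(1) F_L2]
  show "\<exists>g. avg_converges g \<and> L2_norm \<mu> (\<lambda>x. f x - g x) < e" by blast
qed

end

section \<open>The spectral formula\<close>

lemma integral_swap_bounded:
  fixes \<phi> :: "'b \<Rightarrow> 'c \<Rightarrow> real"
  assumes A: "finite_measure A" and B: "finite_measure B"
    and [measurable]: "(\<lambda>(a, b). \<phi> a b) \<in> borel_measurable (A \<Otimes>\<^sub>M B)"
    and bound: "\<And>a b. a \<in> space A \<Longrightarrow> b \<in> space B \<Longrightarrow> \<bar>\<phi> a b\<bar> \<le> C"
  shows "(\<integral>a. (\<integral>b. \<phi> a b \<partial>B) \<partial>A) = (\<integral>b. (\<integral>a. \<phi> a b \<partial>A) \<partial>B)"
proof -
  interpret A: finite_measure A by fact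
  interpret B: finite_measure B by fact
  interpret pair_sigma_finite A B ..
  interpret P: finite_measure "A \<Otimes>\<^sub>M B"
    by (intro finite_measureI) (simp add: B.emeasure_pair_measure_Times space_pair_measure ennreal_mult_eq_top_iff A.emeasure_finite)
  have "integrable (A \<Otimes>\<^sub>M B) (\<lambda>(a, b). \<phi> a b)"
    using bound by (intro P.integrable_const_bound[where B = C]) (auto simp: space_pair_measure)
  from Fubini_integral[OF this] show ?thesis by simp
qed

context ultrametric_measure
begin

text \<open>A closed ball is the intersection of the concentric closed balls of larger radius, so
  numerator and volume converge by dominated convergence. The positive limit of the volume allows
  the division. At r = 0 that limit may vanish, and \<open>avg_converges\<close> takes over.\<close>

lemma tendsto_avg_right:
  assumes f: "f \<in> L2 \<mu>" and "0 < r"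
  shows "(\<lambda>n. avg \<mu> (r + inverse (real (Suc n))) f x) \<longlonglongrightarrow> avg \<mu> r f x"
proof -
  define q where "q n = r + inverse (real (Suc n))" for n
  have q: "r < q n" "q n \<le> r + 1" for n
    by (simp_all add: q_def inverse_le_1_iff)
  have q_lim: "q \<longlonglongrightarrow> r"
    unfolding q_def using tendsto_add[OF tendsto_const LIMSEQ_inverse_real_of_nat, of r] by simp
  have ind: "(\<lambda>n. indicat_real (cball x (q n)) y) \<longlonglongrightarrow> indicat_real (cball x r) y" for y
  proof (cases "dist x y \<le> r")
    case True
    then have "indicat_real (cball x (q n)) y = 1" for n using q(1)[of n] by simp
    with True show ?thesis by simp
  next
    case False
    then have "\<forall>\<^sub>F n in sequentially. q n < dist x y"
      by (intro order_tendstoD(2)[OF q_lim]) simp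
    then have "\<forall>\<^sub>F n in sequentially. indicat_real (cball x (q n)) y = 0"
      by eventually_elim simp
    with False show ?thesis by (simp add: tendsto_eventually)
  qed
  have lim: "(\<lambda>n. \<integral>y. indicator (cball x (q n)) y * h y \<partial>\<mu>) \<longlonglongrightarrow> (\<integral>y. indicator (cball x r) y * h y \<partial>\<mu>)"
    if h: "integrable \<mu> (\<lambda>y. indicator (cball x (r + 1)) y * h y)" and [measurable]: "h \<in> borel_measurable \<mu>" for h :: "'a \<Rightarrow> real"
  proof (rule integral_dominated_convergence)
    show "integrable \<mu> (\<lambda>y. \<bar>indicator (cball x (r + 1)) y * h y\<bar>)" using h by simp
    show "AE y in \<mu>. (\<lambda>n. indicator (cball x (q n)) y * h y) \<longlonglongrightarrow> indicator (cball x r) y * h y"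
      by (intro AE_I2 tendsto_mult ind tendsto_const)
    show "AE y in \<mu>. norm (indicator (cball x (q n)) y * h y) \<le> \<bar>indicator (cball x (r + 1)) y * h y\<bar>" for n
      using q(2)[of n] by (intro AE_I2) (auto simp: indicator_def)
  qed (intro borel_measurable_times borel_measurable_indicator; simp)+
  have "(\<lambda>n. measure \<mu> (cball x (q n))) \<longlonglongrightarrow> measure \<mu> (cball x r)"
    using lim[of "\<lambda>_. 1"] emeasure_cball_finite[of x "r + 1"] by simp
  moreover have "(\<lambda>n. \<integral>y. indicator (cball x (q n)) y * f y \<partial>\<mu>) \<longlonglongrightarrow> (\<integral>y. indicator (cball x r) y * f y \<partial>\<mu>)"
    by (intro lim integrable_indicator_cball f L2_borel[OF f])
  moreover have "measure \<mu> (cball x r) \<noteq> 0" using measure_cball_pos[OF \<open>0 < r\<close>, of x] by simp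
  moreover have "0 < q n" for n using q(1)[of n] \<open>0 < r\<close> by simp
  ultimately show ?thesis
    using \<open>0 < r\<close> unfolding avg_eq q_def[symmetric] by (auto intro: tendsto_divide)
qed

text \<open>Right lower semicontinuity, which for an antimonotone function is right continuity. At r
  = 0 it is the convergence of Q_s f to f; at r > 0 it is Fatou's lemma along the radii r +
  1/(n+1).\<close>

lemma energy_right_open:
  assumes f: "f \<in> L2 \<mu>" and "0 \<le> r" and u: "u < energy f r"
  shows "\<exists>s>r. u < energy f s"
proof (cases "r = 0")
  case True
  define e where "e = sqrt (energy f 0 - u)"
  have e: "0 < e" "e\<^sup>2 = energy f 0 - u" using u True by (auto simp: e_def)
  with avg_converges[OF f] obtain s where s: "0 < s" "L2_norm \<mu> (\<lambda>x. avg \<mu> s f x - f x) < e"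
    unfolding avg_converges_def by blast
  have "energy f 0 - energy f s = (L2_norm \<mu> (\<lambda>x. avg \<mu> s f x - f x))\<^sup>2"
    using norm_avg_diff_sq[OF f order_refl, of s] s(1)
    by (subst L2_norm_minus_commute) (simp add: avg_nonpos)
  also have "\<dots> < e\<^sup>2" using s(2) by (intro power_strict_mono) auto
  finally show ?thesis using e s(1) True by auto
next
  case False
  then have "0 < r" using \<open>0 \<le> r\<close> by simp
  show ?thesis
  proof (rule ccontr)
    assume no: "\<not> ?thesis"
    define q where "q n = r + inverse (real (Suc n))" for n
    have q: "r < q n" for n by (simp add: q_def)
    have [measurable]: "avg \<mu> s f \<in> borel_measurable \<mu>" for s using f by (intro L2_borel avg_L2)
    have sq: "(\<integral>\<^sup>+x. ennreal ((avg \<mu> s f x)\<^sup>2) \<partial>\<mu>) = ennreal (energy f s)" if "0 \<le> s" for s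
      using that f avg_L2[OF f, of s]
      by (subst nn_integral_eq_integral) (auto simp: L2_iff energy_eq L2_norm_sq_integral)
    have "ennreal (energy f r) = (\<integral>\<^sup>+x. liminf (\<lambda>n. ennreal ((avg \<mu> (q n) f x)\<^sup>2)) \<partial>\<mu>)"
    proof (subst sq[OF \<open>0 \<le> r\<close>, symmetric], rule nn_integral_cong)
      fix x
      have "(\<lambda>n. ennreal ((avg \<mu> (q n) f x)\<^sup>2)) \<longlonglongrightarrow> ennreal ((avg \<mu> r f x)\<^sup>2)"
        unfolding q_def using tendsto_avg_right[OF f \<open>0 < r\<close>, of x] by (intro tendsto_ennrealI tendsto_power)
      then show "ennreal ((avg \<mu> r f x)\<^sup>2) = liminf (\<lambda>n. ennreal ((avg \<mu> (q n) f x)\<^sup>2))"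
        by (intro lim_imp_Liminf[symmetric]) auto
    qed
    also have "\<dots> \<le> liminf (\<lambda>n. \<integral>\<^sup>+x. ennreal ((avg \<mu> (q n) f x)\<^sup>2) \<partial>\<mu>)"
      by (rule nn_integral_liminf) measurable
    also have "\<dots> \<le> liminf (\<lambda>n. ennreal u)"
    proof (intro Liminf_mono always_eventually allI)
      fix n
      have "energy f (q n) \<le> u" using no q[of n] by (meson not_less)
      then show "(\<integral>\<^sup>+x. ennreal ((avg \<mu> (q n) f x)\<^sup>2) \<partial>\<mu>) \<le> ennreal u"
        using q[of n] \<open>0 < r\<close> by (subst sq) (auto intro: ennreal_leI)
    qed
    also have "\<dots> = ennreal u" by (simp add: Liminf_const)
    \<comment> \<open>\<open>ennreal\<close> maps negative numbers to 0, hence the second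
      alternative. It is removed by u \<ge> 0, which holds because u bounds an energy from
      above.\<close>
    finally have "energy f r \<le> u \<or> energy f r \<le> 0"
      by (metis ennreal_le_iff ennreal_neg le_cases ennreal_eq_0_iff le_zero_eq)
    moreover have "0 \<le> u"
    proof -
      have "energy f (q 0) \<le> u" using no q[of 0] by (meson not_less)
      moreover have "0 \<le> energy f (q 0)" using q[of 0] \<open>0 < r\<close> f by (intro energy_nonneg) auto
      ultimately show ?thesis by linarith
    qed
    ultimately show False using u by auto
  qed
qed

text \<open>The spectral parameter of \<open>f\<close> ranges over \<open>{0..<\<parallel>f\<parallel>\<^sup>2}\<close>; at the parameter \<open>u\<close>, the average of
  radius \<open>r\<close> acts as the indicator of \<open>r \<in> level f u\<close>.\<close>

definition level :: "('a \<Rightarrow> real) \<Rightarrow> real \<Rightarrow> real set" where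
  "level f u = {r. 0 \<le> r \<and> u < energy f r}"

definition spectral_space :: "('a \<Rightarrow> real) \<Rightarrow> real measure" where
  "spectral_space f = restrict_space lborel {0..<(L2_norm \<mu> f)\<^sup>2}"

text \<open>The level set is a down-set of [0,\<infinity>) that contains 0 and, by
  \<open>energy_right_open\<close>, has no greatest element. Hence it is half-open on the right,
  with b > 0.\<close>

lemma level_cases:
  assumes f: "f \<in> L2 \<mu>" and u: "u \<in> space (spectral_space f)"
  obtains "level f u = {0..}" | b where "0 < b" "level f u = {0..<b}"
proof -
  have u: "u < energy f 0" using u by (auto simp: spectral_space_def space_restrict_space energy_0)
  have down: "r \<in> level f u" if "s \<in> level f u" "0 \<le> r" "r \<le> s" for r s
    using that energy_antimono[OF f, of r s] by (auto simp: level_def)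
  have right: "\<exists>s>r. s \<in> level f u" if "r \<in> level f u" for r
    using energy_right_open[OF f, of r u] that by (auto simp: level_def intro: less_imp_le order_trans)
  have 0: "0 \<in> level f u" using u by (simp add: level_def)
  show thesis
  proof (cases "bdd_above (level f u)")
    case True
    define b where "b = Sup (level f u)"
    have b_notin: "b \<notin> level f u"
      using right[of b] cSup_upper[OF _ True] unfolding b_def by (meson not_less)
    have "0 \<le> b" unfolding b_def using 0 by (intro cSup_upper True)
    moreover have "b \<noteq> 0" using b_notin 0 by auto
    moreover have "level f u = {0..<b}"
    proof (intro equalityI subsetI)
      fix r assume r: "r \<in> level f u"
      have "r \<le> b" unfolding b_def using r by (intro cSup_upper True)
      moreover have "r \<noteq> b" using b_notin r by auto
      ultimately show "r \<in> {0..<b}" using r by (auto simp: level_def)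
    next
      fix r assume r: "r \<in> {0..<b}"
      then have "\<exists>s\<in>level f u. r < s"
        using less_cSup_iff[of "level f u" r] 0 True unfolding b_def by auto
      then obtain s where "s \<in> level f u" "r < s" by blast
      then show "r \<in> level f u" using r by (auto intro: less_imp_le down[of s])
    qed
    ultimately show thesis by (intro that(2)) auto
  next
    case False
    have "level f u = {0..}"
    proof (intro equalityI subsetI)
      fix r :: real assume r: "r \<in> {0..}"
      obtain s where "s \<in> level f u" "r < s" using False by (auto simp: bdd_above_def not_le)
      then show "r \<in> level f u" using r by (auto intro: less_imp_le down[of s])
    qed (auto simp: level_def)
    then show thesis by (rule that(1))
  qed
qed

section \<open>Measurability in the spectral parameter\<close>

lemma finite_spectral_space: "finite_measure (spectral_space f)"
  unfolding spectral_space_def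
  by (intro finite_measure_restrict_space finite_measureI) (auto simp: emeasure_restrict_space space_restrict_space)

lemma measure_spectral_space: "measure (spectral_space f) (space (spectral_space f)) = (L2_norm \<mu> f)\<^sup>2"
  by (simp add: spectral_space_def space_restrict_space measure_restrict_space)

lemma spectral_space_borel: "(\<lambda>u. u) \<in> borel_measurable (spectral_space f)"
  unfolding spectral_space_def by (intro measurable_restrict_space1) simp

lemma level_subset: "ray_measure N \<Longrightarrow> level f u \<subseteq> space N"
  by (auto simp: ray_measure_space level_def)

lemma measurable_energy:
  assumes N: "ray_measure N" and f: "f \<in> L2 \<mu>"
  shows "energy f \<in> borel_measurable N"
proof -
  have [measurable]: "f \<in> borel_measurable \<mu>" using f by (rule L2_borel)
  note [measurable] = measurable_avg_pair[OF N]
  show ?thesis unfolding energy_def[abs_def] L2_inner_def by measurable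
qed

lemma measurable_level:
  assumes N: "ray_measure N" and f: "f \<in> L2 \<mu>"
  shows "(\<lambda>(r, u). indicat_real (level f u) r) \<in> borel_measurable (N \<Otimes>\<^sub>M spectral_space f)"
proof -
  note [measurable] = measurable_energy[OF N f] spectral_space_borel ray_measure_borel[OF N]
  have [measurable]: "fst \<in> borel_measurable (N \<Otimes>\<^sub>M spectral_space f)"
    "snd \<in> borel_measurable (N \<Otimes>\<^sub>M spectral_space f)"
    using measurable_compose[OF measurable_fst ray_measure_borel[OF N]]
      measurable_compose[OF measurable_snd spectral_space_borel] by simp_all
  show ?thesis unfolding indicator_def level_def mem_Collect_eq split_beta' by measurable
qed

lemma level_sets:
  assumes N: "ray_measure N" and f: "f \<in> L2 \<mu>"
  shows "level f u \<in> sets N"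
proof -
  note [measurable] = measurable_energy[OF N f] ray_measure_borel[OF N]
  have "{r \<in> space N. 0 \<le> r \<and> u < energy f r} \<in> sets N" by measurable
  also have "{r \<in> space N. 0 \<le> r \<and> u < energy f r} = level f u"
    by (auto simp: ray_measure_space[OF N] level_def)
  finally show ?thesis .
qed

lemma integral_indicator_level:
  assumes N: "ray_measure N" and f: "f \<in> L2 \<mu>"
  shows "(\<integral>r. indicat_real (level f u) r \<partial>N) = measure N (level f u)"
  using level_sets[OF N f, of u] level_subset[OF N, of f u] by (simp add: Int_absorb2)

lemma measurable_measure_level:
  assumes N: "ray_measure N" and f: "f \<in> L2 \<mu>"
  shows "(\<lambda>u. measure N (level f u)) \<in> borel_measurable (spectral_space f)"
proof -
  interpret finite_measure N by (rule ray_measure_finite[OF N])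
  interpret S: finite_measure "spectral_space f" by (rule finite_spectral_space)
  have "(\<lambda>(u, r). indicat_real (level f u) r) \<in> borel_measurable (spectral_space f \<Otimes>\<^sub>M N)"
    using measurable_pair_swap[OF measurable_level[OF N f]] by (simp add: split_beta')
  then have "(\<lambda>u. \<integral>r. indicat_real (level f u) r \<partial>N) \<in> borel_measurable (spectral_space f)"
    by (rule borel_measurable_lebesgue_integral)
  then show ?thesis unfolding integral_indicator_level[OF N f] .
qed

lemma measure_level_le: "ray_measure N \<Longrightarrow> measure N (level f u) \<le> measure N (space N)"
  using finite_measure.bounded_measure[OF ray_measure_finite] .

section \<open>Layer cake formula and norms of combinations of integrals of averages\<close>

lemma energy_layer_cake:
  assumes f: "f \<in> L2 \<mu>" and "0 \<le> r"
  shows "energy f r = (\<integral>u. indicat_real (level f u) r \<partial>spectral_space f)"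
proof -
  have "(\<integral>u. indicat_real (level f u) r \<partial>spectral_space f) =
      (\<integral>u. indicat_real {0..<energy f r} u \<partial>spectral_space f)"
    using \<open>0 \<le> r\<close> by (intro Bochner_Integration.integral_cong)
       (auto simp: indicator_def level_def spectral_space_def space_restrict_space)
  also have "\<dots> = (\<integral>u. indicat_real {0..<energy f r} u \<partial>lborel)"
  proof -
    have "(\<lambda>u. indicat_real {0..<(L2_norm \<mu> f)\<^sup>2} u *\<^sub>R indicat_real {0..<energy f r} u) =
        indicat_real {0..<energy f r}"
      using energy_le[OF f \<open>0 \<le> r\<close>] by (auto simp: indicator_def fun_eq_iff)
    then show ?thesis
      unfolding spectral_space_def by (subst integral_restrict_space) simp_all
  qed
  also have "\<dots> = energy f r" using energy_nonneg[OF f \<open>0 \<le> r\<close>] by simp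
  finally show ?thesis by simp
qed

lemma level_max: "f \<in> L2 \<mu> \<Longrightarrow> 0 \<le> r \<Longrightarrow> 0 \<le> s \<Longrightarrow>
    indicat_real (level f u) (max r s) = indicat_real (level f u) r * indicat_real (level f u) s"
  using energy_antimono[of f r s] energy_antimono[of f s r]
  by (auto simp: indicator_def level_def max_def)

text \<open>The layer cake writes \<open>energy f (max r s)\<close> as an integral over u, and
  membership of the maximum in a down-set factorises. Exchanging the order of integration twice then
  separates r from s. Only the diagonal f = f is accessible this way; polarisation extends it
  later.\<close>

lemma inner_avg_mix_level:
  assumes N: "ray_measure N" and N': "ray_measure N'" and f: "f \<in> L2 \<mu>"
  shows "L2_inner \<mu> (avg_mix N f) (avg_mix N' f) =
    (\<integral>u. measure N (level f u) * measure N' (level f u) \<partial>spectral_space f)"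
proof -
  let ?S = "spectral_space f" and ?i = "\<lambda>u. indicat_real (level f u)"
  note meas = measurable_level[OF N f] measurable_level[OF N' f] measurable_measure_level[OF N' f]
  have finN: "finite_measure N" "finite_measure N'" using N N' by (auto simp: ray_measure_finite)
  have "L2_inner \<mu> (avg_mix N f) (avg_mix N' f) = (\<integral>r. (\<integral>s. energy f (max r s) \<partial>N') \<partial>N)"
    using avg_mix_inner_avg_mix[OF N N' f f] by (simp add: energy_def)
  also have "\<dots> = (\<integral>r. (\<integral>u. ?i u r * measure N' (level f u) \<partial>?S) \<partial>N)"
  proof (rule Bochner_Integration.integral_cong[OF refl])
    fix r assume "r \<in> space N"
    then have "0 \<le> r" by (simp add: ray_measure_space[OF N])
    have r_meas: "(\<lambda>u. ?i u r) \<in> borel_measurable ?S"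
      using measurable_Pair2[OF measurable_level[OF N f] \<open>r \<in> space N\<close>] by simp
    have "(\<integral>s. energy f (max r s) \<partial>N') = (\<integral>s. (\<integral>u. ?i u r * ?i u s \<partial>?S) \<partial>N')"
    proof (rule Bochner_Integration.integral_cong[OF refl])
      fix s assume "s \<in> space N'"
      then have "0 \<le> s" by (simp add: ray_measure_space[OF N'])
      have "energy f (max r s) = (\<integral>u. ?i u (max r s) \<partial>?S)"
        using \<open>0 \<le> r\<close> by (intro energy_layer_cake f) simp
      then show "energy f (max r s) = (\<integral>u. ?i u r * ?i u s \<partial>?S)"
        by (simp add: level_max[OF f \<open>0 \<le> r\<close> \<open>0 \<le> s\<close>])
    qed
    also have "\<dots> = (\<integral>u. (\<integral>s. ?i u r * ?i u s \<partial>N') \<partial>?S)"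
    proof (rule integral_swap_bounded[where C = 1])
      show "(\<lambda>(s, u). ?i u r * ?i u s) \<in> borel_measurable (N' \<Otimes>\<^sub>M ?S)"
        using borel_measurable_times[OF measurable_compose[OF measurable_snd r_meas] measurable_level[OF N' f]]
        by (simp add: split_beta')
    qed (auto simp: finN finite_spectral_space indicator_def)
    also have "\<dots> = (\<integral>u. ?i u r * measure N' (level f u) \<partial>?S)"
      by (simp add: Int_absorb2 level_subset[OF N'])
    finally show "(\<integral>s. energy f (max r s) \<partial>N') = (\<integral>u. ?i u r * measure N' (level f u) \<partial>?S)" .
  qed
  also have "\<dots> = (\<integral>u. (\<integral>r. ?i u r * measure N' (level f u) \<partial>N) \<partial>?S)"
  proof (rule integral_swap_bounded[where C = "measure N' (space N')"])
    show "(\<lambda>(r, u). ?i u r * measure N' (level f u)) \<in> borel_measurable (N \<Otimes>\<^sub>M ?S)"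
      using borel_measurable_times[OF measurable_level[OF N f]
          measurable_compose[OF measurable_snd measurable_measure_level[OF N' f]]]
      by (simp add: split_beta')
  qed (auto simp: finN finite_spectral_space indicator_def measure_level_le[OF N'])
  also have "\<dots> = (\<integral>u. measure N (level f u) * measure N' (level f u) \<partial>?S)"
    by (simp add: Int_absorb2 level_subset[OF N])
  finally show ?thesis .
qed

lemma integrable_measure_level:
  assumes N: "ray_measure N" and N': "ray_measure N'" and f: "f \<in> L2 \<mu>"
  shows "integrable (spectral_space f) (\<lambda>u. measure N (level f u) * measure N' (level f u))"
proof -
  interpret S: finite_measure "spectral_space f" by (rule finite_spectral_space)
  show ?thesis
  proof (rule S.integrable_const_bound[where B = "measure N (space N) * measure N' (space N')"])
    show "AE u in spectral_space f. norm (measure N (level f u) * measure N' (level f u))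
        \<le> measure N (space N) * measure N' (space N')"
      by (intro AE_I2) (simp add: mult_mono measure_level_le[OF N] measure_level_le[OF N'])
  qed (intro borel_measurable_times measurable_measure_level N N' f)
qed

text \<open>Turns operator identities and norm estimates into statements about numbers at each u. It
  is applied to the resolvent identity, to P - l, to polynomials of P and to differences of
  powers.\<close>

lemma norm_avg_mix_sum:
  assumes I: "finite I" and N: "\<And>i. i \<in> I \<Longrightarrow> ray_measure (N i)" and f: "f \<in> L2 \<mu>"
  shows "(L2_norm \<mu> (\<lambda>x. \<Sum>i\<in>I. a i * avg_mix (N i) f x))\<^sup>2 =
    (\<integral>u. (\<Sum>i\<in>I. a i * measure (N i) (level f u))\<^sup>2 \<partial>spectral_space f)"
proof -
  let ?m = "\<lambda>i u. measure (N i) (level f u)"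
  have L2: "avg_mix (N i) f \<in> L2 \<mu>" if "i \<in> I" for i using N[OF that] f by (rule avg_mix_L2)
  have "(L2_norm \<mu> (\<lambda>x. \<Sum>i\<in>I. a i * avg_mix (N i) f x))\<^sup>2 =
      (\<Sum>i\<in>I. \<Sum>j\<in>I. a i * (a j * L2_inner \<mu> (avg_mix (N i) f) (avg_mix (N j) f)))"
    unfolding L2_norm_sq using L2
    by (simp add: L2_inner_sum_left L2_inner_sum_right L2_sum L2_cmult L2_inner_cmult_left
        L2_inner_cmult_right sum_distrib_left)
  also have "\<dots> = (\<Sum>i\<in>I. \<Sum>j\<in>I. (\<integral>u. a i * (a j * (?m i u * ?m j u)) \<partial>spectral_space f))"
    by (intro sum.cong refl) (simp add: inner_avg_mix_level N f)
  also have "\<dots> = (\<integral>u. (\<Sum>i\<in>I. \<Sum>j\<in>I. a i * (a j * (?m i u * ?m j u))) \<partial>spectral_space f)"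
    by (simp add: Bochner_Integration.integral_sum integrable_measure_level N f)
  also have "\<dots> = (\<integral>u. (\<Sum>i\<in>I. a i * ?m i u)\<^sup>2 \<partial>spectral_space f)"
    unfolding power2_eq_square sum_product by (simp add: mult_ac)
  finally show ?thesis .
qed

end

section \<open>Strong integrals and composition\<close>

text \<open>An arbitrary functional \<phi> of the values is allowed, so that the same formula serves
  for evaluation at a point and for inner products.\<close>

lemma simple_function_weighted_sum:
  fixes \<phi> :: "'c \<Rightarrow> real"
  assumes N: "finite_measure N" and s: "simple_function N s"
  shows "integrable N (\<lambda>r. \<phi> (s r))"
    and "(\<Sum>v\<in>s ` space N. measure N {r \<in> space N. s r = v} * \<phi> v) = (\<integral>r. \<phi> (s r) \<partial>N)"
proof -
  interpret finite_measure N by fact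
  have fin: "finite (s ` space N)" using s by (rule simple_functionD)
  have sets: "{r \<in> space N. s r = v} \<in> sets N" for v
    using simple_functionD(2)[OF s, of "{v}"] by (simp add: vimage_def Int_def conj_commute)
  have eq: "\<phi> (s r) = (\<Sum>v\<in>s ` space N. indicator {r \<in> space N. s r = v} r * \<phi> v)" if "r \<in> space N" for r
  proof -
    have "(\<Sum>v\<in>s ` space N. indicator {r \<in> space N. s r = v} r * \<phi> v) =
        (\<Sum>v\<in>s ` space N. if v = s r then \<phi> v else 0)"
      using that by (intro sum.cong) (auto simp: indicator_def)
    then show ?thesis using fin that by (simp add: sum.delta)
  qed
  have int: "integrable N (\<lambda>r. indicator {r \<in> space N. s r = v} r * \<phi> v)" for v
    using sets[of v] by (intro integrable_mult_left integrable_real_indicator) (auto simp: less_top[symmetric])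
  show "integrable N (\<lambda>r. \<phi> (s r))"
    by (rule iffD2[OF Bochner_Integration.integrable_cong[OF refl eq]])
       (assumption, intro Bochner_Integration.integrable_sum int)
  have "(\<integral>r. \<phi> (s r) \<partial>N) = (\<integral>r. (\<Sum>v\<in>s ` space N. indicator {r \<in> space N. s r = v} r * \<phi> v) \<partial>N)"
    by (intro Bochner_Integration.integral_cong refl eq)
  also have "\<dots> = (\<Sum>v\<in>s ` space N. measure N {r \<in> space N. s r = v} * \<phi> v)"
    by (subst Bochner_Integration.integral_sum[OF int])
       (intro sum.cong refl, simp add: Int_absorb2)
  finally show "(\<Sum>v\<in>s ` space N. measure N {r \<in> space N. s r = v} * \<phi> v) = (\<integral>r. \<phi> (s r) \<partial>N)" by simp
qed

lemma has_L2_integral_AE_cong: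
  assumes int: "has_L2_integral M N F g" and g': "g' \<in> L2 M" and eq: "AE x in M. g x = g' x"
  shows "has_L2_integral M N F g'"
proof -
  have g: "g \<in> L2 M" using int by (simp add: has_L2_integral_def)
  obtain s where s: "\<And>n. simple_function N (s n) \<and> (\<forall>r\<in>space N. s n r \<in> L2 M) \<and>
             emeasure N {r\<in>space N. s n r \<noteq> (\<lambda>_. 0)} < \<infinity> \<and>
             (\<lambda>r. L2_norm M (\<lambda>x. F r x - s n r x)) \<in> borel_measurable N"
    and conv: "(\<lambda>n. \<integral>\<^sup>+ r. ennreal (L2_norm M (\<lambda>x. F r x - s n r x)) \<partial>N) \<longlonglongrightarrow> 0"
    and lim: "(\<lambda>n. L2_norm M (\<lambda>x. (\<Sum>v\<in>s n ` space N. measure N {r\<in>space N. s n r = v} * v x) - g x)) \<longlonglongrightarrow> 0"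
    using int unfolding has_L2_integral_def by blast
  have "L2_norm M (\<lambda>x. (\<Sum>v\<in>s n ` space N. measure N {r\<in>space N. s n r = v} * v x) - g x) =
      L2_norm M (\<lambda>x. (\<Sum>v\<in>s n ` space N. measure N {r\<in>space N. s n r = v} * v x) - g' x)" for n
    using s[of n] g g' eq by (intro L2_norm_AE_cong L2_diff L2_sum L2_cmult) auto
  with lim have "(\<lambda>n. L2_norm M (\<lambda>x. (\<Sum>v\<in>s n ` space N. measure N {r\<in>space N. s n r = v} * v x) - g' x)) \<longlonglongrightarrow> 0"
    by simp
  with int s conv g' show ?thesis unfolding has_L2_integral_def by blast
qed

text \<open>Continuous functionals commute with Bochner integrals: the inner products of h with the
  integrals of the simple functions converge to both sides. Testing against all h makes the integral
  unique up to null sets.\<close>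

lemma has_L2_integral_inner:
  assumes int: "has_L2_integral M N F g" and N: "finite_measure N" and h: "h \<in> L2 M"
    and Fh: "integrable N (\<lambda>r. L2_inner M (F r) h)"
  shows "L2_inner M g h = (\<integral>r. L2_inner M (F r) h \<partial>N)"
proof -
  have g: "g \<in> L2 M" and F: "\<And>r. r \<in> space N \<Longrightarrow> F r \<in> L2 M"
    using int by (auto simp: has_L2_integral_def)
  obtain s where s': "\<And>n. simple_function N (s n) \<and> (\<forall>r\<in>space N. s n r \<in> L2 M) \<and>
             emeasure N {r\<in>space N. s n r \<noteq> (\<lambda>_. 0)} < \<infinity> \<and>
             (\<lambda>r. L2_norm M (\<lambda>x. F r x - s n r x)) \<in> borel_measurable N"
    and conv: "(\<lambda>n. \<integral>\<^sup>+ r. ennreal (L2_norm M (\<lambda>x. F r x - s n r x)) \<partial>N) \<longlonglongrightarrow> 0"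
    and lim: "(\<lambda>n. L2_norm M (\<lambda>x. (\<Sum>v\<in>s n ` space N. measure N {r\<in>space N. s n r = v} * v x) - g x)) \<longlonglongrightarrow> 0"
    using int unfolding has_L2_integral_def by blast
  have s: "\<And>n. simple_function N (s n)" "\<And>n r. r \<in> space N \<Longrightarrow> s n r \<in> L2 M"
    "\<And>n. (\<lambda>r. L2_norm M (\<lambda>x. F r x - s n r x)) \<in> borel_measurable N"
    using s' by auto
  define G where "G n x = (\<Sum>v\<in>s n ` space N. measure N {r\<in>space N. s n r = v} * v x)" for n x
  have G: "G n \<in> L2 M" for n
    unfolding G_def[abs_def] using s(2) by (intro L2_sum L2_cmult) auto
  have inner_G: "L2_inner M (G n) h = (\<integral>r. L2_inner M (s n r) h \<partial>N)" for n
    unfolding G_def[abs_def] using s(2) h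
      simple_function_weighted_sum(2)[OF N s(1)[of n], of "\<lambda>v. L2_inner M v h"]
    by (subst L2_inner_sum_left) (auto simp: L2_inner_cmult_left)
  have "(\<lambda>n. L2_inner M (G n) h - L2_inner M g h) \<longlonglongrightarrow> 0"
  proof (rule Lim_null_comparison)
    show "\<forall>\<^sub>F n in sequentially. norm (L2_inner M (G n) h - L2_inner M g h) \<le> L2_norm M (\<lambda>x. G n x - g x) * L2_norm M h"
      using L2_Cauchy_Schwarz[OF L2_diff[OF G g] h] by (simp add: L2_inner_diff_left G g h)
    show "(\<lambda>n. L2_norm M (\<lambda>x. G n x - g x) * L2_norm M h) \<longlonglongrightarrow> 0"
      using lim unfolding G_def[symmetric] by (rule tendsto_mult_left_zero)
  qed
  moreover have "(\<lambda>n. L2_inner M (G n) h - (\<integral>r. L2_inner M (F r) h \<partial>N)) \<longlonglongrightarrow> 0"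
  proof -
    have le: "ennreal (norm (L2_inner M (G n) h - (\<integral>r. L2_inner M (F r) h \<partial>N))) \<le>
        (\<integral>\<^sup>+ r. ennreal (L2_norm M (\<lambda>x. F r x - s n r x)) \<partial>N) * ennreal (L2_norm M h)" for n
    proof -
      have int: "integrable N (\<lambda>r. L2_inner M (s n r) h)"
        by (rule simple_function_weighted_sum(1)[OF N s(1)])
      have "ennreal (norm (\<integral>r. L2_inner M (s n r) h - L2_inner M (F r) h \<partial>N)) \<le>
          (\<integral>\<^sup>+r. norm (L2_inner M (s n r) h - L2_inner M (F r) h) \<partial>N)"
        using int Fh by (intro integral_norm_bound_ennreal) auto
      also have "\<dots> \<le> (\<integral>\<^sup>+ r. ennreal (L2_norm M (\<lambda>x. F r x - s n r x)) * ennreal (L2_norm M h) \<partial>N)"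
      proof (intro nn_integral_mono)
        fix r assume r: "r \<in> space N"
        have "norm (L2_inner M (s n r) h - L2_inner M (F r) h) \<le> L2_norm M (\<lambda>x. s n r x - F r x) * L2_norm M h"
          using L2_Cauchy_Schwarz[OF L2_diff[OF s(2)[OF r] F[OF r]] h] by (simp add: L2_inner_diff_left s(2)[OF r] F[OF r] h)
        then show "ennreal (norm (L2_inner M (s n r) h - L2_inner M (F r) h)) \<le>
            ennreal (L2_norm M (\<lambda>x. F r x - s n r x)) * ennreal (L2_norm M h)"
          by (subst L2_norm_minus_commute) (simp add: ennreal_leI flip: ennreal_mult)
      qed
      also have "\<dots> = (\<integral>\<^sup>+ r. ennreal (L2_norm M (\<lambda>x. F r x - s n r x)) \<partial>N) * ennreal (L2_norm M h)"
        using s(3) by (intro nn_integral_multc) auto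
      finally show ?thesis using int Fh by (simp add: inner_G)
    qed
    have "(\<lambda>n. (\<integral>\<^sup>+ r. ennreal (L2_norm M (\<lambda>x. F r x - s n r x)) \<partial>N) * ennreal (L2_norm M h)) \<longlonglongrightarrow> 0 * ennreal (L2_norm M h)"
      using conv by (intro tendsto_mult_ennreal tendsto_const) auto
    then have "(\<lambda>n. ennreal (norm (L2_inner M (G n) h - (\<integral>r. L2_inner M (F r) h \<partial>N)))) \<longlonglongrightarrow> ennreal 0"
      using tendsto_sandwich[OF always_eventually[OF allI[OF zero_le]] always_eventually[OF allI[OF le]] tendsto_const]
      by simp
    then have "(\<lambda>n. norm (L2_inner M (G n) h - (\<integral>r. L2_inner M (F r) h \<partial>N))) \<longlonglongrightarrow> 0"
      by (subst (asm) tendsto_ennreal_iff) auto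
    then show ?thesis by (rule tendsto_norm_zero_cancel)
  qed
  ultimately have "(\<lambda>n. L2_inner M (G n) h) \<longlonglongrightarrow> L2_inner M g h"
    and "(\<lambda>n. L2_inner M (G n) h) \<longlonglongrightarrow> (\<integral>r. L2_inner M (F r) h \<partial>N)"
    by (simp_all add: LIM_zero_iff)
  then show ?thesis by (rule LIMSEQ_unique)
qed

text \<open>The unit mass at 0. Since Q_0 = id, the integral of averages against it is the identity,
  to which all formulas for \<open>avg_mix\<close> then apply.\<close>

definition dirac_zero :: "real measure" where
  "dirac_zero = distr (count_space {()}) (restrict_space borel {0..}) (\<lambda>_. 0)"

lemma ray_measure_dirac_zero: "ray_measure dirac_zero"
  unfolding ray_measure_def dirac_zero_def
  by (auto intro!: finite_measure.finite_measure_distr finite_measure_count_space simp: space_restrict_space)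

lemma measure_dirac_zero: "A \<in> sets dirac_zero \<Longrightarrow> 0 \<in> A \<Longrightarrow> measure dirac_zero A = 1"
  by (simp add: dirac_zero_def emeasure_distr space_restrict_space measure_def)

context ultrametric_measure
begin

lemma avg_mix_dirac_zero:
  assumes f: "f \<in> L2 \<mu>" shows "avg_mix dirac_zero f = f"
proof
  fix x
  have [measurable]: "(\<lambda>r. avg \<mu> r f x) \<in> borel_measurable (restrict_space borel {0..})"
    using f by (intro measurable_restrict_space1 measurable_avg) (auto simp: L2_borel)
  have "avg_mix dirac_zero f x = avg \<mu> 0 f x"
    unfolding avg_mix_def dirac_zero_def
    by (subst integral_distr) (auto simp: space_restrict_space lebesgue_integral_count_space_finite)
  then show "avg_mix dirac_zero f x = f x" by (simp add: avg_nonpos)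
qed

lemma zero_in_level: "f \<in> L2 \<mu> \<Longrightarrow> u \<in> space (spectral_space f) \<Longrightarrow> 0 \<in> level f u"
  by (rule level_cases[of f u]) auto

lemma measure_dirac_zero_level:
  "f \<in> L2 \<mu> \<Longrightarrow> u \<in> space (spectral_space f) \<Longrightarrow> measure dirac_zero (level f u) = 1"
  by (intro measure_dirac_zero level_sets ray_measure_dirac_zero zero_in_level)

text \<open>The form B is symmetric even for two different measures, because after expansion only
  the self-adjoint Q_(max r s) occur. So its diagonal determines it.\<close>

lemma inner_avg_mix_polar:
  assumes N: "ray_measure N" and N': "ray_measure N'" and f: "f \<in> L2 \<mu>" and h: "h \<in> L2 \<mu>"
  defines "B \<equiv> \<lambda>f h. L2_inner \<mu> (avg_mix N f) (avg_mix N' h)"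
  shows "B (\<lambda>x. f x + h x) (\<lambda>x. f x + h x) = B f f + 2 * B f h + B h h"
proof -
  have sym: "B h f = B f h"
    unfolding B_def avg_mix_inner_avg_mix[OF N N' f h] avg_mix_inner_avg_mix[OF N N' h f]
    by (simp add: avg_selfadjoint[OF h f] L2_inner_commute[of _ h])
  note L2 = avg_mix_L2[OF N f] avg_mix_L2[OF N h] avg_mix_L2[OF N' f] avg_mix_L2[OF N' h]
  have "B (\<lambda>x. f x + h x) (\<lambda>x. f x + h x) =
      L2_inner \<mu> (\<lambda>x. avg_mix N f x + avg_mix N h x) (\<lambda>x. avg_mix N' f x + avg_mix N' h x)"
    unfolding B_def using L2_operatorD(2)[OF avg_mix_operator[OF N] f h]
      L2_operatorD(2)[OF avg_mix_operator[OF N'] f h]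
    by (rule L2_inner_AE_cong) (intro L2_add L2 avg_mix_L2 N N' f h)+
  also have "\<dots> = B f f + B f h + (B h f + B h h)"
    by (simp add: B_def L2_inner_add_left L2_inner_add_right L2_add L2)
  finally show ?thesis using sym by simp
qed

text \<open>The composition of two averages of radii \<open>r\<close> and \<open>s\<close> is the average of radius \<open>max r s\<close>, so
  composition multiplies the distribution functions.\<close>

lemma avg_mix_compose:
  assumes N: "ray_measure N" and N': "ray_measure N'" and K: "ray_measure K"
    and eq: "\<And>b. 0 < b \<Longrightarrow> measure K {0..<b} = measure N {0..<b} * measure N' {0..<b}"
    and eq_all: "measure K {0..} = measure N {0..} * measure N' {0..}"
    and f: "f \<in> L2 \<mu>"
  shows "AE x in \<mu>. avg_mix N (avg_mix N' f) x = avg_mix K f x"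
proof (rule L2_eqI_weak)
  let ?D = dirac_zero
  note D = ray_measure_dirac_zero
  fix h assume h: "h \<in> L2 \<mu>"
  \<comment> \<open>Pairing K with the unit mass at 0 gives the right-hand side the two-measure form
    required by \<open>inner_avg_mix_level\<close> and by polarisation.\<close>
  have diag: "L2_inner \<mu> (avg_mix N' g) (avg_mix N g) = L2_inner \<mu> (avg_mix K g) (avg_mix ?D g)"
    if g: "g \<in> L2 \<mu>" for g
    unfolding inner_avg_mix_level[OF N' N g] inner_avg_mix_level[OF K D g]
  proof (rule Bochner_Integration.integral_cong[OF refl])
    fix u assume u: "u \<in> space (spectral_space g)"
    have "measure N' (level g u) * measure N (level g u) = measure K (level g u)"
      using g u by (rule level_cases) (simp_all add: eq eq_all)
    then show "measure N' (level g u) * measure N (level g u) = measure K (level g u) * measure ?D (level g u)"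
      by (simp add: measure_dirac_zero_level[OF g u])
  qed
  have "L2_inner \<mu> (avg_mix N (avg_mix N' f)) h = L2_inner \<mu> (avg_mix N' f) (avg_mix N h)"
    using avg_mix_selfadjoint[OF N] avg_mix_L2[OF N' f] h by (simp add: L2_selfadjoint_def)
  also have "\<dots> = L2_inner \<mu> (avg_mix K f) (avg_mix ?D h)"
    using inner_avg_mix_polar[OF N' N f h] inner_avg_mix_polar[OF K D f h]
      diag[OF f] diag[OF h] diag[OF L2_add[OF f h]] by simp
  finally show "L2_inner \<mu> (avg_mix N (avg_mix N' f)) h = L2_inner \<mu> (avg_mix K f) h"
    by (simp add: avg_mix_dirac_zero[OF h])
qed (intro avg_mix_L2 N N' K f)+

lemma has_L2_integral_unique:
  assumes N: "ray_measure N" and f: "f \<in> L2 \<mu>" and int: "has_L2_integral \<mu> N (\<lambda>r. avg \<mu> r f) g"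
  shows "AE x in \<mu>. g x = avg_mix N f x"
proof (rule L2_eqI_weak)
  fix h assume h: "h \<in> L2 \<mu>"
  show "L2_inner \<mu> g h = L2_inner \<mu> (avg_mix N f) h"
    unfolding avg_mix_inner[OF N f h]
    by (rule has_L2_integral_inner[OF int ray_measure_finite[OF N] h avg_mix_integrable_inner[OF N f h]])
qed (use int avg_mix_L2[OF N f] in \<open>auto simp: has_L2_integral_def\<close>)

text \<open>The map sending r to Q_r f is right continuous in norm, so sampling it at grid points
  just to the right of r gives approximating simple functions. All errors are at most twice the norm
  of f, and the measure is finite.\<close>

lemma has_L2_integral_avg_mix:
  assumes N: "ray_measure N" and f: "f \<in> L2 \<mu>"
  shows "has_L2_integral \<mu> N (\<lambda>r. avg \<mu> r f) (avg_mix N f)"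
proof -
  interpret finite_measure N by (rule ray_measure_finite[OF N])
  have space: "space N = {0..}" by (rule ray_measure_space[OF N])
  have [measurable]: "f \<in> borel_measurable \<mu>" using f by (rule L2_borel)
  have id_N: "(\<lambda>r. r) \<in> borel_measurable N" by (rule ray_measure_borel[OF N])
  \<comment> \<open>Rounds r up to the grid of mesh 1/(n+1) and caps the result at n. Rounding up
    matches right continuity; the cap leaves finitely many values.\<close>
  define c where "c n r = min (real n) (real_of_int \<lceil>real (Suc n) * r\<rceil> / real (Suc n))" for n :: nat and r :: real
  have c_meas [measurable]: "c n \<in> borel_measurable N" for n
  proof -
    have "c n \<in> borel_measurable borel" unfolding c_def[abs_def] by measurable
    from measurable_compose[OF id_N this] show ?thesis by simp
  qed
  have c_nonneg: "0 \<le> c n r" if "0 \<le> r" for n r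
  proof -
    have "(0::int) \<le> \<lceil>real (Suc n) * r\<rceil>" using that by (simp add: order_less_le_trans[OF _ mult_nonneg_nonneg])
    then show ?thesis by (simp add: c_def)
  qed
  have c_simple: "simple_function N (c n)" for n
    unfolding simple_function_iff_borel_measurable
  proof
    have "c n r \<in> insert (real n) ((\<lambda>k. real_of_int k / real (Suc n)) ` {0..int (n * Suc n)})" if "0 \<le> r" for r
    proof (cases "\<lceil>real (Suc n) * r\<rceil> \<le> int (n * Suc n)")
      case True
      have "(0::int) \<le> \<lceil>real (Suc n) * r\<rceil>" using that by (simp add: order_less_le_trans[OF _ mult_nonneg_nonneg])
      moreover have "real_of_int \<lceil>real (Suc n) * r\<rceil> / real (Suc n) \<le> real n"
      proof -
        have "real_of_int \<lceil>real (Suc n) * r\<rceil> \<le> real_of_int (int (n * Suc n))"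
          using True by (simp only: of_int_le_iff)
        also have "\<dots> = real n * real (Suc n)" by (simp only: of_int_of_nat_eq of_nat_mult of_int_mult)
        finally show ?thesis by (simp add: pos_divide_le_eq del: of_nat_Suc)
      qed
      ultimately show ?thesis using True by (auto simp: c_def min_absorb2)
    next
      case False
      then have "real_of_int (int (n * Suc n)) \<le> real_of_int \<lceil>real (Suc n) * r\<rceil>"
        by (simp only: of_int_le_iff)
      moreover have "real_of_int (int (n * Suc n)) = real n * real (Suc n)" by (simp only: of_int_of_nat_eq of_nat_mult of_int_mult)
      ultimately have "real n \<le> real_of_int \<lceil>real (Suc n) * r\<rceil> / real (Suc n)"
        by (simp add: pos_le_divide_eq del: of_nat_Suc)
      then show ?thesis by (simp add: c_def min_absorb1)
    qed
    then have "c n ` space N \<subseteq> insert (real n) ((\<lambda>k. real_of_int k / real (Suc n)) ` {0..int (n * Suc n)})"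
      unfolding space by auto
    then show "finite (c n ` space N)" by (rule finite_subset) simp
  qed (rule c_meas)
  have c_ge: "r \<le> c n r" if "r \<le> real n" for n r
  proof -
    have "real (Suc n) * r \<le> real_of_int \<lceil>real (Suc n) * r\<rceil>" by (rule le_of_int_ceiling)
    then have "r \<le> real_of_int \<lceil>real (Suc n) * r\<rceil> / real (Suc n)"
      by (simp add: pos_le_divide_eq mult.commute del: of_nat_Suc)
    with that show ?thesis by (simp add: c_def)
  qed
  have c_le: "c n r \<le> r + inverse (real (Suc n))" for n r
  proof -
    have "real_of_int \<lceil>real (Suc n) * r\<rceil> \<le> real (Suc n) * r + 1" by linarith
    then have "real_of_int \<lceil>real (Suc n) * r\<rceil> / real (Suc n) \<le> (real (Suc n) * r + 1) / real (Suc n)"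
      by (intro divide_right_mono) auto
    also have "\<dots> = r + inverse (real (Suc n))" by (simp add: add_divide_distrib inverse_eq_divide del: of_nat_Suc)
    finally show ?thesis by (simp add: c_def)
  qed
  define s where "s n r = avg \<mu> (c n r) f" for n r
  define d where "d n r = L2_norm \<mu> (\<lambda>x. avg \<mu> r f x - s n r x)" for n r
  have s_L2: "s n r \<in> L2 \<mu>" for n r unfolding s_def using f by simp
  have s_simple: "simple_function N (s n)" for n
    using simple_function_compose[OF c_simple, of "\<lambda>c. avg \<mu> c f" n] by (simp add: comp_def s_def[abs_def])
  have [measurable]: "fst \<in> borel_measurable (N \<Otimes>\<^sub>M \<mu>)"
    by (rule measurable_compose[OF measurable_fst id_N])
  have s_pair [measurable]: "(\<lambda>(r, x). s n r x) \<in> borel_measurable (N \<Otimes>\<^sub>M \<mu>)" for n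
    unfolding s_def split_beta' by measurable
  have avg_pair [measurable]: "(\<lambda>(r, x). avg \<mu> r f x) \<in> borel_measurable (N \<Otimes>\<^sub>M \<mu>)"
    by (rule measurable_avg_pair[OF N]) measurable
  have d_meas [measurable]: "d n \<in> borel_measurable N" for n
    unfolding d_def[abs_def] L2_norm_def L2_inner_def by measurable
  have d_le: "d n r \<le> 2 * L2_norm \<mu> f" for n r
  proof -
    have "d n r \<le> L2_norm \<mu> (\<lambda>x. avg \<mu> r f x - 0) + L2_norm \<mu> (\<lambda>x. 0 - s n r x)"
      unfolding d_def using f s_L2 by (intro L2_norm_diff_triangle) auto
    also have "L2_norm \<mu> (\<lambda>x. 0 - s n r x) = L2_norm \<mu> (\<lambda>x. s n r x - 0)" by (rule L2_norm_minus_commute)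
    also have "L2_norm \<mu> (\<lambda>x. avg \<mu> r f x - 0) + L2_norm \<mu> (\<lambda>x. s n r x - 0) \<le> 2 * L2_norm \<mu> f"
      using avg_norm_le[OF f, of r] avg_norm_le[OF f, of "c n r"] by (simp add: s_def)
    finally show ?thesis .
  qed
  have d_nonneg: "0 \<le> d n r" for n r by (simp add: d_def)
  \<comment> \<open>Up to radius q the energy drops by less than e^2. For n \<ge> n0 the cap does
    not push c n r below r, and for n \<ge> n1 the mesh keeps it below q; Pythagoras then bounds the
    error.\<close>
  have d_lim: "(\<lambda>n. d n r) \<longlonglongrightarrow> 0" if r: "0 \<le> r" for r
  proof (rule LIMSEQ_I)
    fix e :: real assume "0 < e"
    then have "energy f r - e\<^sup>2 < energy f r" by simp
    then obtain q where q: "r < q" "energy f r - e\<^sup>2 < energy f q"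
      using energy_right_open[OF f r] by blast
    obtain n0 where n0: "r \<le> real n0" using real_arch_simple by blast
    obtain n1 where n1: "inverse (real (Suc n1)) < q - r"
      using reals_Archimedean[of "q - r"] q(1) by auto
    have "norm (d n r - 0) < e" if n: "n \<ge> max n0 n1" for n
    proof -
      have ge: "r \<le> c n r" using n n0 by (intro c_ge) simp
      have "inverse (real (Suc n)) \<le> inverse (real (Suc n1))" using n by simp
      then have "c n r \<le> q" using c_le[of n r] n1 by linarith
      then have "energy f q \<le> energy f (c n r)" by (intro energy_antimono f c_nonneg r)
      moreover have "(d n r)\<^sup>2 = energy f r - energy f (c n r)"
        unfolding d_def s_def by (rule norm_avg_diff_sq[OF f r ge])
      ultimately have "(d n r)\<^sup>2 < e\<^sup>2" using q(2) by linarith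
      then have "d n r < e" by (rule power2_less_imp_less) (use \<open>0 < e\<close> in simp)
      then show ?thesis using d_nonneg[of n r] by simp
    qed
    then show "\<exists>no. \<forall>n\<ge>no. norm (d n r - 0) < e" by blast
  qed
  \<comment> \<open>The exponent k is kept general: k = 1 serves the integrated norm condition of
    \<open>has_L2_integral\<close>, k = 2 the estimate from \<open>integral_L2\<close>.\<close>
  have d_pow: "norm (d n r ^ k) \<le> (2 * L2_norm \<mu> f) ^ k" for n r k
    using power_mono[OF d_le[of n r] d_nonneg, of k] d_nonneg[of n r] by simp
  have d_int: "integrable N (\<lambda>r. d n r ^ k)" for n k
    by (intro integrable_const_bound[where B = "(2 * L2_norm \<mu> f) ^ k"] AE_I2 d_pow) measurable
  have lim_int: "(\<lambda>n. \<integral>r. d n r ^ k \<partial>N) \<longlonglongrightarrow> 0" if "0 < k" for k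
  proof -
    have "(\<lambda>n. \<integral>r. d n r ^ k \<partial>N) \<longlonglongrightarrow> (\<integral>r. 0 \<partial>N)"
    proof (rule integral_dominated_convergence[where w = "\<lambda>_. (2 * L2_norm \<mu> f) ^ k"])
      show "AE r in N. (\<lambda>n. d n r ^ k) \<longlonglongrightarrow> 0"
      proof (rule AE_I2)
        fix r assume "r \<in> space N"
        then have "(\<lambda>n. d n r ^ k) \<longlonglongrightarrow> 0 ^ k" by (intro tendsto_power d_lim) (simp add: space)
        then show "(\<lambda>n. d n r ^ k) \<longlonglongrightarrow> 0" unfolding zero_power[OF that] .
      qed
      show "AE r in N. norm (d n r ^ k) \<le> (2 * L2_norm \<mu> f) ^ k" for n
        by (intro AE_I2 d_pow)
    qed auto
    then show ?thesis by simp
  qed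
  have "(\<lambda>n. \<integral>\<^sup>+ r. ennreal (d n r) \<partial>N) \<longlonglongrightarrow> 0"
  proof -
    have "(\<integral>\<^sup>+ r. ennreal (d n r) \<partial>N) = ennreal (\<integral>r. d n r \<partial>N)" for n
      using d_int[of n 1] d_nonneg by (intro nn_integral_eq_integral) auto
    then show ?thesis using tendsto_ennrealI[OF lim_int[of 1]] by simp
  qed
  moreover have "(\<lambda>n. L2_norm \<mu> (\<lambda>x. (\<Sum>v\<in>s n ` space N. measure N {r\<in>space N. s n r = v} * v x) - avg_mix N f x)) \<longlonglongrightarrow> 0"
  proof -
    let ?m = "measure N (space N)"
    define e where "e n = L2_norm \<mu> (\<lambda>x. (\<Sum>v\<in>s n ` space N. measure N {r\<in>space N. s n r = v} * v x) - avg_mix N f x)" for n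
    have e_le: "(e n)\<^sup>2 \<le> ?m * (\<integral>r. d n r ^ 2 \<partial>N)" for n
    proof -
      let ?\<Phi> = "\<lambda>r x. s n r x - avg \<mu> r f x"
      have \<Phi>: "(\<lambda>(r, x). ?\<Phi> r x) \<in> borel_measurable (N \<Otimes>\<^sub>M \<mu>)"
        using borel_measurable_diff[OF s_pair[of n] avg_pair] by (simp add: split_beta')
      have \<Phi>_L2: "?\<Phi> r \<in> L2 \<mu>" for r using f s_L2 by auto
      have \<Phi>_norm: "L2_norm \<mu> (?\<Phi> r) = d n r" for r unfolding d_def by (rule L2_norm_minus_commute)
      have \<Phi>_le: "L2_norm \<mu> (?\<Phi> r) \<le> 2 * L2_norm \<mu> f" for r unfolding \<Phi>_norm by (rule d_le)
      note \<Phi>_int = integral_L2[OF finite_measure_axioms \<Phi> \<Phi>_L2 \<Phi>_le]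
      have sum_eq: "(\<Sum>v\<in>s n ` space N. measure N {r\<in>space N. s n r = v} * v x) = (\<integral>r. s n r x \<partial>N)" for x
        by (rule simple_function_weighted_sum(2)[OF finite_measure_axioms s_simple])
      have s_int: "integrable N (\<lambda>r. s n r x)" for x
        by (rule simple_function_weighted_sum(1)[OF finite_measure_axioms s_simple])
      have "AE x in \<mu>. (\<Sum>v\<in>s n ` space N. measure N {r\<in>space N. s n r = v} * v x) - avg_mix N f x = (\<integral>r. ?\<Phi> r x \<partial>N)"
        using avg_mix_AE_integrable[OF N f]
        by eventually_elim (simp add: sum_eq avg_mix_def s_int)
      then have "e n = L2_norm \<mu> (\<lambda>x. \<integral>r. ?\<Phi> r x \<partial>N)"
        unfolding e_def using s_L2 avg_mix_L2[OF N f] \<Phi>_int(2)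
        by (intro L2_norm_AE_cong L2_diff L2_sum L2_cmult) auto
      then show ?thesis using \<Phi>_int(3) by (simp add: \<Phi>_norm)
    qed
    have m_lim: "(\<lambda>n. ?m * (\<integral>r. d n r ^ 2 \<partial>N)) \<longlonglongrightarrow> 0"
      using lim_int[of 2] by (intro tendsto_mult_right_zero) simp
    have "(\<lambda>n. (e n)\<^sup>2) \<longlonglongrightarrow> 0"
      by (rule tendsto_sandwich[OF _ _ tendsto_const m_lim]) (simp_all add: e_le)
    moreover have "sqrt ((e n)\<^sup>2) = e n" for n unfolding e_def by simp
    ultimately have "e \<longlonglongrightarrow> 0" using tendsto_real_sqrt[of "\<lambda>n. (e n)\<^sup>2" 0] by simp
    then show ?thesis unfolding e_def .
  qed
  moreover have "emeasure N {r \<in> space N. s n r \<noteq> (\<lambda>_. 0)} < \<infinity>" for n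
    by (simp add: less_top[symmetric])
  ultimately show ?thesis
    unfolding has_L2_integral_def using f avg_mix_L2[OF N f] s_simple s_L2 d_meas
    by (auto simp: d_def[abs_def] intro!: exI[of _ s])
qed

lemma has_strong_integral_avg_mix:
  assumes N: "ray_measure N" shows "has_strong_integral \<mu> N (avg \<mu>) (avg_mix N)"
  using avg_mix_operator[OF N] has_L2_integral_avg_mix[OF N] by (simp add: has_strong_integral_def)

lemma strong_integral_avg:
  assumes N: "ray_measure N"
  shows "has_strong_integral \<mu> N (avg \<mu>) (strong_integral \<mu> N (avg \<mu>))"
    and "f \<in> L2 \<mu> \<Longrightarrow> AE x in \<mu>. strong_integral \<mu> N (avg \<mu>) f x = avg_mix N f x"
proof -
  show *: "has_strong_integral \<mu> N (avg \<mu>) (strong_integral \<mu> N (avg \<mu>))"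
    unfolding strong_integral_def
    by (rule someI[where P = "has_strong_integral \<mu> N (avg \<mu>)", OF has_strong_integral_avg_mix[OF N]])
  show "f \<in> L2 \<mu> \<Longrightarrow> AE x in \<mu>. strong_integral \<mu> N (avg \<mu>) f x = avg_mix N f x"
    using * by (intro has_L2_integral_unique[OF N]) (auto simp: has_strong_integral_def)
qed

end

section \<open>Powers of the isotropic operator\<close>

text \<open>The functions G for which the integral of Q_r against dG(\<sigma>(r)) represents G(P). G
  0 = 0 excludes an atom at radius 0, and continuity on the range of \<sigma> makes G(\<sigma>(r))
  left continuous. Positive powers and the nontrivial part of the resolvents are of this
  kind.\<close>

definition stieltjes_integrator :: "(real \<Rightarrow> real) \<Rightarrow> bool" where
  "stieltjes_integrator G \<longleftrightarrow> mono_on {0..1} G \<and> continuous_on {0..1} G \<and> G 0 = 0"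

lemma stieltjes_integrator_powr: "0 < t \<Longrightarrow> stieltjes_integrator (\<lambda>l. l powr t)"
  unfolding stieltjes_integrator_def
proof (intro conjI mono_onI)
  assume "0 < t"
  then show "continuous_on {0..1} (\<lambda>l. l powr t)"
    by (intro continuous_on_powr' continuous_on_id continuous_on_const) auto
qed (auto intro: powr_mono2)

lemma stieltjes_integrator_ident: "stieltjes_integrator (\<lambda>l. l)"
  unfolding stieltjes_integrator_def by (auto intro!: mono_onI continuous_intros)

locale isotropic = ultrametric_measure \<mu> for \<mu> :: "'a::metric_space measure" +
  fixes \<sigma> :: "ennreal \<Rightarrow> real"
  assumes distribution: "distance_distribution \<sigma>"
begin

section \<open>The distance distribution function\<close>

lemma \<sigma>_range: "0 \<le> \<sigma> r" "\<sigma> r \<le> 1"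
  using distribution by (auto simp: distance_distribution_def image_subset_iff)

lemma \<sigma>_strict_mono: "strict_mono \<sigma>"
  using distribution by (simp add: distance_distribution_def)

lemma \<sigma>_mono: "r \<le> s \<Longrightarrow> \<sigma> r \<le> \<sigma> s"
  using \<sigma>_strict_mono by (simp add: strict_mono_less_eq)

lemma \<sigma>_left_continuous: "(\<sigma> \<longlongrightarrow> \<sigma> r) (at_left r)"
  using distribution by (simp add: distance_distribution_def)

text \<open>The value at 0 lies below all values to the right, hence below their limit 0, once the
  filter of right neighbourhoods of 0 is known to be nontrivial.\<close>

lemma \<sigma>_0: "\<sigma> 0 = 0"
proof -
  have lim: "(\<sigma> \<longlongrightarrow> 0) (at_right 0)" using distribution by (simp add: distance_distribution_def)
  have nontriv: "at_right (0 :: ennreal) \<noteq> bot"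
  proof
    assume "at_right (0 :: ennreal) = bot"
    then have "eventually (\<lambda>_. False) (at_right (0 :: ennreal))" by simp
    then obtain b :: ennreal where "0 < b" "\<forall>z>0. \<not> z < b"
      by (subst (asm) eventually_at_right[of 0 1]) auto
    then show False using dense[of 0 b] by auto
  qed
  have "\<sigma> 0 \<le> 0"
    by (rule tendsto_lowerbound[OF lim _ nontriv]) (simp add: \<sigma>_mono)
  with \<sigma>_range[of 0] show ?thesis by simp
qed

lemma \<sigma>_pos: "0 < r \<Longrightarrow> 0 < \<sigma> r"
  using \<sigma>_strict_mono \<sigma>_0 by (metis strict_mono_less)

lemma \<sigma>_top: "\<sigma> \<infinity> = 1"
  using distribution by (simp add: distance_distribution_def)

lemma filterlim_ennreal_at_left:
  assumes "0 < x" shows "filterlim ennreal (at_left (ennreal x)) (at_left x)"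
  unfolding filterlim_at
proof
  have "\<forall>\<^sub>F r in at_left x. r < x" by (auto simp: eventually_at_filter)
  then show "\<forall>\<^sub>F r in at_left x. ennreal r \<in> {..<ennreal x} \<and> ennreal r \<noteq> ennreal x"
    by eventually_elim (use assms in \<open>simp add: ennreal_lessI\<close>, use assms ennreal_lessI in force)
  show "(ennreal \<longlongrightarrow> ennreal x) (at_left x)"
    by (intro tendsto_ennrealI tendsto_ident_at)
qed

lemma \<sigma>_real_left_continuous: "((\<lambda>r. \<sigma> (ennreal r)) \<longlongrightarrow> \<sigma> (ennreal x)) (at_left x)"
proof (cases "0 < x")
  case True
  show ?thesis by (rule filterlim_compose[OF \<sigma>_left_continuous filterlim_ennreal_at_left[OF True]])
next
  case False
  have "\<forall>\<^sub>F r in at_left x. r < x" by (auto simp: eventually_at_filter)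
  then have "\<forall>\<^sub>F r in at_left x. \<sigma> (ennreal r) = \<sigma> (ennreal x)"
    by eventually_elim (use False in \<open>simp add: ennreal_neg\<close>)
  then show ?thesis by (rule tendsto_eventually)
qed

text \<open>Left continuity at \<infinity> prevents mass from escaping to infinity, which is what
  gives P^t 1 = 1.\<close>

lemma \<sigma>_tendsto_1: "(\<lambda>n. \<sigma> (ennreal (real n))) \<longlonglongrightarrow> 1"
proof -
  have "filterlim (\<lambda>n. ennreal (real n)) (at_left \<infinity>) sequentially"
    unfolding filterlim_at
  proof
    show "(\<lambda>n. ennreal (real n)) \<longlonglongrightarrow> \<infinity>"
      using of_nat_tendsto_top_ennreal by (simp add: ennreal_of_nat_eq_real_of_nat)
  qed simp
  from filterlim_compose[OF \<sigma>_left_continuous this] show ?thesis by (simp add: \<sigma>_top[simplified])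
qed

lemma \<sigma>_right_0: "0 < e \<Longrightarrow> \<exists>b>0. \<sigma> (ennreal b) < e"
proof -
  assume "0 < e"
  have lim: "(\<sigma> \<longlongrightarrow> 0) (at_right 0)" using distribution by (simp add: distance_distribution_def)
  have "\<forall>\<^sub>F r in at_right (0 :: real). ennreal r \<in> {0<..} \<and> ennreal r \<noteq> 0"
    by (auto simp: eventually_at_filter)
  then have "filterlim ennreal (at_right 0) (at_right 0)"
    unfolding filterlim_at using tendsto_ennrealI[OF tendsto_ident_at, of "0 :: real" "{0<..}"] by simp
  from order_tendstoD(2)[OF filterlim_compose[OF lim this] \<open>0 < e\<close>]
  have "\<forall>\<^sub>F r in at_right 0. \<sigma> (ennreal r) < e \<and> 0 < r"
    by (rule eventually_conj[OF _ eventually_at_right_less])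
  then show ?thesis
    using eventually_happens'[OF trivial_limit_at_right_real] by blast
qed

section \<open>The Stieltjes measures dG(\<sigma>(r))\<close>

definition mix_measure :: "(real \<Rightarrow> real) \<Rightarrow> real measure" where
  "mix_measure G = stieltjes_measure (\<lambda>r. G (\<sigma> (ennreal r)))"

lemma sigma_pow_eq: "sigma_pow \<sigma> t = mix_measure (\<lambda>l. l powr t)"
  by (simp add: sigma_pow_def mix_measure_def)

context
  fixes G :: "real \<Rightarrow> real"
  assumes G: "stieltjes_integrator G"
begin

lemma emeasure_mix_measure: "0 \<le> b \<Longrightarrow> emeasure (mix_measure G) {0..<b} = ennreal (G (\<sigma> (ennreal b)))"
proof -
  have mono: "G (\<sigma> (ennreal x)) \<le> G (\<sigma> (ennreal y))" if "x \<le> y" for x y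
    using G that \<sigma>_range unfolding stieltjes_integrator_def
    by (intro mono_onD[of "{0..1}" G] \<sigma>_mono ennreal_leI) auto
  have cont: "continuous (at_left x) (\<lambda>r. G (\<sigma> (ennreal r)))" for x
    unfolding continuous_within
    using G \<sigma>_range unfolding stieltjes_integrator_def
    by (intro continuous_on_tendsto_compose[of "{0..1}" G] \<sigma>_real_left_continuous) auto
  assume "0 \<le> b"
  then show ?thesis
    unfolding mix_measure_def using G emeasure_stieltjes_measure[OF mono cont order_refl \<open>0 \<le> b\<close>]
    by (simp add: stieltjes_integrator_def \<sigma>_0)
qed

lemma sets_mix_measure: "sets (mix_measure G) = sets (restrict_space borel {0..})"
  unfolding mix_measure_def stieltjes_measure_def by (intro sets_restrict_space_cong) simp

lemma space_mix_measure: "space (mix_measure G) = {0..}"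
  using sets_eq_imp_space_eq[OF sets_mix_measure] by (simp add: space_restrict_space)

lemma emeasure_mix_measure_space: "emeasure (mix_measure G) {0..} = ennreal (G 1)"
proof -
  have "(\<lambda>n. emeasure (mix_measure G) {0..<real n}) \<longlonglongrightarrow> emeasure (mix_measure G) (\<Union>n. {0..<real n})"
  proof (rule Lim_emeasure_incseq)
    show "range (\<lambda>n. {0..<real n}) \<subseteq> sets (mix_measure G)"
      unfolding sets_mix_measure by (auto simp: sets_restrict_space_iff)
  qed (auto simp: incseq_def)
  moreover have "(\<Union>n. {0..<real n}) = {0..}"
    by (auto intro: reals_Archimedean2)
  moreover have "(\<lambda>n. emeasure (mix_measure G) {0..<real n}) \<longlonglongrightarrow> ennreal (G 1)"
    using G \<sigma>_range unfolding stieltjes_integrator_def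
    by (subst emeasure_mix_measure)
       (auto intro!: tendsto_ennrealI continuous_on_tendsto_compose[of "{0..1}" G] \<sigma>_tendsto_1)
  ultimately show ?thesis using LIMSEQ_unique by metis
qed

lemma ray_measure_mix_measure: "ray_measure (mix_measure G)"
  unfolding ray_measure_def
  using sets_mix_measure emeasure_mix_measure_space
  by (auto intro!: finite_measureI simp: space_mix_measure)

lemma integrator_nonneg: "0 \<le> l \<Longrightarrow> l \<le> 1 \<Longrightarrow> 0 \<le> G l"
  using G mono_onD[of "{0..1}" G 0 l] by (auto simp: stieltjes_integrator_def)

lemma measure_mix_measure: "0 \<le> b \<Longrightarrow> measure (mix_measure G) {0..<b} = G (\<sigma> (ennreal b))"
  by (simp add: measure_def emeasure_mix_measure integrator_nonneg \<sigma>_range)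

lemma measure_mix_measure_space: "measure (mix_measure G) {0..} = G 1"
  by (simp add: measure_def emeasure_mix_measure_space integrator_nonneg)

text \<open>The mass of {0} is at most G(\<sigma>(b)) for every b > 0, which is arbitrarily small by
  \<sigma>(0+) = 0 and continuity of G at 0. The kernel formula depends on this, since the formula
  breaks down for Q_0 = id.\<close>

lemma AE_mix_measure_pos: "AE r in mix_measure G. 0 < r"
proof -
  have "emeasure (mix_measure G) {0} \<le> ennreal e" if "0 < e" for e
  proof -
    have "(G \<longlongrightarrow> G 0) (at 0 within {0..1})"
    proof -
      have "continuous_on {0..1} G" using G by (simp add: stieltjes_integrator_def)
      then show ?thesis by (auto simp: continuous_on_def)
    qed
    then have "\<forall>\<^sub>F l in at 0 within {0..1}. G l < e"
      using that G by (intro order_tendstoD(2)) (auto simp: stieltjes_integrator_def)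
    then obtain d where d: "0 < d" "\<And>l. l \<in> {0..1} \<Longrightarrow> l \<noteq> 0 \<Longrightarrow> dist l 0 < d \<Longrightarrow> G l < e"
      unfolding eventually_at by auto
    obtain b where b: "0 < b" "\<sigma> (ennreal b) < d" using \<sigma>_right_0[OF d(1)] by blast
    have "G (\<sigma> (ennreal b)) < e"
      using b \<sigma>_range[of "ennreal b"] \<sigma>_pos[of "ennreal b"] by (intro d(2)) auto
    moreover have "emeasure (mix_measure G) {0} \<le> emeasure (mix_measure G) {0..<b}"
      using b by (intro emeasure_mono) (auto simp: sets_mix_measure sets_restrict_space_iff)
    then have "emeasure (mix_measure G) {0} \<le> ennreal (G (\<sigma> (ennreal b)))"
      using b(1) by (simp add: emeasure_mix_measure)
    ultimately show ?thesis by (meson ennreal_leI less_imp_le order_trans)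
  qed
  then have "emeasure (mix_measure G) {0} \<le> 0"
    using ennreal_le_epsilon[of 0 "emeasure (mix_measure G) {0}"] by simp
  then have "{0} \<in> null_sets (mix_measure G)"
    by (auto simp: null_sets_def sets_mix_measure sets_restrict_space_iff)
  then have "AE r in mix_measure G. r \<notin> {0}" by (rule AE_not_in)
  with AE_space show ?thesis by eventually_elim (auto simp: space_mix_measure)
qed

end

abbreviation avg_int :: "(real \<Rightarrow> real) \<Rightarrow> ('a \<Rightarrow> real) \<Rightarrow> ('a \<Rightarrow> real)" where
  "avg_int G \<equiv> avg_mix (mix_measure G)"

text \<open>On the cyclic subspace of \<open>f\<close>, the operator \<open>P\<close> acts as multiplication by \<open>spectral_value f\<close>.\<close>

definition spectral_value :: "('a \<Rightarrow> real) \<Rightarrow> real \<Rightarrow> real" where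
  "spectral_value f u = measure (mix_measure (\<lambda>l. l)) (level f u)"

context
  fixes f u
  assumes f: "f \<in> L2 \<mu>" and u: "u \<in> space (spectral_space f)"
begin

lemma spectral_value_cases:
  obtains "level f u = {0..}" "spectral_value f u = 1"
  | b where "0 < b" "level f u = {0..<b}" "spectral_value f u = \<sigma> (ennreal b)"
  using f u
proof (rule level_cases)
  assume "level f u = {0..}"
  then show thesis
    by (intro that(1)) (auto simp: spectral_value_def measure_mix_measure_space stieltjes_integrator_ident)
next
  fix b assume "0 < b" "level f u = {0..<b}"
  then show thesis
    by (intro that(2)) (auto simp: spectral_value_def measure_mix_measure stieltjes_integrator_ident)
qed

text \<open>Positivity reflects b > 0 in \<open>level_cases\<close>. It lets \<open>powr\<close>
  agree with natural powers, including exponent 0, and makes powers continuous in the exponent at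
  0.\<close>

lemma spectral_value_pos: "0 < spectral_value f u" and spectral_value_le: "spectral_value f u \<le> 1"
  by (rule spectral_value_cases; simp add: \<sigma>_pos \<sigma>_range)+

lemma measure_mix_measure_level:
  assumes G: "stieltjes_integrator G"
  shows "measure (mix_measure G) (level f u) = G (spectral_value f u)"
  by (rule spectral_value_cases) (simp_all add: measure_mix_measure[OF G] measure_mix_measure_space[OF G])

end

text \<open>For t = 0 the function l powr 0 jumps at l = 0 and is no
  \<open>stieltjes_integrator\<close>, so the exponent 0 is represented by the unit mass.\<close>

definition power_measure :: "real \<Rightarrow> real measure" where
  "power_measure t = (if t = 0 then dirac_zero else sigma_pow \<sigma> t)"

definition power_op :: "real \<Rightarrow> ('a \<Rightarrow> real) \<Rightarrow> ('a \<Rightarrow> real)" where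
  "power_op t = avg_mix (power_measure t)"

lemma power_op_0: "f \<in> L2 \<mu> \<Longrightarrow> power_op 0 f = f"
  by (simp add: power_op_def power_measure_def avg_mix_dirac_zero)

lemma power_op_pos: "0 < t \<Longrightarrow> power_op t = avg_mix (sigma_pow \<sigma> t)"
  by (simp add: power_op_def power_measure_def)

lemma stieltjes_measure_\<sigma>: "stieltjes_measure (\<lambda>r. \<sigma> (ennreal r)) = mix_measure (\<lambda>l. l)"
  by (simp add: mix_measure_def)

lemma mix_measure_ident: "mix_measure (\<lambda>l. l) = power_measure 1"
  by (simp add: power_measure_def sigma_pow_eq mix_measure_def \<sigma>_range)

lemma ray_measure_sigma_pow: "0 < t \<Longrightarrow> ray_measure (sigma_pow \<sigma> t)"
  unfolding sigma_pow_eq by (intro ray_measure_mix_measure stieltjes_integrator_powr)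

context
  fixes t :: real
  assumes t: "0 \<le> t"
begin

lemma ray_measure_power: "ray_measure (power_measure t)"
  using t by (auto simp: power_measure_def ray_measure_dirac_zero ray_measure_sigma_pow)

lemma measure_power_measure:
  assumes "0 < b" shows "measure (power_measure t) {0..<b} = \<sigma> (ennreal b) powr t"
proof (cases "t = 0")
  case True
  then show ?thesis using assms \<sigma>_pos[of "ennreal b"]
    by (simp add: power_measure_def)
       (intro measure_dirac_zero, auto simp: ray_measure_sets[OF ray_measure_dirac_zero] sets_restrict_space_iff)
next
  case False
  then show ?thesis using assms t
    by (simp add: power_measure_def sigma_pow_eq measure_mix_measure stieltjes_integrator_powr)
qed

lemma measure_power_measure_space: "measure (power_measure t) {0..} = 1"
proof (cases "t = 0")
  case True
  then show ?thesis
    by (simp add: power_measure_def)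
       (intro measure_dirac_zero, auto simp: ray_measure_sets[OF ray_measure_dirac_zero] sets_restrict_space_iff)
next
  case False
  then show ?thesis using t
    by (simp add: power_measure_def sigma_pow_eq measure_mix_measure_space stieltjes_integrator_powr)
qed

lemma measure_power_measure_level:
  assumes "f \<in> L2 \<mu>" "u \<in> space (spectral_space f)"
  shows "measure (power_measure t) (level f u) = spectral_value f u powr t"
  using assms
  by (cases rule: spectral_value_cases[consumes 2])
     (simp_all add: measure_power_measure measure_power_measure_space)

lemma power_op_operator: "L2_operator \<mu> (power_op t)"
  unfolding power_op_def by (rule avg_mix_operator[OF ray_measure_power])

lemma power_op_L2: "f \<in> L2 \<mu> \<Longrightarrow> power_op t f \<in> L2 \<mu>"
  by (rule L2_operatorD(1)[OF power_op_operator])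

lemma power_op_selfadjoint: "L2_selfadjoint \<mu> (power_op t)"
  unfolding power_op_def by (rule avg_mix_selfadjoint[OF ray_measure_power])

end

lemma power_op_add:
  assumes "0 \<le> s" "0 \<le> t" "f \<in> L2 \<mu>"
  shows "AE x in \<mu>. power_op s (power_op t f) x = power_op (s + t) f x"
  unfolding power_op_def using assms
  by (intro avg_mix_compose ray_measure_power)
     (auto simp: measure_power_measure measure_power_measure_space powr_add)

lemma norm_power_op_sum:
  assumes I: "finite I" and \<tau>: "\<And>i. i \<in> I \<Longrightarrow> 0 \<le> \<tau> i" and f: "f \<in> L2 \<mu>"
  shows "(L2_norm \<mu> (\<lambda>x. \<Sum>i\<in>I. a i * power_op (\<tau> i) f x))\<^sup>2 =
    (\<integral>u. (\<Sum>i\<in>I. a i * spectral_value f u powr \<tau> i)\<^sup>2 \<partial>spectral_space f)"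
proof -
  have "(L2_norm \<mu> (\<lambda>x. \<Sum>i\<in>I. a i * power_op (\<tau> i) f x))\<^sup>2 =
      (\<integral>u. (\<Sum>i\<in>I. a i * measure (power_measure (\<tau> i)) (level f u))\<^sup>2 \<partial>spectral_space f)"
    unfolding power_op_def using \<tau> by (intro norm_avg_mix_sum I ray_measure_power f)
  also have "\<dots> = (\<integral>u. (\<Sum>i\<in>I. a i * spectral_value f u powr \<tau> i)\<^sup>2 \<partial>spectral_space f)"
    using \<tau> f by (intro Bochner_Integration.integral_cong refl arg_cong[where f = "\<lambda>x. x\<^sup>2"] sum.cong)
       (simp add: measure_power_measure_level)
  finally show ?thesis .
qed

lemma integral_spectral_space_le:
  assumes le: "\<And>u. u \<in> space (spectral_space f) \<Longrightarrow> \<bar>\<phi> u\<bar> \<le> e"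
  shows "(\<integral>u. (\<phi> u)\<^sup>2 \<partial>spectral_space f) \<le> (e * L2_norm \<mu> f)\<^sup>2"
proof -
  interpret finite_measure "spectral_space f" by (rule finite_spectral_space)
  have sq: "(\<phi> u)\<^sup>2 \<le> e\<^sup>2" if "u \<in> space (spectral_space f)" for u
    using power_mono[OF le[OF that], of 2] by simp
  have "(\<integral>u. (\<phi> u)\<^sup>2 \<partial>spectral_space f) \<le> (\<integral>u. e\<^sup>2 \<partial>spectral_space f)"
    using sq by (intro integral_mono_AE') auto
  also have "\<dots> = (e * L2_norm \<mu> f)\<^sup>2"
    by (simp add: measure_spectral_space power_mult_distrib)
  finally show ?thesis .
qed

end

section \<open>Spectrum and functional calculus\<close>

context isotropic
begin

abbreviation "P \<equiv> iso_op \<mu> \<sigma>"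

section \<open>The operator P and its spectrum\<close>

lemma ray_measure_\<sigma>: "ray_measure (stieltjes_measure (\<lambda>r. \<sigma> (ennreal r)))"
  unfolding stieltjes_measure_\<sigma> by (rule ray_measure_mix_measure[OF stieltjes_integrator_ident])

lemma iso_op_strong_integral:
  "has_strong_integral \<mu> (stieltjes_measure (\<lambda>r. \<sigma> (ennreal r))) (avg \<mu>) P"
  unfolding iso_op_def by (rule strong_integral_avg(1)[OF ray_measure_\<sigma>])

lemma iso_op_operator: "L2_operator \<mu> P"
  using iso_op_strong_integral by (simp add: has_strong_integral_def)

lemma iso_op_L2: "f \<in> L2 \<mu> \<Longrightarrow> P f \<in> L2 \<mu>"
  by (rule L2_operatorD(1)[OF iso_op_operator])

lemma iso_op_eq: "f \<in> L2 \<mu> \<Longrightarrow> AE x in \<mu>. P f x = power_op 1 f x"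
  using strong_integral_avg(2)[OF ray_measure_\<sigma>, of f]
  by (simp add: iso_op_def power_op_def stieltjes_measure_\<sigma> mix_measure_ident)

lemma iso_op_selfadjoint: "L2_selfadjoint \<mu> P"
  by (rule L2_selfadjoint_cong[OF power_op_selfadjoint iso_op_operator iso_op_eq]) simp

lemma avg_int_compose:
  assumes G: "stieltjes_integrator G" and H: "stieltjes_integrator H"
    and K: "stieltjes_integrator (\<lambda>l. G l * H l)" and f: "f \<in> L2 \<mu>"
  shows "AE x in \<mu>. avg_int G (avg_int H f) x = avg_int (\<lambda>l. G l * H l) f x"
  using assms by (intro avg_mix_compose ray_measure_mix_measure)
    (auto simp: measure_mix_measure measure_mix_measure_space)

text \<open>The resolvent at \<open>l\<close> corresponds to \<open>\<lambda> \<mapsto> 1 / (\<lambda> - l) = - 1 / l - \<lambda> / (l * (l - \<lambda>))\<close>,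
  where the second part is a stieltjes integrator.\<close>

lemma spectrum_subset: "L2_spectrum \<mu> P \<subseteq> {0..1}"
proof (rule ccontr)
  assume "\<not> ?thesis"
  then obtain l where l: "l \<in> L2_spectrum \<mu> P" "l < 0 \<or> 1 < l" by force
  define G where "G x = x / (l * (l - x))" for x
  define K where "K x = x * G x" for x
  \<comment> \<open>For l outside [0,1] and x inside, l and l - x have the same sign.\<close>
  have denom: "0 < l * (l - x)" if "0 \<le> x" "x \<le> 1" for x
    using l(2) that by (auto intro: mult_pos_pos mult_neg_neg)
  have G_mono: "G x \<le> G y" if "0 \<le> x" "x \<le> y" "y \<le> 1" for x y
  proof -
    have "x * (l * (l - y)) \<le> y * (l * (l - x))"
    proof -
      have "y * (l * (l - x)) - x * (l * (l - y)) = (y - x) * l\<^sup>2" by (simp add: algebra_simps power2_eq_square)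
      moreover have "0 \<le> (y - x) * l\<^sup>2" using that by simp
      ultimately show ?thesis by linarith
    qed
    then show ?thesis
      using denom[of x] denom[of y] that by (simp add: G_def frac_le_eq divide_le_0_iff) (simp add: field_simps)
  qed
  have G_nonneg: "0 \<le> G x" if "0 \<le> x" "x \<le> 1" for x
    using denom[OF that] that by (simp add: G_def)
  have G_cont: "continuous_on {0..1} G"
    unfolding G_def using denom by (intro continuous_intros) force
  have G: "stieltjes_integrator G"
    unfolding stieltjes_integrator_def using G_mono G_cont by (auto intro!: mono_onI simp: G_def)
  \<comment> \<open>K is the symbol of P W and of W P, and it has to be an integrator itself for the
    composition rule to apply.\<close>
  have K: "stieltjes_integrator K"
    unfolding stieltjes_integrator_def K_def using G_mono G_cont G_nonneg
    by (auto intro!: mono_onI mult_mono continuous_intros)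
  have K1: "stieltjes_integrator (\<lambda>x. x * G x)" and K2: "stieltjes_integrator (\<lambda>x. G x * x)"
    using K by (simp_all add: K_def[abs_def] mult.commute)
  have K_eq: "(\<lambda>x. x * G x) = K" "(\<lambda>x. G x * x) = K" by (auto simp: K_def)
  define W where "W = avg_int G"
  define R where "R = (\<lambda>f x. (- 1 / l) * f x + (- 1) * W f x)"
  have W: "L2_operator \<mu> W" unfolding W_def by (rule avg_mix_operator[OF ray_measure_mix_measure[OF G]])
  have R: "L2_operator \<mu> R" unfolding R_def by (rule L2_operator_combine[OF W])
  have l0: "l \<noteq> 0" using l(2) by auto
  have "(AE x in \<mu>. R (\<lambda>y. P f y - l * f y) x = f x) \<and> (AE x in \<mu>. P (R f) x - l * R f x = f x)"
    if f: "f \<in> L2 \<mu>" for f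
  proof -
    have PW: "AE x in \<mu>. P (W f) x = avg_int K f x"
    proof -
      have "AE x in \<mu>. avg_int (\<lambda>x. x) (W f) x = avg_int K f x"
        using avg_int_compose[OF stieltjes_integrator_ident G K1 f] by (simp add: W_def K_eq)
      moreover have "AE x in \<mu>. P (W f) x = avg_int (\<lambda>x. x) (W f) x"
        using iso_op_eq[OF L2_operatorD(1)[OF W f]] by (simp add: power_op_def mix_measure_ident)
      ultimately show ?thesis by eventually_elim simp
    qed
    have WP: "AE x in \<mu>. W (P f) x = avg_int K f x"
    proof -
      have "AE x in \<mu>. W (avg_int (\<lambda>x. x) f) x = avg_int K f x"
        using avg_int_compose[OF G stieltjes_integrator_ident K2 f] by (simp add: W_def K_eq)
      moreover have "AE x in \<mu>. P f x = avg_int (\<lambda>x. x) f x"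
        using iso_op_eq[OF f] by (simp add: power_op_def mix_measure_ident)
      then have "AE x in \<mu>. W (P f) x = W (avg_int (\<lambda>x. x) f) x"
        by (intro L2_operator_AE_cong[OF W iso_op_L2[OF f]] avg_mix_L2 f
            ray_measure_mix_measure stieltjes_integrator_ident)
      ultimately show ?thesis by eventually_elim simp
    qed
    \<comment> \<open>The three terms of - \<lambda>/l - \<lambda> G(\<lambda>) + l G(\<lambda>) =
      0, arranged as one linear combination. This scalar identity yields both the left and the right
      inverse property.\<close>
    define N where "N i = mix_measure (if i = 0 then (\<lambda>x. x) else if i = 1 then K else G)" for i :: nat
    define a where "a i = (if i = 0 then - 1 / l else if i = 1 then - 1 else l)" for i :: nat
    have N: "ray_measure (N i)" for i
      unfolding N_def using G K stieltjes_integrator_ident by (auto intro: ray_measure_mix_measure)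
    have sum3: "(\<Sum>i\<in>{..<3::nat}. h i) = h 0 + h 1 + h 2" for h :: "nat \<Rightarrow> real"
      by (simp add: eval_nat_numeral)
    let ?Z = "\<lambda>x. \<Sum>i\<in>{..<3}. a i * avg_mix (N i) f x"
    have "(L2_norm \<mu> ?Z)\<^sup>2 = (\<integral>u. (\<Sum>i\<in>{..<3}. a i * measure (N i) (level f u))\<^sup>2 \<partial>spectral_space f)"
      by (intro norm_avg_mix_sum N f) simp
    also have "\<dots> = (\<integral>u. 0 \<partial>spectral_space f)"
    proof (rule Bochner_Integration.integral_cong[OF refl])
      fix u assume u: "u \<in> space (spectral_space f)"
      let ?v = "spectral_value f u"
      have v: "0 < l * (l - ?v)" using spectral_value_pos[OF f u] spectral_value_le[OF f u] by (intro denom) auto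
      then have v': "l - ?v \<noteq> 0" by auto
      have "(\<Sum>i\<in>{..<3}. a i * measure (N i) (level f u)) = - ?v / l - ?v * G ?v + l * G ?v"
        unfolding sum3 N_def a_def
        by (simp add: measure_mix_measure_level[OF f u] G K stieltjes_integrator_ident K_def)
      also have "\<dots> = (l - ?v) * G ?v - ?v / l" by (simp add: algebra_simps)
      also have "\<dots> = 0" using l0 v' by (simp add: G_def)
      finally show "(\<Sum>i\<in>{..<3}. a i * measure (N i) (level f u))\<^sup>2 = 0" by simp
    qed
    finally have "L2_norm \<mu> ?Z = 0" by simp
    moreover have "?Z \<in> L2 \<mu>" by (intro L2_sum L2_cmult avg_mix_L2 N f)
    ultimately have "AE x in \<mu>. ?Z x = 0" by (simp add: L2_norm_zero_iff)
    then have Z: "AE x in \<mu>. - 1 / l * P f x - avg_int K f x + l * W f x = 0"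
      using iso_op_eq[OF f]
      by eventually_elim (simp add: sum3 a_def N_def W_def power_op_def mix_measure_ident)
    have "AE x in \<mu>. R (\<lambda>y. P f y - l * f y) x = f x"
    proof -
      have "AE x in \<mu>. W (\<lambda>y. P f y - l * f y) x = W (P f) x - W (\<lambda>y. l * f y) x"
        by (intro L2_operator_diff[OF W] iso_op_L2 L2_cmult f)
      moreover have "AE x in \<mu>. W (\<lambda>y. l * f y) x = l * W f x" by (rule L2_operatorD(3)[OF W f])
      ultimately show ?thesis
        using Z WP by eventually_elim (simp add: R_def l0 right_diff_distrib diff_divide_distrib)
    qed
    moreover have "AE x in \<mu>. P (R f) x - l * R f x = f x"
    proof -
      have "AE x in \<mu>. P (R f) x = P (\<lambda>y. (- 1 / l) * f y) x + P (\<lambda>y. (- 1) * W f y) x"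
        unfolding R_def by (intro L2_operatorD(2)[OF iso_op_operator] L2_cmult f L2_operatorD(1)[OF W])
      moreover have "AE x in \<mu>. P (\<lambda>y. (- 1 / l) * f y) x = (- 1 / l) * P f x"
        by (rule L2_operatorD(3)[OF iso_op_operator f])
      moreover have "AE x in \<mu>. P (\<lambda>y. (- 1) * W f y) x = (- 1) * P (W f) x"
        by (intro L2_operatorD(3)[OF iso_op_operator] L2_operatorD(1)[OF W] f)
      ultimately show ?thesis
        using Z PW by eventually_elim (simp add: R_def l0 algebra_simps)
    qed
    ultimately show ?thesis ..
  qed
  with R l(1) show False unfolding L2_spectrum_def by blast
qed

text \<open>P and the identity are the powers with exponents 1 and 0, so the formula for
  combinations of powers applies with coefficients 1 and - l.\<close>

lemma norm_iso_op_diff: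
  assumes f: "f \<in> L2 \<mu>"
  shows "(L2_norm \<mu> (\<lambda>x. P f x - l * f x))\<^sup>2 = (\<integral>u. (spectral_value f u - l)\<^sup>2 \<partial>spectral_space f)"
proof -
  let ?a = "\<lambda>i :: nat. if i = 1 then 1 else - l"
  have sum2: "(\<Sum>i\<in>{0, 1::nat}. h i) = h 0 + h 1" for h :: "nat \<Rightarrow> real" by simp
  have "(L2_norm \<mu> (\<lambda>x. P f x - l * f x))\<^sup>2 = (L2_norm \<mu> (\<lambda>x. \<Sum>i\<in>{0, 1}. ?a i * power_op (real i) f x))\<^sup>2"
  proof (intro arg_cong[where f = "\<lambda>x. x\<^sup>2"] L2_norm_AE_cong)
    show "AE x in \<mu>. P f x - l * f x = (\<Sum>i\<in>{0, 1}. ?a i * power_op (real i) f x)"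
      using iso_op_eq[OF f] by eventually_elim (simp add: sum2 power_op_0 f)
  qed (intro L2_diff L2_sum L2_cmult iso_op_L2 power_op_L2 f; simp)+
  also have "\<dots> = (\<integral>u. (\<Sum>i\<in>{0, 1}. ?a i * spectral_value f u powr real i)\<^sup>2 \<partial>spectral_space f)"
    by (intro norm_power_op_sum f) auto
  also have "\<dots> = (\<integral>u. (spectral_value f u - l)\<^sup>2 \<partial>spectral_space f)"
    using spectral_value_pos[OF f]
    by (intro Bochner_Integration.integral_cong refl arg_cong[where f = "\<lambda>x. x\<^sup>2"]) (simp add: less_imp_le, fastforce)
  finally show ?thesis .
qed

text \<open>Differences of averages over radii close to the end point of \<open>level f u\<close> are approximate
  eigenvectors for \<open>spectral_value f u\<close>.\<close>

lemma approximate_eigenvector: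
  assumes f: "f \<in> L2 \<mu>" and u: "u \<in> space (spectral_space f)" and a: "a \<in> level f u"
  obtains g where "g \<in> L2 \<mu>" "0 < L2_norm \<mu> g"
    "L2_norm \<mu> (\<lambda>x. P g x - spectral_value f u * g x) \<le> (spectral_value f u - \<sigma> (ennreal a)) * L2_norm \<mu> g"
proof -
  have u0: "0 \<le> u" using u by (simp add: spectral_space_def space_restrict_space)
  have a0: "0 \<le> a" "u < energy f a" using a by (auto simp: level_def)
  let ?l = "spectral_value f u"
  note found = that
  \<comment> \<open>If g is fixed by all averages up to radius a, its level sets contain [0,a); if
    they also lie in \<open>level f u\<close>, every spectral value of g is squeezed between
    \<sigma>(a) and that of f at u.\<close>
  have main: thesis
    if g: "g \<in> L2 \<mu>" and pos: "0 < L2_norm \<mu> g"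
      and avg_g: "\<And>r. 0 \<le> r \<Longrightarrow> r \<le> a \<Longrightarrow> avg \<mu> r g = g"
      and sub: "\<And>v. v \<in> space (spectral_space g) \<Longrightarrow> level g v \<subseteq> level f u" for g
  proof (rule found[OF g pos], rule power2_le_imp_le)
    have "\<bar>spectral_value g v - ?l\<bar> \<le> ?l - \<sigma> (ennreal a)" if v: "v \<in> space (spectral_space g)" for v
    proof -
      let ?N = "mix_measure (\<lambda>l. l)"
      have N: "ray_measure ?N" by (rule ray_measure_mix_measure[OF stieltjes_integrator_ident])
      interpret finite_measure ?N by (rule ray_measure_finite[OF N])
      have "{0..<a} \<subseteq> level g v"
      proof
        fix r assume r: "r \<in> {0..<a}"
        then have "energy g r = energy g 0" using avg_g[of r] avg_g[of 0] a0 by (simp add: energy_def)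
        then show "r \<in> level g v"
          using r v by (simp add: level_def energy_0 spectral_space_def space_restrict_space)
      qed
      then have "\<sigma> (ennreal a) \<le> spectral_value g v"
        unfolding spectral_value_def measure_mix_measure[OF stieltjes_integrator_ident a0(1), symmetric]
        by (intro finite_measure_mono level_sets N g)
      moreover have "spectral_value g v \<le> ?l"
        unfolding spectral_value_def by (intro finite_measure_mono level_sets sub v N f)
      ultimately show ?thesis by simp
    qed
    then show "(L2_norm \<mu> (\<lambda>x. P g x - ?l * g x))\<^sup>2 \<le> ((?l - \<sigma> (ennreal a)) * L2_norm \<mu> g)\<^sup>2"
      unfolding norm_iso_op_diff[OF g] by (rule integral_spectral_space_le)
    have "\<sigma> (ennreal a) \<le> ?l"
      using a by (cases rule: spectral_value_cases[OF f u]) (auto intro!: \<sigma>_mono ennreal_leI \<sigma>_range)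
    then show "0 \<le> (?l - \<sigma> (ennreal a)) * L2_norm \<mu> g" by simp
  qed
  show thesis
  proof (cases rule: spectral_value_cases[OF f u])
    \<comment> \<open>The level set is the whole half-line, so no upper restriction on the radii is
      imposed and Q_a f serves.\<close>
    case 1
    show thesis
    proof (rule main)
      show "avg \<mu> a f \<in> L2 \<mu>" using f by simp
      show "0 < L2_norm \<mu> (avg \<mu> a f)"
        using a0 u0 energy_eq[OF f a0(1)] by (metis L2_norm_nonneg less_le not_less power_zero_numeral)
      show "avg \<mu> r (avg \<mu> a f) = avg \<mu> a f" if "0 \<le> r" "r \<le> a" for r using that by (rule avg_avg)
      show "level (avg \<mu> a f) v \<subseteq> level f u" for v unfolding 1(1) by (auto simp: level_def)
    qed
  next
    case (2 b)
    have ab: "a < b" using a 2(2) by auto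
    have b_notin: "b \<notin> level f u" using 2(2) by simp
    \<comment> \<open>Subtracting Q_b f removes all energy at radii from b on, which confines the
      level sets to [0,b).\<close>
    let ?g = "\<lambda>x. avg \<mu> a f x - avg \<mu> b f x"
    have g: "?g \<in> L2 \<mu>" using f by auto
    have avg_g: "avg \<mu> r ?g x = avg \<mu> r (avg \<mu> a f) x - avg \<mu> r (avg \<mu> b f) x" for r x
      using f by (intro avg_diff) auto
    show thesis
    proof (rule main)
      show "?g \<in> L2 \<mu>" by (rule g)
      have "(L2_norm \<mu> ?g)\<^sup>2 = energy f a - energy f b"
        using ab a0 by (intro norm_avg_diff_sq f) auto
      also have "\<dots> > 0" using a0(2) b_notin 2(1) by (auto simp: level_def)
      finally show "0 < L2_norm \<mu> ?g"
        using L2_norm_nonneg[of \<mu> ?g] by (auto simp: less_le simp del: L2_norm_nonneg)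
      show "avg \<mu> r ?g = ?g" if "0 \<le> r" "r \<le> a" for r
        using that ab by (auto simp: avg_g avg_avg fun_eq_iff)
      fix v assume v: "v \<in> space (spectral_space ?g)"
      have "energy ?g r = 0" if "b \<le> r" for r
      proof -
        have r: "0 \<le> r" "a \<le> r" using that ab a0 by auto
        have *: "L2_inner \<mu> (avg \<mu> r (avg \<mu> q f)) ?g = L2_inner \<mu> (avg \<mu> r f) ?g" if "0 \<le> q" "q \<le> r" for q
          using avg_selfadjoint[OF avg_L2[OF f] g, of r q] inner_avg_avg[OF f g that(1) r(1)] that
          by (simp add: max_absorb2)
        have "energy ?g r = L2_inner \<mu> (avg \<mu> r (avg \<mu> a f)) ?g - L2_inner \<mu> (avg \<mu> r (avg \<mu> b f)) ?g"
          unfolding energy_def avg_g using f g by (intro L2_inner_diff_left) auto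
        also have "\<dots> = 0" using *[of a] *[of b] r that 2(1) a0 by simp
        finally show ?thesis .
      qed
      then show "level ?g v \<subseteq> level f u"
        using v unfolding 2(2) by (force simp: level_def spectral_space_def space_restrict_space not_less[symmetric])
    qed
  qed
qed

text \<open>A bounded left inverse of P - l with bound D is incompatible with an approximate
  eigenvector of relative error below 1/D.\<close>

lemma spectral_value_in_spectrum:
  assumes f: "f \<in> L2 \<mu>" and u: "u \<in> space (spectral_space f)"
  shows "spectral_value f u \<in> L2_spectrum \<mu> P"
proof (rule ccontr)
  let ?l = "spectral_value f u"
  assume "?l \<notin> L2_spectrum \<mu> P"
  then obtain R where R: "L2_operator \<mu> R"
    and inv: "\<And>g. g \<in> L2 \<mu> \<Longrightarrow> AE x in \<mu>. R (\<lambda>y. P g y - ?l * g y) x = g x"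
    unfolding L2_spectrum_def by blast
  obtain C where C: "\<And>g. g \<in> L2 \<mu> \<Longrightarrow> L2_norm \<mu> (R g) \<le> C * L2_norm \<mu> g"
    using L2_operatorD(4)[OF R] by blast
  \<comment> \<open>The maximum with 1 makes the bound positive, so that 1 / D is a meaningful
    tolerance.\<close>
  define D where "D = max C 1"
  have D: "0 < D" "C \<le> D" by (auto simp: D_def)
  \<comment> \<open>Left continuity of \<sigma> at the right end of the level set, which is
    \<infinity> in the unbounded case, provides a radius inside it with this gap.\<close>
  have "\<exists>a\<in>level f u. ?l - \<sigma> (ennreal a) < 1 / D"
  proof (cases rule: spectral_value_cases[OF f u])
    case 1
    have "\<forall>\<^sub>F n in sequentially. 1 - 1 / D < \<sigma> (ennreal (real n))"
      using D by (intro order_tendstoD(1)[OF \<sigma>_tendsto_1]) simp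
    then obtain n where "1 - 1 / D < \<sigma> (ennreal (real n))"
      using eventually_happens'[OF sequentially_bot] by blast
    with 1 show ?thesis by (intro bexI[of _ "real n"]) auto
  next
    case (2 b)
    have "\<forall>\<^sub>F a in at_left b. \<sigma> (ennreal b) - 1 / D < \<sigma> (ennreal a)"
      using D by (intro order_tendstoD(1)[OF \<sigma>_real_left_continuous]) simp
    moreover have "\<forall>\<^sub>F a in at_left b. 0 < a"
      using 2(1) by (intro eventually_at_leftI[of 0]) auto
    moreover have "\<forall>\<^sub>F a in at_left b. a < b"
      by (auto simp: eventually_at_filter)
    ultimately have "\<forall>\<^sub>F a in at_left b. 0 < a \<and> a < b \<and> \<sigma> (ennreal b) - 1 / D < \<sigma> (ennreal a)"
      by eventually_elim auto
    then obtain a where "0 < a" "a < b" "\<sigma> (ennreal b) - 1 / D < \<sigma> (ennreal a)"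
      using eventually_happens'[OF trivial_limit_at_left_real] by blast
    with 2 show ?thesis by (intro bexI[of _ a]) auto
  qed
  then obtain a where a: "a \<in> level f u" "?l - \<sigma> (ennreal a) < 1 / D" by blast
  obtain g where g: "g \<in> L2 \<mu>" "0 < L2_norm \<mu> g"
    "L2_norm \<mu> (\<lambda>x. P g x - ?l * g x) \<le> (?l - \<sigma> (ennreal a)) * L2_norm \<mu> g"
    using approximate_eigenvector[OF f u a(1)] .
  let ?h = "\<lambda>x. P g x - ?l * g x"
  have h: "?h \<in> L2 \<mu>" by (intro L2_diff L2_cmult iso_op_L2 g(1))
  have "L2_norm \<mu> g = L2_norm \<mu> (R ?h)"
    using inv[OF g(1)] by (intro L2_norm_AE_cong g(1) L2_operatorD(1)[OF R h]) auto
  also have "\<dots> \<le> D * L2_norm \<mu> ?h"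
    using C[OF h] D(2) by (meson L2_norm_nonneg mult_right_mono order_trans)
  also have "\<dots> \<le> D * ((?l - \<sigma> (ennreal a)) * L2_norm \<mu> g)"
    using g(3) D(1) by (intro mult_left_mono) auto
  also have "\<dots> < D * (1 / D * L2_norm \<mu> g)"
    using a(2) g(2) D(1) by (intro mult_strict_left_mono mult_strict_right_mono)
  also have "\<dots> = L2_norm \<mu> g" using D(1) by simp
  finally show False by simp
qed

section \<open>Polynomials of P and the functional calculus\<close>

lemma iso_op_funpow:
  assumes f: "f \<in> L2 \<mu>"
  shows "(P ^^ i) f \<in> L2 \<mu> \<and> (AE x in \<mu>. (P ^^ i) f x = power_op (real i) f x)"
proof (induction i)
  case 0
  then show ?case by (simp add: f power_op_0)
next
  case (Suc i)
  then have L2: "(P ^^ i) f \<in> L2 \<mu>" and eq: "AE x in \<mu>. (P ^^ i) f x = power_op (real i) f x" by auto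
  have i: "power_op (real i) f \<in> L2 \<mu>" by (intro power_op_L2 f) simp
  \<comment> \<open>The iterate is known only almost everywhere, so the argument of the chosen P is
    exchanged for its concrete representative before the semigroup law is used.\<close>
  have "AE x in \<mu>. P ((P ^^ i) f) x = P (power_op (real i) f) x"
    by (rule L2_operator_AE_cong[OF iso_op_operator L2 i eq])
  moreover have "AE x in \<mu>. P (power_op (real i) f) x = power_op 1 (power_op (real i) f) x"
    by (rule iso_op_eq[OF i])
  moreover have "AE x in \<mu>. power_op 1 (power_op (real i) f) x = power_op (1 + real i) f x"
    by (intro power_op_add f) auto
  ultimately have "AE x in \<mu>. (P ^^ Suc i) f x = power_op (real (Suc i)) f x"
    by eventually_elim simp
  with iso_op_L2[OF L2] show ?case by simp
qed

lemma op_poly_L2: "f \<in> L2 \<mu> \<Longrightarrow> op_poly p P f \<in> L2 \<mu>"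
  unfolding op_poly_def using iso_op_funpow by (intro L2_sum L2_cmult) auto

lemma norm_op_poly_diff:
  assumes f: "f \<in> L2 \<mu>" and t: "0 \<le> t"
  shows "(L2_norm \<mu> (\<lambda>x. op_poly p P f x - power_op t f x))\<^sup>2 =
    (\<integral>u. (poly p (spectral_value f u) - spectral_value f u powr t)\<^sup>2 \<partial>spectral_space f)"
proof -
  let ?d = "degree p"
  \<comment> \<open>The power with exponent t is appended as one further term, of index degree + 1
    and coefficient -1, so that the difference is again a finite combination of powers.\<close>
  define \<tau> where "\<tau> i = (if i = Suc ?d then t else real i)" for i
  define a where "a i = (if i = Suc ?d then - 1 else coeff p i)" for i
  have \<tau>: "0 \<le> \<tau> i" for i using t by (simp add: \<tau>_def)
  have sum_eq: "(\<Sum>i\<le>Suc ?d. a i * h (\<tau> i)) = (\<Sum>i\<le>?d. coeff p i * h (real i)) - h t" for h :: "real \<Rightarrow> real"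
    by (simp add: a_def \<tau>_def)
  have "(L2_norm \<mu> (\<lambda>x. op_poly p P f x - power_op t f x))\<^sup>2 = (L2_norm \<mu> (\<lambda>x. \<Sum>i\<le>Suc ?d. a i * power_op (\<tau> i) f x))\<^sup>2"
  proof (intro arg_cong[where f = "\<lambda>x. x\<^sup>2"] L2_norm_AE_cong)
    have "AE x in \<mu>. \<forall>i. (P ^^ i) f x = power_op (real i) f x"
      using iso_op_funpow[OF f] by (subst AE_all_countable) auto
    then show "AE x in \<mu>. op_poly p P f x - power_op t f x = (\<Sum>i\<le>Suc ?d. a i * power_op (\<tau> i) f x)"
    proof eventually_elim
      case (elim x)
      then show ?case unfolding sum_eq[of "\<lambda>s. power_op s f x"] op_poly_def by simp
    qed
  qed (intro L2_diff L2_sum L2_cmult op_poly_L2 power_op_L2 f \<tau> t)+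
  also have "\<dots> = (\<integral>u. (\<Sum>i\<le>Suc ?d. a i * spectral_value f u powr \<tau> i)\<^sup>2 \<partial>spectral_space f)"
    by (intro norm_power_op_sum f \<tau>) simp
  also have "\<dots> = (\<integral>u. (poly p (spectral_value f u) - spectral_value f u powr t)\<^sup>2 \<partial>spectral_space f)"
  proof (rule Bochner_Integration.integral_cong[OF refl])
    fix u assume u: "u \<in> space (spectral_space f)"
    show "(\<Sum>i\<le>Suc ?d. a i * spectral_value f u powr \<tau> i)\<^sup>2 = (poly p (spectral_value f u) - spectral_value f u powr t)\<^sup>2"
      unfolding sum_eq[of "\<lambda>s. spectral_value f u powr s"]
      using spectral_value_pos[OF f u] by (simp add: poly_altdef powr_realpow)
  qed
  finally show ?thesis .
qed

text \<open>Control on the spectrum is all that \<open>is_fun_calc\<close> provides; it suffices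
  because the integrand involves only spectral values, which lie there.\<close>

lemma norm_op_poly_diff_le:
  assumes f: "f \<in> L2 \<mu>" and t: "0 \<le> t" and e: "0 \<le> e"
    and le: "\<And>l. l \<in> L2_spectrum \<mu> P \<Longrightarrow> \<bar>poly p l - l powr t\<bar> \<le> e"
  shows "L2_norm \<mu> (\<lambda>x. op_poly p P f x - power_op t f x) \<le> e * L2_norm \<mu> f"
proof (rule power2_le_imp_le)
  show "(L2_norm \<mu> (\<lambda>x. op_poly p P f x - power_op t f x))\<^sup>2 \<le> (e * L2_norm \<mu> f)\<^sup>2"
    unfolding norm_op_poly_diff[OF f t]
    by (intro integral_spectral_space_le le spectral_value_in_spectrum f)
qed (simp add: e)

lemma op_poly_tendsto:
  assumes t: "0 \<le> t" and p: "uniform_limit (L2_spectrum \<mu> P) (\<lambda>n. poly (p n)) (\<lambda>l. l powr t) sequentially"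
  shows "L2_op_tendsto \<mu> (\<lambda>n. op_poly (p n) P) (power_op t)"
  unfolding L2_op_tendsto_def
proof (intro allI impI)
  fix e :: real assume "0 < e"
  from uniform_limitD[OF p this]
  show "\<forall>\<^sub>F n in sequentially. \<forall>f\<in>L2 \<mu>. L2_norm \<mu> (\<lambda>x. op_poly (p n) P f x - power_op t f x) \<le> e * L2_norm \<mu> f"
    by eventually_elim
       (intro ballI norm_op_poly_diff_le t, use \<open>0 < e\<close> in \<open>auto simp: dist_real_def less_imp_le\<close>)
qed

text \<open>Weierstrass approximation on [0,1], restricted to the spectrum by
  \<open>spectrum_subset\<close>.\<close>

lemma is_fun_calc_power_op:
  assumes t: "0 < t" shows "is_fun_calc \<mu> P (\<lambda>l. l powr t) (power_op t)"
proof -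
  have "continuous_on {0..1} (\<lambda>l :: real. l powr t)"
    using stieltjes_integrator_powr[OF t] by (simp add: stieltjes_integrator_def)
  then obtain g :: "nat \<Rightarrow> real \<Rightarrow> real" where g: "uniform_limit {0..1} g (\<lambda>l. l powr t) sequentially"
    "\<And>n. polynomial_function (g n)"
    using Stone_Weierstrass_uniform_limit[of "{0..1::real}"] by blast
  have "\<exists>p. g n = poly p" for n
  proof -
    obtain a k where "g n = (\<lambda>x. \<Sum>i\<le>k. a i * x ^ i)"
      using g(2)[of n] unfolding real_polynomial_function_eq[symmetric] real_polynomial_function_iff_sum by blast
    then have "g n = poly (\<Sum>i\<le>k. monom (a i) i)" by (auto simp: poly_sum poly_monom)
    then show ?thesis by blast
  qed
  then obtain p where "\<And>n. g n = poly (p n)" by metis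
  then have p: "g = (\<lambda>n. poly (p n))" by auto
  have lim: "uniform_limit (L2_spectrum \<mu> P) (\<lambda>n. poly (p n)) (\<lambda>l. l powr t) sequentially"
    using uniform_limit_on_subset[OF g(1) spectrum_subset] by (simp add: p)
  with op_poly_tendsto[OF _ lim] t power_op_operator[of t] show ?thesis
    unfolding is_fun_calc_def by (intro conjI exI[of _ p]) auto
qed

text \<open>The polynomials that witness B also converge to \<open>power_op t\<close> by
  \<open>op_poly_tendsto\<close>, whichever sequence was chosen, and limits agree up to null
  sets.\<close>

lemma is_fun_calc_unique:
  assumes t: "0 < t" and B: "is_fun_calc \<mu> P (\<lambda>l. l powr t) B" and f: "f \<in> L2 \<mu>"
  shows "AE x in \<mu>. B f x = power_op t f x"
proof -
  obtain p where p: "uniform_limit (L2_spectrum \<mu> P) (\<lambda>n. poly (p n)) (\<lambda>l. l powr t) sequentially"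
    and lim: "L2_op_tendsto \<mu> (\<lambda>n. op_poly (p n) P) B"
    using B unfolding is_fun_calc_def by blast
  have Bf: "B f \<in> L2 \<mu>" using B f by (auto simp: is_fun_calc_def L2_operator_def)
  have Tf: "power_op t f \<in> L2 \<mu>" using t f by (intro power_op_L2) auto
  have "L2_norm \<mu> (\<lambda>x. B f x - power_op t f x) \<le> 0 + e" if "0 < e" for e
  proof -
    \<comment> \<open>The summand 1 keeps c positive when f is null.\<close>
    define c where "c = L2_norm \<mu> f + 1"
    define d where "d = e / (2 * c)"
    have nf: "0 < c" unfolding c_def using L2_norm_nonneg[of \<mu> f] by linarith
    then have d: "0 < d" using that by (simp add: d_def)
    have "\<forall>\<^sub>F n in sequentially. L2_norm \<mu> (\<lambda>x. op_poly (p n) P f x - B f x) \<le> d * L2_norm \<mu> f \<and>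
        L2_norm \<mu> (\<lambda>x. op_poly (p n) P f x - power_op t f x) \<le> d * L2_norm \<mu> f"
      using lim op_poly_tendsto[OF less_imp_le[OF t] p] d f
      unfolding L2_op_tendsto_def by (auto simp: eventually_conj_iff intro: eventually_mono)
    then obtain n where n: "L2_norm \<mu> (\<lambda>x. op_poly (p n) P f x - B f x) \<le> d * L2_norm \<mu> f"
        "L2_norm \<mu> (\<lambda>x. op_poly (p n) P f x - power_op t f x) \<le> d * L2_norm \<mu> f"
      using eventually_happens'[OF sequentially_bot] by blast
    have "L2_norm \<mu> (\<lambda>x. B f x - power_op t f x) \<le>
        L2_norm \<mu> (\<lambda>x. B f x - op_poly (p n) P f x) + L2_norm \<mu> (\<lambda>x. op_poly (p n) P f x - power_op t f x)"
      by (intro L2_norm_diff_triangle Bf Tf op_poly_L2 f)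
    also have "\<dots> \<le> 2 * (d * L2_norm \<mu> f)"
      using n by (subst L2_norm_minus_commute) simp
    also have "\<dots> \<le> 2 * (d * c)" using d by (simp add: c_def)
    also have "\<dots> = e" using nf by (simp add: d_def)
    finally show ?thesis by simp
  qed
  then have "L2_norm \<mu> (\<lambda>x. B f x - power_op t f x) \<le> 0" by (rule field_le_epsilon)
  then have "L2_norm \<mu> (\<lambda>x. B f x - power_op t f x) = 0"
    using L2_norm_nonneg[of \<mu> "\<lambda>x. B f x - power_op t f x"] by linarith
  then have "AE x in \<mu>. B f x - power_op t f x = 0"
    using Bf Tf by (subst (asm) L2_norm_zero_iff) auto
  then show ?thesis by simp
qed

lemma is_fun_calc_iso_power: "0 < t \<Longrightarrow> is_fun_calc \<mu> P (\<lambda>l. l powr t) (iso_power \<mu> \<sigma> t)"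
  unfolding iso_power_def fun_calc_def
  using someI[where P = "is_fun_calc \<mu> P (\<lambda>l. l powr t)", OF is_fun_calc_power_op] by auto

lemma iso_power_eq: "0 \<le> t \<Longrightarrow> f \<in> L2 \<mu> \<Longrightarrow> AE x in \<mu>. iso_power \<mu> \<sigma> t f x = power_op t f x"
  using is_fun_calc_unique[OF _ is_fun_calc_iso_power, of t f]
  by (cases "t = 0") (auto simp: iso_power_def power_op_0)

lemma iso_power_operator: "0 \<le> t \<Longrightarrow> L2_operator \<mu> (iso_power \<mu> \<sigma> t)"
proof (cases "t = 0")
  case True
  show ?thesis
    using L2_operator_cong[OF power_op_operator[of 0], of id]
    by (simp add: True iso_power_def power_op_0)
next
  case False
  assume "0 \<le> t"
  with False show ?thesis using is_fun_calc_iso_power[of t] by (simp add: is_fun_calc_def)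
qed

lemma iso_power_L2: "0 \<le> t \<Longrightarrow> f \<in> L2 \<mu> \<Longrightarrow> iso_power \<mu> \<sigma> t f \<in> L2 \<mu>"
  by (rule L2_operatorD(1)[OF iso_power_operator])

section \<open>Integral representation, semigroup law and strong continuity\<close>

lemma iso_power_strong_integral:
  assumes t: "0 < t" shows "has_strong_integral \<mu> (sigma_pow \<sigma> t) (avg \<mu>) (iso_power \<mu> \<sigma> t)"
  unfolding has_strong_integral_def
proof (intro conjI ballI)
  fix f assume f: "f \<in> L2 \<mu>"
  have "AE x in \<mu>. avg_mix (sigma_pow \<sigma> t) f x = iso_power \<mu> \<sigma> t f x"
    using iso_power_eq[OF less_imp_le[OF t] f] t by (simp add: power_op_pos eq_commute)
  with t f show "has_L2_integral \<mu> (sigma_pow \<sigma> t) (\<lambda>r. avg \<mu> r f) (iso_power \<mu> \<sigma> t f)"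
    by (intro has_L2_integral_AE_cong[OF has_L2_integral_avg_mix] ray_measure_sigma_pow iso_power_L2) auto
qed (use t in \<open>simp add: iso_power_operator\<close>)

lemma iso_power_add:
  assumes s: "0 \<le> s" and t: "0 \<le> t" and f: "f \<in> L2 \<mu>"
  shows "AE x in \<mu>. iso_power \<mu> \<sigma> (s + t) f x = iso_power \<mu> \<sigma> s (iso_power \<mu> \<sigma> t f) x"
proof -
  note L2 = iso_power_L2[OF t f] power_op_L2[OF t f]
  have "AE x in \<mu>. iso_power \<mu> \<sigma> s (iso_power \<mu> \<sigma> t f) x = iso_power \<mu> \<sigma> s (power_op t f) x"
    by (rule L2_operator_AE_cong[OF iso_power_operator[OF s] L2 iso_power_eq[OF t f]])
  moreover note iso_power_eq[OF s L2(2)] power_op_add[OF s t f]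
  moreover have "AE x in \<mu>. iso_power \<mu> \<sigma> (s + t) f x = power_op (s + t) f x"
    using s t by (intro iso_power_eq f) simp
  ultimately show ?thesis by eventually_elim simp
qed

lemma norm_power_op_diff:
  assumes f: "f \<in> L2 \<mu>" and s: "0 \<le> s" and t: "0 \<le> t"
  shows "(L2_norm \<mu> (\<lambda>x. power_op t f x - power_op s f x))\<^sup>2 =
    (\<integral>u. (spectral_value f u powr t - spectral_value f u powr s)\<^sup>2 \<partial>spectral_space f)"
  using norm_power_op_sum[of "{False, True}" "\<lambda>i. if i then t else s" f "\<lambda>i. if i then 1 else - 1"] assms
  by (simp add: algebra_simps)

text \<open>Dominated convergence in the spectral parameter along sequences of exponents. The bases
  lie in (0,1]: positivity covers the limit exponent 0, and the upper bound supplies the majorant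
  1.\<close>

lemma iso_power_strongly_continuous: "strongly_continuous \<mu> (iso_power \<mu> \<sigma>)"
  unfolding strongly_continuous_def tendsto_at_iff_sequentially
proof (intro ballI allI impI)
  fix f s and X :: "nat \<Rightarrow> real"
  assume f: "f \<in> L2 \<mu>" and s: "0 \<le> s" and X: "\<forall>i. X i \<in> {0..} - {s}" "X \<longlonglongrightarrow> s"
  have X0: "0 \<le> X i" for i using X(1) by simp
  interpret finite_measure "spectral_space f" by (rule finite_spectral_space)
  let ?v = "spectral_value f"
  have v_meas: "?v \<in> borel_measurable (spectral_space f)"
    unfolding spectral_value_def[abs_def]
    by (intro measurable_measure_level ray_measure_mix_measure stieltjes_integrator_ident f)
  have v: "0 < ?v u" "?v u \<le> 1" if "u \<in> space (spectral_space f)" for u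
    using f that by (auto intro: spectral_value_pos spectral_value_le)
  have "(\<lambda>i. \<integral>u. (?v u powr X i - ?v u powr s)\<^sup>2 \<partial>spectral_space f) \<longlonglongrightarrow> (\<integral>u. 0 \<partial>spectral_space f)"
  proof (rule integral_dominated_convergence[where w = "\<lambda>_. 1"])
    show "AE u in spectral_space f. (\<lambda>i. (?v u powr X i - ?v u powr s)\<^sup>2) \<longlonglongrightarrow> 0"
    proof (rule AE_I2)
      fix u assume "u \<in> space (spectral_space f)"
      then have "(\<lambda>i. (?v u powr X i - ?v u powr s)\<^sup>2) \<longlonglongrightarrow> (?v u powr s - ?v u powr s)\<^sup>2"
        using v[of u] X(2) by (intro tendsto_intros) auto
      then show "(\<lambda>i. (?v u powr X i - ?v u powr s)\<^sup>2) \<longlonglongrightarrow> 0" by simp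
    qed
    show "AE u in spectral_space f. norm ((?v u powr X i - ?v u powr s)\<^sup>2) \<le> 1" for i
    proof (rule AE_I2)
      fix u assume "u \<in> space (spectral_space f)"
      then have "?v u powr X i \<le> 1" "?v u powr s \<le> 1" "0 \<le> ?v u powr X i" "0 \<le> ?v u powr s"
        using v[of u] X0[of i] s by (auto intro: powr_le1)
      then have "\<bar>?v u powr X i - ?v u powr s\<bar> \<le> 1" by linarith
      then have "\<bar>?v u powr X i - ?v u powr s\<bar>\<^sup>2 \<le> 1\<^sup>2" by (intro power_mono) auto
      then show "norm ((?v u powr X i - ?v u powr s)\<^sup>2) \<le> 1" by simp
    qed
  qed (use v_meas in measurable)
  moreover have "L2_norm \<mu> (\<lambda>x. iso_power \<mu> \<sigma> (X i) f x - iso_power \<mu> \<sigma> s f x) =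
      L2_norm \<mu> (\<lambda>x. power_op (X i) f x - power_op s f x)" for i
  proof (rule L2_norm_AE_cong)
    show "AE x in \<mu>. iso_power \<mu> \<sigma> (X i) f x - iso_power \<mu> \<sigma> s f x = power_op (X i) f x - power_op s f x"
      using iso_power_eq[OF X0 f] iso_power_eq[OF s f] by eventually_elim simp
  qed (intro L2_diff iso_power_L2 power_op_L2 X0 s f)+
  ultimately have "(\<lambda>i. (L2_norm \<mu> (\<lambda>x. iso_power \<mu> \<sigma> (X i) f x - iso_power \<mu> \<sigma> s f x))\<^sup>2) \<longlonglongrightarrow> 0"
    by (simp add: norm_power_op_diff[OF f s X0])
  from tendsto_real_sqrt[OF this]
  show "((\<lambda>t. L2_norm \<mu> (\<lambda>x. iso_power \<mu> \<sigma> t f x - iso_power \<mu> \<sigma> s f x)) \<circ> X) \<longlonglongrightarrow> 0"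
    by (simp add: comp_def)
qed

end

section \<open>Markov property and heat kernel\<close>

context isotropic
begin

lemma borel_measurable_mu_iff: "f \<in> borel_measurable \<mu> \<longleftrightarrow> f \<in> borel_measurable borel"
  by (simp add: measurable_cong_sets[OF sets_mu refl])

lemma measurable_indicator_cball_times:
  "f \<in> borel_measurable borel \<Longrightarrow> (\<lambda>y. indicator (cball x r) y * f y :: real) \<in> borel_measurable \<mu>"
  by (intro borel_measurable_times borel_measurable_indicator) (auto simp: borel_measurable_mu_iff)

text \<open>A common class for L2 functions and bounded Borel functions, on which all averages are
  defined; the kernel formula is proved once for it.\<close>

definition ball_integrable :: "('a \<Rightarrow> real) \<Rightarrow> bool" where
  "ball_integrable f \<longleftrightarrow> f \<in> borel_measurable borel \<and>
    (\<forall>x r. integrable \<mu> (\<lambda>y. indicator (cball x r) y * f y))"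

lemma L2_ball_integrable: "f \<in> L2 \<mu> \<Longrightarrow> ball_integrable f"
  using L2_borel[of f \<mu>] by (simp add: ball_integrable_def integrable_indicator_cball borel_measurable_mu_iff)

lemma bounded_borel_ball_integrable:
  assumes f: "bounded_borel f" shows "ball_integrable f"
proof -
  obtain C where C: "\<And>x. \<bar>f x\<bar> \<le> C" using f by (auto simp: bounded_borel_def bounded_iff)
  have f_meas: "f \<in> borel_measurable borel" using f by (simp add: bounded_borel_def)
  have "integrable \<mu> (\<lambda>y. indicator (cball x r) y * f y)" for x r
  proof (rule Bochner_Integration.integrable_bound)
    show "integrable \<mu> (\<lambda>y. C * indicat_real (cball x r) y)"
      using emeasure_cball_finite[of x r] by simp
    show "AE y in \<mu>. norm (indicator (cball x r) y * f y) \<le> norm (C * indicat_real (cball x r) y)"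
      using C by (auto simp: indicator_def intro: order_trans[OF _ abs_ge_self])
  qed (rule measurable_indicator_cball_times[OF f_meas])
  with f_meas show ?thesis by (simp add: ball_integrable_def)
qed

text \<open>Tonelli treats nonnegative functions, so signed ones enter through their positive and
  negative parts, with the modulus controlling both.\<close>

lemma ball_integrable_split:
  assumes f: "ball_integrable f"
  shows "ball_integrable (\<lambda>y. max 0 (f y))" "ball_integrable (\<lambda>y. max 0 (- f y))"
    "ball_integrable (\<lambda>y. \<bar>f y\<bar>)"
    "avg \<mu> r f x = avg \<mu> r (\<lambda>y. max 0 (f y)) x - avg \<mu> r (\<lambda>y. max 0 (- f y)) x"
    "avg \<mu> r (\<lambda>y. \<bar>f y\<bar>) x = avg \<mu> r (\<lambda>y. max 0 (f y)) x + avg \<mu> r (\<lambda>y. max 0 (- f y)) x"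
proof -
  have f_meas: "f \<in> borel_measurable borel" using f by (simp add: ball_integrable_def)
  have int: "integrable \<mu> (\<lambda>y. indicator (cball x r) y * h (f y))"
    if h: "h \<in> borel_measurable borel" "\<And>v :: real. \<bar>h v\<bar> \<le> \<bar>v\<bar>" for h :: "real \<Rightarrow> real" and x r
  proof (rule Bochner_Integration.integrable_bound)
    show "integrable \<mu> (\<lambda>y. indicator (cball x r) y * f y)" using f by (simp add: ball_integrable_def)
    show "AE y in \<mu>. norm (indicator (cball x r) y * h (f y)) \<le> norm (indicator (cball x r) y * f y)"
      using h(2) by (auto simp: indicator_def)
    show "(\<lambda>y. indicator (cball x r) y * h (f y)) \<in> borel_measurable \<mu>"
      by (rule measurable_indicator_cball_times[OF measurable_compose[OF f_meas h(1)]])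
  qed
  have bi: "ball_integrable (\<lambda>y. h (f y))"
    if h: "h \<in> borel_measurable borel" "\<And>v :: real. \<bar>h v\<bar> \<le> \<bar>v\<bar>" for h :: "real \<Rightarrow> real"
    unfolding ball_integrable_def using int[OF h] measurable_compose[OF f_meas h(1)] by simp
  show *: "ball_integrable (\<lambda>y. max 0 (f y))" by (rule bi[of "max 0"]) auto
  show **: "ball_integrable (\<lambda>y. max 0 (- f y))" by (rule bi[of "\<lambda>v. max 0 (- v)"]) auto
  show "ball_integrable (\<lambda>y. \<bar>f y\<bar>)" by (rule bi[of abs]) auto
  note ints = *[unfolded ball_integrable_def] **[unfolded ball_integrable_def]
  have "(\<integral>y. indicator (cball x r) y * f y \<partial>\<mu>) =
      (\<integral>y. indicator (cball x r) y * max 0 (f y) - indicator (cball x r) y * max 0 (- f y) \<partial>\<mu>)"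
    by (intro Bochner_Integration.integral_cong) (auto simp: indicator_def)
  also have "\<dots> = (\<integral>y. indicator (cball x r) y * max 0 (f y) \<partial>\<mu>) - (\<integral>y. indicator (cball x r) y * max 0 (- f y) \<partial>\<mu>)"
    using ints by (intro Bochner_Integration.integral_diff) auto
  finally show "avg \<mu> r f x = avg \<mu> r (\<lambda>y. max 0 (f y)) x - avg \<mu> r (\<lambda>y. max 0 (- f y)) x"
    by (auto simp: avg_eq diff_divide_distrib)
  have "(\<integral>y. indicator (cball x r) y * \<bar>f y\<bar> \<partial>\<mu>) =
      (\<integral>y. indicator (cball x r) y * max 0 (f y) + indicator (cball x r) y * max 0 (- f y) \<partial>\<mu>)"
    by (intro Bochner_Integration.integral_cong) (auto simp: indicator_def)
  also have "\<dots> = (\<integral>y. indicator (cball x r) y * max 0 (f y) \<partial>\<mu>) + (\<integral>y. indicator (cball x r) y * max 0 (- f y) \<partial>\<mu>)"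
    using ints by (intro Bochner_Integration.integral_add) auto
  finally show "avg \<mu> r (\<lambda>y. \<bar>f y\<bar>) x = avg \<mu> r (\<lambda>y. max 0 (f y)) x + avg \<mu> r (\<lambda>y. max 0 (- f y)) x"
    by (auto simp: avg_eq add_divide_distrib)
qed

lemma avg_abs_le:
  assumes f: "ball_integrable f" and C: "\<And>y. \<bar>f y\<bar> \<le> C"
  shows "\<bar>avg \<mu> r f x\<bar> \<le> C"
proof (cases "0 < r")
  case True
  let ?m = "measure \<mu> (cball x r)"
  have m: "0 < ?m" using True by (rule measure_cball_pos)
  have int: "integrable \<mu> (\<lambda>y. indicator (cball x r) y * f y)" using f by (simp add: ball_integrable_def)
  have "\<bar>\<integral>y. indicator (cball x r) y * f y \<partial>\<mu>\<bar> \<le> (\<integral>y. C * indicat_real (cball x r) y \<partial>\<mu>)"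
  proof (rule order_trans[OF integral_abs_bound integral_mono])
    show "integrable \<mu> (\<lambda>y. \<bar>indicator (cball x r) y * f y\<bar>)" using int by simp
    show "integrable \<mu> (\<lambda>y. C * indicat_real (cball x r) y)"
      using emeasure_cball_finite[of x r] by simp
    show "\<bar>indicator (cball x r) y * f y\<bar> \<le> C * indicat_real (cball x r) y" for y
      using C[of y] by (auto simp: indicator_def)
  qed
  then have "\<bar>\<integral>y. indicator (cball x r) y * f y \<partial>\<mu>\<bar> \<le> C * ?m" by simp
  with True m show ?thesis by (simp add: avg_eq abs_divide pos_divide_le_eq)
qed (use C in \<open>simp add: avg_nonpos\<close>)

lemma measurable_avg_radius:
  assumes N: "ray_measure N" and f: "f \<in> borel_measurable borel"
  shows "(\<lambda>r. avg \<mu> r f x) \<in> borel_measurable N"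
  using f by (intro measurable_avg ray_measure_borel[OF N]) auto

lemma integrable_avg_radius:
  assumes N: "ray_measure N" and f: "ball_integrable f" and C: "\<And>y. \<bar>f y\<bar> \<le> C"
  shows "integrable N (\<lambda>r. avg \<mu> r f x)"
proof -
  interpret finite_measure N by (rule ray_measure_finite[OF N])
  show ?thesis
    using f avg_abs_le[OF f C]
    by (intro integrable_const_bound[where B = C] measurable_avg_radius N) (auto simp: ball_integrable_def)
qed

lemma bounded_borel_avg_mix:
  assumes N: "ray_measure N" and f: "bounded_borel f"
  shows "bounded_borel (avg_mix N f)"
proof -
  interpret finite_measure N by (rule ray_measure_finite[OF N])
  interpret Q: pair_sigma_finite N \<mu> ..
  obtain C where C: "\<And>x. \<bar>f x\<bar> \<le> C" using f by (auto simp: bounded_borel_def bounded_iff)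
  note bi = bounded_borel_ball_integrable[OF f]
  have "f \<in> borel_measurable \<mu>" using f by (simp add: bounded_borel_def borel_measurable_mu_iff)
  then have "(\<lambda>(x, r). avg \<mu> r f x) \<in> borel_measurable (\<mu> \<Otimes>\<^sub>M N)"
    using measurable_pair_swap[OF measurable_avg_pair[OF N]] by (simp add: split_beta')
  then have "avg_mix N f \<in> borel_measurable \<mu>"
    unfolding avg_mix_def[abs_def] by (rule borel_measurable_lebesgue_integral)
  moreover have "norm (avg_mix N f x) \<le> C * measure N (space N)" for x
  proof -
    have "\<bar>avg_mix N f x\<bar> \<le> (\<integral>r. C \<partial>N)"
      unfolding avg_mix_def
      by (intro integral_abs_bound_integral integrable_avg_radius[OF N bi C] avg_abs_le[OF bi C]) auto
    then show ?thesis by (simp add: mult.commute)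
  qed
  ultimately show ?thesis
    unfolding bounded_borel_def by (auto simp: bounded_iff)
qed

lemma iso_power_bdd_eq: "0 < t \<Longrightarrow> iso_power_bdd \<mu> \<sigma> t f x = avg_mix (sigma_pow \<sigma> t) f x"
  by (simp add: iso_power_bdd_def avg_mix_def)

lemma measure_sigma_pow_space: "0 < t \<Longrightarrow> measure (sigma_pow \<sigma> t) (space (sigma_pow \<sigma> t)) = 1"
  using measure_power_measure_space[of t]
  by (simp add: power_measure_def ray_measure_space[OF ray_measure_sigma_pow])

lemma markov_operator_iso_power:
  assumes t: "0 \<le> t" shows "markov_operator \<mu> (iso_power \<mu> \<sigma> t) (iso_power_bdd \<mu> \<sigma> t)"
proof (cases "t = 0")
  case True
  have "iso_power_bdd \<mu> \<sigma> 0 f = f" for f by (auto simp: iso_power_bdd_def)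
  with True show ?thesis
    using iso_power_operator[OF t] by (simp add: markov_operator_def iso_power_def)
next
  case False
  with t have t: "0 < t" by simp
  let ?N = "sigma_pow \<sigma> t"
  have N: "ray_measure ?N" using t by (rule ray_measure_sigma_pow)
  have bdd_eq: "iso_power_bdd \<mu> \<sigma> t f = avg_mix ?N f" for f
    using iso_power_bdd_eq[OF t] by auto
  have eq: "AE x in \<mu>. iso_power \<mu> \<sigma> t f x = avg_mix ?N f x" if "f \<in> L2 \<mu>" for f
    using iso_power_eq[OF less_imp_le[OF t] that] by (simp add: power_op_pos t)
  show ?thesis
    unfolding markov_operator_def bdd_eq
  proof (intro conjI allI ballI impI)
    fix f assume f: "f \<in> L2 \<mu>" and pos: "AE x in \<mu>. 0 \<le> f x"
    \<comment> \<open>For r > 0 an average ignores null sets and is nonnegative at every x. At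
      radius 0 it is f x itself, so the conclusion is drawn only for almost every x.\<close>
    have avg_pos: "0 \<le> avg \<mu> r f x" if "0 < r" for r x
      using that pos by (simp add: avg_eq) (intro divide_nonneg_nonneg integral_nonneg_AE, auto elim: eventually_mono)
    show "AE x in \<mu>. 0 \<le> iso_power \<mu> \<sigma> t f x"
      using eq[OF f] pos
    proof eventually_elim
      case (elim x)
      have "0 \<le> avg \<mu> r f x" for r using avg_pos[of r x] elim by (cases "0 < r") (auto simp: avg_nonpos)
      then show ?case unfolding elim avg_mix_def by (intro Bochner_Integration.integral_nonneg)
    qed
  next
    show "avg_mix ?N (\<lambda>_. 1) x = 1" for x
      using measure_sigma_pow_space[OF t] by (simp add: avg_mix_def avg_const)
  next
    fix f :: "'a \<Rightarrow> real" and x assume "bounded_borel f \<and> (\<forall>x. 0 \<le> f x)"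
    then show "0 \<le> avg_mix ?N f x"
      unfolding avg_mix_def by (intro Bochner_Integration.integral_nonneg avg_nonneg) auto
  qed (use t eq bounded_borel_avg_mix[OF N] iso_power_operator in auto)
qed

lemma symmetric_markov: "symmetric_markov_semigroup \<mu> (iso_power \<mu> \<sigma>) (iso_power_bdd \<mu> \<sigma>)"
  unfolding symmetric_markov_semigroup_def
  using L2_selfadjoint_cong[OF power_op_selfadjoint iso_power_operator iso_power_eq]
    markov_operator_iso_power iso_power_add
  by (auto simp: iso_power_def[of _ _ 0])

context
  fixes t :: real
  assumes t: "0 < t"
begin

section \<open>The integral kernel\<close>

lemma measurable_kernel_integrand:
  "(\<lambda>(y, r). 1 / emeasure \<mu> (cball x r) * indicator {dist x y..} r) \<in> borel_measurable (\<mu> \<Otimes>\<^sub>M sigma_pow \<sigma> t)"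
proof -
  have em: "emeasure \<mu> (cball x r) = ennreal (measure \<mu> (cball x r))" for r
    using emeasure_cball_finite[of x r] by (intro emeasure_eq_ennreal_measure) auto
  have [measurable]: "snd \<in> borel_measurable (\<mu> \<Otimes>\<^sub>M sigma_pow \<sigma> t)"
    by (rule measurable_compose[OF measurable_snd ray_measure_borel[OF ray_measure_sigma_pow[OF t]]])
  have [measurable]: "(\<lambda>_. x) \<in> (\<mu> \<Otimes>\<^sub>M sigma_pow \<sigma> t) \<rightarrow>\<^sub>M \<mu>" by simp
  show ?thesis unfolding em split_beta' indicator_def atLeast_iff by measurable
qed

lemma measurable_iso_kernel: "iso_kernel \<mu> \<sigma> t x \<in> borel_measurable \<mu>"
proof -
  interpret N: finite_measure "sigma_pow \<sigma> t" by (rule ray_measure_finite[OF ray_measure_sigma_pow[OF t]])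
  show ?thesis
    unfolding iso_kernel_def[abs_def]
    by (rule N.borel_measurable_nn_integral[OF measurable_kernel_integrand])
qed

text \<open>After Tonelli the condition dist x y \<le> r is read for fixed r as y \<in> cball x r,
  and the inner integral becomes the average Q_r f x.\<close>

lemma nn_integral_iso_kernel:
  assumes f: "ball_integrable f" and pos: "\<And>y. 0 \<le> f y"
  shows "(\<integral>\<^sup>+y. ennreal (f y) \<partial>density \<mu> (iso_kernel \<mu> \<sigma> t x)) = (\<integral>\<^sup>+r. ennreal (avg \<mu> r f x) \<partial>sigma_pow \<sigma> t)"
proof -
  let ?N = "sigma_pow \<sigma> t" and ?k = "\<lambda>y r. 1 / emeasure \<mu> (cball x r) * indicator {dist x y..} r"
  interpret N: finite_measure ?N by (rule ray_measure_finite[OF ray_measure_sigma_pow[OF t]])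
  interpret Q: pair_sigma_finite \<mu> ?N ..
  have [measurable]: "f \<in> borel_measurable borel" using f by (simp add: ball_integrable_def)
  have f_mu: "f \<in> borel_measurable \<mu>" by (simp add: borel_measurable_mu_iff)
  note k = measurable_kernel_integrand[of x]
  have k_fst: "(\<lambda>r. ?k y r) \<in> borel_measurable ?N" for y
    using measurable_Pair2[OF k, of y] by simp
  have "(\<lambda>p. ennreal (f (fst p))) \<in> borel_measurable (\<mu> \<Otimes>\<^sub>M ?N)"
    by (rule measurable_compose[OF measurable_compose[OF measurable_fst f_mu] measurable_ennreal])
  with k have "(\<lambda>p. (case p of (y, r) \<Rightarrow> ?k y r) * ennreal (f (fst p))) \<in> borel_measurable (\<mu> \<Otimes>\<^sub>M ?N)"
    by (rule borel_measurable_times_ennreal)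
  then have kf: "(\<lambda>(y, r). ?k y r * ennreal (f y)) \<in> borel_measurable (\<mu> \<Otimes>\<^sub>M ?N)"
    by (simp add: split_beta')
  have "(\<integral>\<^sup>+y. ennreal (f y) \<partial>density \<mu> (iso_kernel \<mu> \<sigma> t x)) = (\<integral>\<^sup>+y. iso_kernel \<mu> \<sigma> t x y * ennreal (f y) \<partial>\<mu>)"
    using measurable_iso_kernel by (intro nn_integral_density) auto
  also have "\<dots> = (\<integral>\<^sup>+y. (\<integral>\<^sup>+r. ?k y r * ennreal (f y) \<partial>?N) \<partial>\<mu>)"
    unfolding iso_kernel_def by (intro nn_integral_cong nn_integral_multc[symmetric] k_fst)
  also have "\<dots> = (\<integral>\<^sup>+r. (\<integral>\<^sup>+y. ?k y r * ennreal (f y) \<partial>\<mu>) \<partial>?N)"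
    by (rule Q.Fubini'[OF kf, symmetric])
  also have "\<dots> = (\<integral>\<^sup>+r. ennreal (avg \<mu> r f x) \<partial>?N)"
  proof (rule nn_integral_cong_AE)
    \<comment> \<open>At r = 0 the kernel side integrates over the single point x, whose measure may
      vanish, while Q_0 f x = f x. The radius 0 has no mass.\<close>
    have "AE r in ?N. 0 < r"
      unfolding sigma_pow_eq by (rule AE_mix_measure_pos[OF stieltjes_integrator_powr[OF t]])
    then show "AE r in ?N. (\<integral>\<^sup>+y. ?k y r * ennreal (f y) \<partial>\<mu>) = ennreal (avg \<mu> r f x)"
    proof eventually_elim
      case (elim r)
      let ?m = "measure \<mu> (cball x r)"
      have m: "0 < ?m" using elim by (rule measure_cball_pos)
      have em: "emeasure \<mu> (cball x r) = ennreal ?m"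
        using emeasure_cball_finite[of x r] by (intro emeasure_eq_ennreal_measure) auto
      have "(\<integral>\<^sup>+y. ?k y r * ennreal (f y) \<partial>\<mu>) = (\<integral>\<^sup>+y. ennreal (indicator (cball x r) y * f y / ?m) \<partial>\<mu>)"
        using m pos unfolding em
        by (intro nn_integral_cong) (auto simp: indicator_def divide_ennreal[symmetric] ennreal_times_divide mult.commute)
      also have "\<dots> = ennreal (\<integral>y. indicator (cball x r) y * f y / ?m \<partial>\<mu>)"
        using f pos by (intro nn_integral_eq_integral) (auto simp: ball_integrable_def)
      also have "\<dots> = ennreal (avg \<mu> r f x)" using elim by (simp add: avg_eq)
      finally show ?case .
    qed
  qed
  finally show ?thesis .
qed

text \<open>The positive and negative parts are treated separately; integrability of the averages of
  |f| at x makes both integrals finite, so that they may be subtracted.\<close>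

lemma has_kernel_value_avg_mix:
  assumes f: "ball_integrable f" and int: "integrable (sigma_pow \<sigma> t) (\<lambda>r. avg \<mu> r (\<lambda>y. \<bar>f y\<bar>) x)"
  shows "has_kernel_value \<mu> (iso_kernel \<mu> \<sigma> t x) f (avg_mix (sigma_pow \<sigma> t) f x)"
proof -
  let ?N = "sigma_pow \<sigma> t" and ?D = "density \<mu> (iso_kernel \<mu> \<sigma> t x)"
  have N: "ray_measure ?N" using t by (rule ray_measure_sigma_pow)
  let ?p = "\<lambda>y. max 0 (f y)" and ?n = "\<lambda>y. max 0 (- f y)"
  note split = ball_integrable_split[OF f]
  have [measurable]: "f \<in> borel_measurable borel" using f by (simp add: ball_integrable_def)
  have f_D: "f \<in> borel_measurable ?D" by simp
  have part: "integrable ?D h \<and> integrable ?N (\<lambda>r. avg \<mu> r h x) \<and> (\<integral>y. h y \<partial>?D) = (\<integral>r. avg \<mu> r h x \<partial>?N)"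
    if h: "ball_integrable h" "\<And>y. 0 \<le> h y" and le: "\<And>r. avg \<mu> r h x \<le> avg \<mu> r (\<lambda>y. \<bar>f y\<bar>) x" for h
  proof -
    have avg_h: "0 \<le> avg \<mu> r h x" for r by (intro avg_nonneg h(2))
    have h_meas: "h \<in> borel_measurable borel" using h(1) by (simp add: ball_integrable_def)
    have int_N: "integrable ?N (\<lambda>r. avg \<mu> r h x)"
    proof (rule Bochner_Integration.integrable_bound[OF int])
      show "AE r in ?N. norm (avg \<mu> r h x) \<le> norm (avg \<mu> r (\<lambda>y. \<bar>f y\<bar>) x)"
        using avg_h le by (intro AE_I2) (simp add: order_trans[OF _ abs_ge_self])
    qed (rule measurable_avg_radius[OF N h_meas])
    have nn: "(\<integral>\<^sup>+y. ennreal (h y) \<partial>?D) = ennreal (\<integral>r. avg \<mu> r h x \<partial>?N)"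
      unfolding nn_integral_iso_kernel[OF h] using int_N avg_h by (intro nn_integral_eq_integral) auto
    have "h \<in> borel_measurable ?D" using h_meas by simp
    moreover have "0 \<le> (\<integral>r. avg \<mu> r h x \<partial>?N)" using avg_h by (rule Bochner_Integration.integral_nonneg)
    ultimately show ?thesis
      using int_N nn h(2) by (auto intro: integrableI_nn_integral_finite simp: integral_eq_nn_integral)
  qed
  have p: "integrable ?D ?p \<and> integrable ?N (\<lambda>r. avg \<mu> r ?p x) \<and> (\<integral>y. ?p y \<partial>?D) = (\<integral>r. avg \<mu> r ?p x \<partial>?N)"
    using avg_nonneg[of ?n] by (intro part split(1)) (auto simp: split(5))
  have n: "integrable ?D ?n \<and> integrable ?N (\<lambda>r. avg \<mu> r ?n x) \<and> (\<integral>y. ?n y \<partial>?D) = (\<integral>r. avg \<mu> r ?n x \<partial>?N)"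
    using avg_nonneg[of ?p] by (intro part split(2)) (auto simp: split(5))
  have f_eq: "f = (\<lambda>y. ?p y - ?n y)" by auto
  have "integrable ?D (\<lambda>y. ?p y - ?n y)" using p n by (intro Bochner_Integration.integrable_diff) auto
  then have int_f: "integrable ?D f" unfolding f_eq[symmetric] .
  have "(\<integral>y. f y \<partial>?D) = (\<integral>y. ?p y - ?n y \<partial>?D)" by (intro Bochner_Integration.integral_cong) auto
  also have "\<dots> = (\<integral>r. avg \<mu> r ?p x \<partial>?N) - (\<integral>r. avg \<mu> r ?n x \<partial>?N)"
    using p n by (subst Bochner_Integration.integral_diff) auto
  also have "\<dots> = (\<integral>r. avg \<mu> r f x \<partial>?N)"
    unfolding split(4) using p n by (subst Bochner_Integration.integral_diff) auto
  finally show ?thesis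
    unfolding has_kernel_value_def avg_mix_def using measurable_iso_kernel int_f by simp
qed

lemma has_kernel_value_bounded_borel:
  assumes f: "bounded_borel f"
  shows "has_kernel_value \<mu> (iso_kernel \<mu> \<sigma> t x) f (iso_power_bdd \<mu> \<sigma> t f x)"
  unfolding iso_power_bdd_eq[OF t]
proof (rule has_kernel_value_avg_mix)
  obtain C where "\<And>x. \<bar>f x\<bar> \<le> C" using f by (auto simp: bounded_borel_def bounded_iff)
  then show "integrable (sigma_pow \<sigma> t) (\<lambda>r. avg \<mu> r (\<lambda>y. \<bar>f y\<bar>) x)"
    by (intro integrable_avg_radius[where C = C] ray_measure_sigma_pow t
        ball_integrable_split(3) bounded_borel_ball_integrable f) simp
qed (rule bounded_borel_ball_integrable[OF f])

text \<open>Two exceptional null sets combine: where the chosen power differs from its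
  representative, and where the averages of |f| fail to be integrable in r.\<close>

lemma has_kernel_value_L2:
  assumes f: "f \<in> L2 \<mu>"
  shows "AE x in \<mu>. has_kernel_value \<mu> (iso_kernel \<mu> \<sigma> t x) f (iso_power \<mu> \<sigma> t f x)"
  using iso_power_eq[OF less_imp_le[OF t] f] avg_mix_AE_integrable[OF ray_measure_sigma_pow[OF t] L2_abs[OF f]]
proof eventually_elim
  case (elim x)
  with has_kernel_value_avg_mix[OF L2_ball_integrable[OF f], of x] show ?case
    by (simp add: power_op_pos t)
qed

end

end

theorem theorem2p2:
  fixes \<mu> :: "'a::metric_space measure" and \<sigma> :: "ennreal \<Rightarrow> real"
  assumes "ultrametric TYPE('a)"
    and "separable_space (euclidean :: 'a topology)"
    and "\<And>(x::'a) r. compact (cball x r)"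
    and "radon_measure \<mu>" and "full_support \<mu>"
    and "distance_distribution \<sigma>"
  shows
    \<comment> \<open>first conjunct: the operators are well-defined; then (a), (b), (c)\<close>
    "(has_strong_integral \<mu> (stieltjes_measure (\<lambda>r. \<sigma> (ennreal r))) (avg \<mu>) (iso_op \<mu> \<sigma>) \<and>
      L2_selfadjoint \<mu> (iso_op \<mu> \<sigma>) \<and> L2_spectrum \<mu> (iso_op \<mu> \<sigma>) \<subseteq> {0..1} \<and>
      (\<forall>t>0. is_fun_calc \<mu> (iso_op \<mu> \<sigma>) (\<lambda>l. l powr t) (iso_power \<mu> \<sigma> t))) \<and>
     (symmetric_markov_semigroup \<mu> (iso_power \<mu> \<sigma>) (iso_power_bdd \<mu> \<sigma>) \<and>
      strongly_continuous \<mu> (iso_power \<mu> \<sigma>)) \<and>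
     (\<forall>t>0. has_strong_integral \<mu> (sigma_pow \<sigma> t) (avg \<mu>) (iso_power \<mu> \<sigma> t)) \<and>
     (\<forall>t>0.
       (\<forall>f. bounded_borel f \<longrightarrow>
          (\<forall>x. has_kernel_value \<mu> (iso_kernel \<mu> \<sigma> t x) f (iso_power_bdd \<mu> \<sigma> t f x))) \<and>
       (\<forall>f\<in>L2 \<mu>. AE x in \<mu>.
          has_kernel_value \<mu> (iso_kernel \<mu> \<sigma> t x) f (iso_power \<mu> \<sigma> t f x)))"
proof -
  interpret isotropic \<mu> \<sigma>
    using assms by unfold_locales
  show ?thesis
    using iso_op_strong_integral iso_op_selfadjoint spectrum_subset is_fun_calc_iso_power
      symmetric_markov iso_power_strongly_continuous iso_power_strong_integral
      has_kernel_value_bounded_borel has_kernel_value_L2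
    by (intro conjI allI impI ballI) auto
qed

end
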